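(* Let $\mathcal{G}_P$ be the parallelogram bar-joint framework of a regular multigrid parallelogram tiling $P$ of $\mathbb{R}^2$ and let $\underline{a}$ be a basis for $\mathbb{R}^2$. Then \[ {\bf L}_{\rm lim}(\mathcal{G}_P,\underline{a})={\bf L}_{\rm slip}(\mathcal{G}_P,\underline{a})=RF(P)^{\underline{a}}. \]
   Context: Frameworks. A bar-joint framework $\mathcal{G}=(G,p)$ in $\mathbb{R}^2$ is a countable simple graph $G=(V,E)$ with a placement $p:V\to\mathbb{R}^2$ by distinct points (joints). It is a Delone framework if its set of joints is a Delone set (uniformly discrete and relatively dense) and the bar lengths $|p(v)-p(w)|$, $vw\in E$, are uniformly bounded. A velocity field is a map $u:p(V)\to\mathbb{C}^2$; it is an infinitesimal flex if $\langle u(p(v))-u(p(w)),p(v)-p(w)\rangle=0$ for all $vw\in E$. A line figure is a set of lines through the origin (identified with its union). Phase fields. Let $\underline{\bf t}=\{{\bf t_1},{\bf t_2}\}$ be a basis of $\mathbb{R}^2$ and $C_k=\{s_1{\bf t_1}+s_2{\bf t_2}:k_i\le s_i<k_i+1\}$, $k\in\mathbb{Z}^2$, its cells. For $\omega=(\omega_1,\omega_2)\in\mathbb{T}^2$ ($\mathbb{T}$ the unit circle), the phase field $\phi_{\omega,\underline{\bf t}}:\mathbb{R}^2\to\mathbb{T}$ takes the value $\omega_1^{k_1}\omega_2^{k_2}$ on $C_k$. For a matrix $B=(b_{l,m})_{0\le l\le L-1,\,0\le m\le M-1}$ of vectors in $\mathbb{C}^2$ (a unit cell velocity vector matrix, of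 some size $L\times M$), $\phi_{\omega,\underline{\bf t}}\otimes B$ is the velocity field on $\mathbb{R}^2$ which takes the value $b_{l,m}$ on the $(l,m)$ subcell $\{s_1{\bf t_1}+s_2{\bf t_2}: l/L\le s_1<(l+1)/L,\ m/M\le s_2<(m+1)/M\}$ of $C_{(0,0)}$ and the value $\omega_1^{k_1}\omega_2^{k_2}b_{l,m}$ on the translate of this subcell by $k_1{\bf t_1}+k_2{\bf t_2}$. For a scalar function $\phi$ on $\mathbb{R}^2$ and a velocity field $u$, the modulation $\phi\cdot u$ is the pointwise product. $\tau_b$ denotes the constant velocity field with value $b$. Closeness. Velocity fields $u,z$ on the set $J$ of joints are mostly $\epsilon$-close if there is $N_0$ such that for all $N\ge N_0$ and every translate $S$ of the square $[-N,N]^2$, $|\{p\in J\cap S:\|u(p)-z(p)\|_2>\epsilon\}|<\epsilon|J\cap S|$. Periodic slippage lines. A line $H=\mathbb{R}{\bf t_1}$ is a periodic slippage line for a Delone framework $\mathcal{G}$ if there are a nonzero $b\in\mathbb{R}^2$ and a vector ${\bf t_2}$, with $\{{\bf t_1},{\bf t_2}\}$ a basis, such that for every $\epsilon>0$ there are an infinitesimal flex $u$ of $\mathcal{G}$ and a positive integer $M$ with: (i) $\phi_{(1,\lambda),\{{\bf t_1},M{\bf t_2}\}}\cdot u$ is an infinitesimal flex for all $\lambda\in\mathbb{T}$; (ii) $\phi_{(1,\lambda),\{{\bf t_1},M{\bf t_2}\}}\cdot u$ is mostly $\epsilon$-close to the restriction to the joints of $\phi_{(1,\lambda),\{{\bf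 t_1},M{\bf t_2}\}}\cdot\tau_b$ for all $\lambda\in\mathbb{T}$. $PSF(\mathcal{G})$ is the union of the periodic slippage lines. Periodic localisation lines. A line $H=\mathbb{R}{\bf t_1}$ is a periodic localisation line for a Delone framework $\mathcal{G}$ if there is a basis $\{{\bf t_1},{\bf t_2}\}$ such that for every $\epsilon>0$ there are a nonzero infinitesimal flex $u$, a phase factor $\lambda_1\in\mathbb{T}$ and positive integers $M_1,M_2$ with: (i) $\phi_{(\lambda_1,\lambda),\{M_1{\bf t_1},M_2{\bf t_2}\}}\cdot u$ is an infinitesimal flex for all $\lambda\in\mathbb{T}$; (ii) for some unit cell velocity vector matrix $B$, $\phi_{(\lambda_1,\lambda),\{M_1{\bf t_1},M_2{\bf t_2}\}}\cdot u$ is mostly $\epsilon$-close to the restriction to the joints of $\phi_{(\lambda_1,\lambda),\{M_1{\bf t_1},M_2{\bf t_2}\}}\otimes B$ for all $\lambda\in\mathbb{T}$. $PLLF(\mathcal{G})$ is the union of the periodic localisation lines. Reciprocal figures and spectra. For a basis $\underline{a}=\{a_1,a_2\}$ of $\mathbb{R}^2$ and a line $H=\mathbb{R}(\alpha a_1+\beta a_2)$, the reciprocal line is $H^{\underline{a}}=\mathbb{R}(\beta,-\alpha)$ in the reciprocal space $\mathbb{R}^2_{\bf k}$ (a copy of $\mathbb{R}^2$ with standard basis). For a line figure $F$, $F^{\underline{a}}$ is the union of the lines $H^{\underline{a}}$, $H$ a line of $F$. The slippage spectrum is ${\bf L}_{\rm slip}(\mathcal{G},\underline{a})=PSF(\mathcal{G})^{\underline{a}}$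 and the limit spectrum is ${\bf L}_{\rm lim}(\mathcal{G},\underline{a})=PLLF(\mathcal{G})^{\underline{a}}$. Multigrid tilings (de Bruijn, Beenker). A multigrid is a union of $r\ge2$ component grids, the $j$th consisting of the parallel lines $\{x:\langle x,n_j\rangle+\gamma_j=ks_j\}$, $k\in\mathbb{Z}$, with unit normals $n_j$ pairwise non-parallel, spacings $s_j>0$ and shifts $\gamma_j\in\mathbb{R}$. It is regular if no point lies on more than two of the lines. The associated parallelogram tiling $P$ is the dual tiling: fix edge vectors $d_j=\ell_jn_j$, $\ell_j>0$; each connected component of the complement of the multigrid gives a vertex $\sum_jK_j(x)d_j$, where $x$ is any point of the component and $K_j(x)=\lceil(\langle x,n_j\rangle+\gamma_j)/s_j\rceil$; components sharing a boundary segment on a line of the $j$th grid give vertices joined by an edge (a translate of $d_j$); and each intersection point of two grid lines gives a parallelogram tile. $\mathcal{G}_P$ is the bar-joint framework (a Delone framework) whose joints are the vertices of $P$ and whose bars are the edges of $P$. A ribbon of $P$ is a two-way infinite path of tiles, consecutive tiles sharing an edge, all the shared edges being translates of one another (these correspond to the lines of the multigrid). Each ribbon lies within a bounded distance of a unique line $H$ through the origin, and the ribbon figure $RF(P)$ is the union of the lines $H$ obtained in this way. *)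

theory Defs
  imports "HOL-Analysis.Analysis"
begin

section \<open>Bar-joint frameworks in the plane\<close>

record 'v framework =
  verts :: "'v set"
  bars :: "'v set set"
  place :: "'v \<Rightarrow> real^2"

definition bar_joint_framework :: "'v framework \<Rightarrow> bool" where
  "bar_joint_framework G \<longleftrightarrow>
     countable (verts G) \<and>
     (\<forall>e\<in>bars G. \<exists>v\<in>verts G. \<exists>w\<in>verts G. v \<noteq> w \<and> e = {v, w}) \<and>
     inj_on (place G) (verts G)"

definition joints :: "'v framework \<Rightarrow> (real^2) set" where
  "joints G = place G ` verts G"

definition relatively_dense :: "(real^2) set \<Rightarrow> bool" where
  "relatively_dense J \<longleftrightarrow> (\<exists>R. \<forall>x. \<exists>y\<in>J. dist x y \<le> R)"

definition Delone_set :: "(real^2) set \<Rightarrow> bool" where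
  "Delone_set J \<longleftrightarrow> uniform_discrete J \<and> relatively_dense J"

definition Delone_framework :: "'v framework \<Rightarrow> bool" where
  "Delone_framework G \<longleftrightarrow>
     bar_joint_framework G \<and> Delone_set (joints G) \<and>
     (\<exists>R. \<forall>v w. {v, w} \<in> bars G \<longrightarrow> norm (place G v - place G w) \<le> R)"

text \<open>Velocity fields are total functions on the plane of which only the values at the
  joints are ever used.\<close>

type_synonym velocity_field = "real^2 \<Rightarrow> complex^2"

definition infinitesimal_flex :: "'v framework \<Rightarrow> velocity_field \<Rightarrow> bool" where
  "infinitesimal_flex G u \<longleftrightarrow>
     (\<forall>v w. {v, w} \<in> bars G \<longrightarrow>
        (\<Sum>i\<in>UNIV. (u (place G v) - u (place G w)) $ i
                     * complex_of_real ((place G v - place G w) $ i)) = 0)"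

section \<open>Phase fields\<close>

definition plane_basis :: "real^2 \<Rightarrow> real^2 \<Rightarrow> bool" where
  "plane_basis t1 t2 \<longleftrightarrow> independent {t1, t2} \<and> span {t1, t2} = UNIV"

definition lattice_cell :: "real^2 \<Rightarrow> real^2 \<Rightarrow> int \<Rightarrow> int \<Rightarrow> (real^2) set" where
  "lattice_cell t1 t2 k1 k2 =
     {s1 *\<^sub>R t1 + s2 *\<^sub>R t2 | s1 s2.
        of_int k1 \<le> s1 \<and> s1 < of_int k1 + 1 \<and> of_int k2 \<le> s2 \<and> s2 < of_int k2 + 1}"

definition phase_field ::
    "complex \<Rightarrow> complex \<Rightarrow> real^2 \<Rightarrow> real^2 \<Rightarrow> real^2 \<Rightarrow> complex" where
  "phase_field \<omega>1 \<omega>2 t1 t2 x =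
     (THE z. \<exists>k1 k2. x \<in> lattice_cell t1 t2 k1 k2 \<and> z = \<omega>1 powi k1 * \<omega>2 powi k2)"

definition unit_subcell ::
    "real^2 \<Rightarrow> real^2 \<Rightarrow> nat \<Rightarrow> nat \<Rightarrow> nat \<Rightarrow> nat \<Rightarrow> (real^2) set" where
  "unit_subcell t1 t2 L M l m =
     {s1 *\<^sub>R t1 + s2 *\<^sub>R t2 | s1 s2.
        real l / real L \<le> s1 \<and> s1 < (real l + 1) / real L \<and>
        real m / real M \<le> s2 \<and> s2 < (real m + 1) / real M}"

text \<open>The field \<open>\<phi> \<otimes> B\<close>, for a unit cell velocity vector matrix \<open>B\<close> of size \<open>L \<times> M\<close>:
  the entries \<open>B l m\<close> with \<open>l < L\<close> and \<open>m < M\<close> are used.\<close>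

definition phase_tensor ::
    "complex \<Rightarrow> complex \<Rightarrow> real^2 \<Rightarrow> real^2 \<Rightarrow> nat \<Rightarrow> nat \<Rightarrow> (nat \<Rightarrow> nat \<Rightarrow> complex^2)
      \<Rightarrow> velocity_field" where
  "phase_tensor \<omega>1 \<omega>2 t1 t2 L M B x =
     (THE z. \<exists>k1 k2 l m. l < L \<and> m < M \<and>
        x \<in> (+) (of_int k1 *\<^sub>R t1 + of_int k2 *\<^sub>R t2) ` unit_subcell t1 t2 L M l m \<and>
        z = (\<omega>1 powi k1 * \<omega>2 powi k2) *s B l m)"

definition modulation :: "(real^2 \<Rightarrow> complex) \<Rightarrow> velocity_field \<Rightarrow> velocity_field" where
  "modulation \<phi> u = (\<lambda>x. \<phi> x *s u x)"

definition const_velocity :: "real^2 \<Rightarrow> velocity_field" where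
  "const_velocity b = (\<lambda>x. \<chi> i. complex_of_real (b $ i))"

definition mostly_close ::
    "(real^2) set \<Rightarrow> real \<Rightarrow> velocity_field \<Rightarrow> velocity_field \<Rightarrow> bool" where
  "mostly_close J \<epsilon> u z \<longleftrightarrow>
     (\<exists>N0::real. \<forall>N\<ge>N0. \<forall>c. let S = (+) c ` cbox (vec (- N)) (vec N) in
        real (card {x \<in> J \<inter> S. norm (u x - z x) > \<epsilon>}) < \<epsilon> * real (card (J \<inter> S)))"

section \<open>Line figures, slippage and localisation\<close>

definition origin_line :: "(real^2) set \<Rightarrow> bool" where
  "origin_line H \<longleftrightarrow> (\<exists>v. v \<noteq> 0 \<and> H = span {v})"

definition periodic_slippage_line :: "'v framework \<Rightarrow> (real^2) set \<Rightarrow> bool" where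
  "periodic_slippage_line G H \<longleftrightarrow>
     Delone_framework G \<and>
     (\<exists>t1 t2 b. H = span {t1} \<and> plane_basis t1 t2 \<and> b \<noteq> 0 \<and>
        (\<forall>\<epsilon>>0. \<exists>u. \<exists>M::nat. infinitesimal_flex G u \<and> M > 0 \<and>
           (\<forall>\<omega>\<in>sphere 0 1.
              infinitesimal_flex G (modulation (phase_field 1 \<omega> t1 (real M *\<^sub>R t2)) u)) \<and>
           (\<forall>\<omega>\<in>sphere 0 1.
              mostly_close (joints G) \<epsilon>
                (modulation (phase_field 1 \<omega> t1 (real M *\<^sub>R t2)) u)
                (modulation (phase_field 1 \<omega> t1 (real M *\<^sub>R t2)) (const_velocity b)))))"

definition PSF :: "'v framework \<Rightarrow> (real^2) set" where
  "PSF G = \<Union> {H. periodic_slippage_line G H}"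

definition periodic_localisation_line :: "'v framework \<Rightarrow> (real^2) set \<Rightarrow> bool" where
  "periodic_localisation_line G H \<longleftrightarrow>
     Delone_framework G \<and>
     (\<exists>t1 t2. H = span {t1} \<and> plane_basis t1 t2 \<and>
        (\<forall>\<epsilon>>0. \<exists>u. \<exists>\<omega>1\<in>sphere 0 1. \<exists>M1 M2 :: nat.
           infinitesimal_flex G u \<and> (\<exists>x\<in>joints G. u x \<noteq> 0) \<and> M1 > 0 \<and> M2 > 0 \<and>
           (\<forall>\<omega>\<in>sphere 0 1.
              infinitesimal_flex G
                (modulation (phase_field \<omega>1 \<omega> (real M1 *\<^sub>R t1) (real M2 *\<^sub>R t2)) u)) \<and>
           (\<exists>L M B. L > 0 \<and> M > 0 \<and>
             (\<forall>\<omega>\<in>sphere 0 1.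
                mostly_close (joints G) \<epsilon>
                  (modulation (phase_field \<omega>1 \<omega> (real M1 *\<^sub>R t1) (real M2 *\<^sub>R t2)) u)
                  (phase_tensor \<omega>1 \<omega> (real M1 *\<^sub>R t1) (real M2 *\<^sub>R t2) L M B)))))"

definition PLLF :: "'v framework \<Rightarrow> (real^2) set" where
  "PLLF G = \<Union> {H. periodic_localisation_line G H}"

definition reciprocal_line :: "real^2 \<Rightarrow> real^2 \<Rightarrow> (real^2) set \<Rightarrow> (real^2) set" where
  "reciprocal_line a1 a2 H =
     (THE K. \<exists>\<alpha> \<beta>. H = span {\<alpha> *\<^sub>R a1 + \<beta> *\<^sub>R a2} \<and> K = span {vector [\<beta>, - \<alpha>]})"

text \<open>A line figure is given by its union \<open>F\<close>; its lines are the lines through the origin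
  contained in \<open>F\<close>.\<close>

definition reciprocal_figure :: "real^2 \<Rightarrow> real^2 \<Rightarrow> (real^2) set \<Rightarrow> (real^2) set" where
  "reciprocal_figure a1 a2 F = \<Union> {reciprocal_line a1 a2 H | H. origin_line H \<and> H \<subseteq> F}"

definition slippage_spectrum :: "'v framework \<Rightarrow> real^2 \<Rightarrow> real^2 \<Rightarrow> (real^2) set" where
  "slippage_spectrum G a1 a2 = reciprocal_figure a1 a2 (PSF G)"

definition limit_spectrum :: "'v framework \<Rightarrow> real^2 \<Rightarrow> real^2 \<Rightarrow> (real^2) set" where
  "limit_spectrum G a1 a2 = reciprocal_figure a1 a2 (PLLF G)"

section \<open>Multigrid parallelogram tilings\<close>

text \<open>The component grids are indexed by \<open>j < grid_count \<Gamma>\<close>; the values of the other fields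
  at larger indices are irrelevant.\<close>

record multigrid =
  grid_count :: nat
  normal :: "nat \<Rightarrow> real^2"
  spacing :: "nat \<Rightarrow> real"
  shift :: "nat \<Rightarrow> real"

definition is_multigrid :: "multigrid \<Rightarrow> bool" where
  "is_multigrid \<Gamma> \<longleftrightarrow>
     grid_count \<Gamma> \<ge> 2 \<and>
     (\<forall>j<grid_count \<Gamma>. norm (normal \<Gamma> j) = 1 \<and> spacing \<Gamma> j > 0) \<and>
     (\<forall>i<grid_count \<Gamma>. \<forall>j<grid_count \<Gamma>. i \<noteq> j \<longrightarrow> span {normal \<Gamma> i} \<noteq> span {normal \<Gamma> j})"

definition grid_line :: "multigrid \<Rightarrow> nat \<Rightarrow> int \<Rightarrow> (real^2) set" where
  "grid_line \<Gamma> j k = {x. x \<bullet> normal \<Gamma> j + shift \<Gamma> j = of_int k * spacing \<Gamma> j}"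

definition grid_lines :: "multigrid \<Rightarrow> (real^2) set set" where
  "grid_lines \<Gamma> = {grid_line \<Gamma> j k | j k. j < grid_count \<Gamma>}"

definition regular_multigrid :: "multigrid \<Rightarrow> bool" where
  "regular_multigrid \<Gamma> \<longleftrightarrow>
     is_multigrid \<Gamma> \<and>
     \<not> (\<exists>x. \<exists>A\<in>grid_lines \<Gamma>. \<exists>B\<in>grid_lines \<Gamma>. \<exists>C\<in>grid_lines \<Gamma>.
           distinct [A, B, C] \<and> x \<in> A \<and> x \<in> B \<and> x \<in> C)"

definition grid_regions :: "multigrid \<Rightarrow> (real^2) set set" where
  "grid_regions \<Gamma> = components (- \<Union> (grid_lines \<Gamma>))"

text \<open>\<open>dual_point \<Gamma> len x\<close>, where \<open>len j\<close> is the length of the edge vector \<open>d\<^sub>j\<close>, is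
  \<open>\<Sum>\<^sub>j K\<^sub>j(x) d\<^sub>j\<close>; it is constant on each region.\<close>

definition dual_point :: "multigrid \<Rightarrow> (nat \<Rightarrow> real) \<Rightarrow> real^2 \<Rightarrow> real^2" where
  "dual_point \<Gamma> len x =
     (\<Sum>j<grid_count \<Gamma>.
        of_int \<lceil>(x \<bullet> normal \<Gamma> j + shift \<Gamma> j) / spacing \<Gamma> j\<rceil> *\<^sub>R (len j *\<^sub>R normal \<Gamma> j))"

definition tiling_vertices :: "multigrid \<Rightarrow> (nat \<Rightarrow> real) \<Rightarrow> (real^2) set" where
  "tiling_vertices \<Gamma> len = {dual_point \<Gamma> len x | x C. C \<in> grid_regions \<Gamma> \<and> x \<in> C}"

definition adjacent_regions :: "multigrid \<Rightarrow> (real^2) set \<Rightarrow> (real^2) set \<Rightarrow> bool" where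
  "adjacent_regions \<Gamma> C D \<longleftrightarrow>
     C \<in> grid_regions \<Gamma> \<and> D \<in> grid_regions \<Gamma> \<and> C \<noteq> D \<and>
     (\<exists>A\<in>grid_lines \<Gamma>. \<exists>a b. a \<noteq> b \<and> closed_segment a b \<subseteq> A \<inter> closure C \<inter> closure D)"

definition tiling_edges :: "multigrid \<Rightarrow> (nat \<Rightarrow> real) \<Rightarrow> (real^2) set set" where
  "tiling_edges \<Gamma> len =
     {{dual_point \<Gamma> len x, dual_point \<Gamma> len y} | x y C D. adjacent_regions \<Gamma> C D \<and> x \<in> C \<and> y \<in> D}"

text \<open>The tile of an intersection point \<open>x\<close> is the parallelogram whose corners are the
  vertices of the regions that meet at \<open>x\<close>.\<close>

definition tile_at :: "multigrid \<Rightarrow> (nat \<Rightarrow> real) \<Rightarrow> real^2 \<Rightarrow> (real^2) set" where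
  "tile_at \<Gamma> len x =
     convex hull {dual_point \<Gamma> len y | y C. C \<in> grid_regions \<Gamma> \<and> x \<in> closure C \<and> y \<in> C}"

definition tiling_tiles :: "multigrid \<Rightarrow> (nat \<Rightarrow> real) \<Rightarrow> (real^2) set set" where
  "tiling_tiles \<Gamma> len =
     {tile_at \<Gamma> len x | x A B. A \<in> grid_lines \<Gamma> \<and> B \<in> grid_lines \<Gamma> \<and> A \<noteq> B \<and> x \<in> A \<inter> B}"

definition tiling_framework :: "multigrid \<Rightarrow> (nat \<Rightarrow> real) \<Rightarrow> (real^2) framework" where
  "tiling_framework \<Gamma> len =
     \<lparr>verts = tiling_vertices \<Gamma> len, bars = tiling_edges \<Gamma> len, place = id\<rparr>"

text \<open>In a ribbon \<open>T\<close> of a family of tiles \<open>P\<close>, the set \<open>e i\<close> is the edge shared by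
  \<open>T i\<close> and \<open>T (i + 1)\<close>. Being a path, a ribbon does not revisit tiles.\<close>

definition ribbon :: "(real^2) set set \<Rightarrow> (int \<Rightarrow> (real^2) set) \<Rightarrow> bool" where
  "ribbon P T \<longleftrightarrow>
     range T \<subseteq> P \<and> inj T \<and>
     (\<exists>e. (\<forall>i. e i edge_of T i \<and> e i edge_of T (i + 1)) \<and>
          (\<forall>i j. \<exists>c. e j = (+) c ` e i))"

definition ribbon_figure :: "(real^2) set set \<Rightarrow> (real^2) set" where
  "ribbon_figure P =
     \<Union> {H. origin_line H \<and> (\<exists>T. ribbon P T \<and> (\<exists>R. \<forall>x\<in>\<Union> (range T). infdist x H \<le> R))}"

end

theory Submission
  imports Defs
begin

text \<open>
  The dual map sends a point \<open>x\<close> of the multigrid plane to \<open>\<Sum>\<^sub>j K\<^sub>j(x) d\<^sub>j\<close> and stays within a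
  bounded distance of the positive definite linear map
  \<open>A x = \<Sum>\<^sub>j (len j / spacing j) (x \<bullet> n\<^sub>j) n\<^sub>j\<close>. The ribbon of a line of the \<open>j\<close>th grid
  therefore follows the line spanned by \<open>A (perp n\<^sub>j)\<close>, and all three figures turn out to be the
  union of these ribbon lines.

  Across a tile the jump of an infinitesimal flex over two opposite edges is the same, so the
  jump of a flex is constant along each ribbon. If modulating \<open>u\<close> by all phases in the
  \<open>t\<^sub>2\<close>-direction yields flexes, then, comparing powers of the phase, the part of the modulated
  field supported in a single strip parallel to \<open>t\<^sub>1\<close> is a flex. When \<open>t\<^sub>1\<close> is not a ribbon
  direction, every ribbon leaves the strip, so all jumps of this flex vanish and it is zero;
  hence every localisation line is a ribbon line.
  Conversely, the velocity \<open>perp n\<^sub>j\<close> may be prescribed independently between any two consecutive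
  ribbons of the \<open>j\<close>th grid, which makes each ribbon line a slippage line.
\<close>

section \<open>Planar linear algebra\<close>

definition perp :: "real^2 \<Rightarrow> real^2" where
  "perp v = vector [- v$2, v$1]"

lemma perp_nth [simp]: "perp v $ 1 = - v$2" "perp v $ 2 = v$1"
  by (simp_all add: perp_def)

lemma inner_vec2: "x \<bullet> y = x$1 * y$1 + x$2 * y$2" for x y :: "real^2"
  by (simp add: inner_vec_def sum_2)

lemma vec2_eq_iff: "x = y \<longleftrightarrow> x$1 = y$1 \<and> x$2 = y$2" for x y :: "'a^2"
  by (simp add: vec_eq_iff forall_2)

lemma perp_inner_swap: "perp u \<bullet> v = - (perp v \<bullet> u)"
  by (simp add: inner_vec2)

lemma perp_inner_self [simp]: "perp u \<bullet> u = 0" "u \<bullet> perp u = 0"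
  by (simp_all add: inner_vec2)

lemma perp_inner_perp [simp]: "perp u \<bullet> perp v = u \<bullet> v"
  by (simp add: inner_vec2)

lemma norm_perp [simp]: "norm (perp u) = norm u"
  by (simp add: norm_eq_sqrt_inner)

lemma perp_eq_0_iff [simp]: "perp u = 0 \<longleftrightarrow> u = 0"
  by (metis norm_eq_zero norm_perp)

lemma perp_0 [simp]: "perp 0 = 0"
  by simp

lemma perp_perp [simp]: "perp (perp u) = - u"
  by (simp add: vec2_eq_iff)

lemma perp_minus [simp]: "perp (- u) = - perp u"
  by (simp add: vec2_eq_iff)

lemma perp_scaleR [simp]: "perp (c *\<^sub>R u) = c *\<^sub>R perp u"
  by (simp add: vec2_eq_iff)

lemma perp_pythagoras: "(w \<bullet> z)\<^sup>2 + (perp w \<bullet> z)\<^sup>2 = (norm w)\<^sup>2 * (norm z)\<^sup>2"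
  unfolding power2_norm_eq_inner inner_vec2 by (simp add: power2_eq_square algebra_simps)

lemma perp_cramer: "(perp u \<bullet> v) *\<^sub>R p = (perp u \<bullet> p) *\<^sub>R v - (perp v \<bullet> p) *\<^sub>R u"
  by (simp add: vec2_eq_iff inner_vec2 algebra_simps)

lemma orthogonal_to_basis_imp_0:
  assumes "perp u \<bullet> v \<noteq> 0" "u \<bullet> x = 0" "v \<bullet> x = 0"
  shows "x = 0"
proof -
  have "(perp u \<bullet> v) * (x \<bullet> x) = (perp u \<bullet> x) * (v \<bullet> x) - (perp v \<bullet> x) * (u \<bullet> x)"
    using arg_cong[OF perp_cramer[of u v x], of "\<lambda>q. q \<bullet> x"] by (simp add: inner_diff_left)
  then show ?thesis using assms by simp
qed

definition coordinate :: "real^2 \<Rightarrow> real^2 \<Rightarrow> real^2 \<Rightarrow> real" where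
  "coordinate u v p = (perp v \<bullet> p) / (perp v \<bullet> u)"

lemma coordinate_add: "coordinate u v (p + q) = coordinate u v p + coordinate u v q"
  by (simp add: coordinate_def inner_add_right add_divide_distrib)

lemma coordinate_diff: "coordinate u v (p - q) = coordinate u v p - coordinate u v q"
  by (simp add: coordinate_def inner_diff_right diff_divide_distrib)

lemma coordinate_scaleR: "coordinate u v (c *\<^sub>R p) = c * coordinate u v p"
  by (simp add: coordinate_def)

lemma coordinate_scaleR_vector: "coordinate (c *\<^sub>R u) v p = coordinate u v p / c"
  by (simp add: coordinate_def)

lemma abs_coordinate_le: "\<bar>coordinate u v p\<bar> \<le> norm v / \<bar>perp v \<bullet> u\<bar> * norm p"
  using Cauchy_Schwarz_ineq2[of "perp v" p] by (simp add: coordinate_def divide_right_mono)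

lemma coordinate_decomposition:
  assumes "perp u \<bullet> v \<noteq> 0"
  shows "coordinate u v p *\<^sub>R u + coordinate v u p *\<^sub>R v = p"
proof -
  have "(perp u \<bullet> v) *\<^sub>R (coordinate u v p *\<^sub>R u + coordinate v u p *\<^sub>R v) = (perp u \<bullet> v) *\<^sub>R p"
    using assms perp_inner_swap[of v u]
    by (simp add: coordinate_def perp_cramer[of u v p] scaleR_diff_right)
  then show ?thesis using assms by simp
qed

lemma coordinate_combination:
  assumes "perp u \<bullet> v \<noteq> 0"
  shows "coordinate u v (a *\<^sub>R u + b *\<^sub>R v) = a" "coordinate v u (a *\<^sub>R u + b *\<^sub>R v) = b"
  using assms perp_inner_swap[of v u] by (simp_all add: coordinate_def inner_add_right)

lemma in_combinations_iff_coordinates: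
  assumes "perp u \<bullet> v \<noteq> 0"
  shows "p \<in> {a *\<^sub>R u + b *\<^sub>R v | a b. P a b} \<longleftrightarrow> P (coordinate u v p) (coordinate v u p)"
proof
  assume "P (coordinate u v p) (coordinate v u p)"
  then show "p \<in> {a *\<^sub>R u + b *\<^sub>R v | a b. P a b}"
    using coordinate_decomposition[OF assms, of p, symmetric] by blast
qed (use coordinate_combination[OF assms] in auto)

lemma coordinate_perp_of_unit:
  assumes "norm u = 1"
  shows "coordinate u (perp u) p = u \<bullet> p"
  using assms by (simp add: coordinate_def dot_square_norm)

lemma unit_perp_expansion:
  assumes "norm u = 1"
  shows "p = (u \<bullet> p) *\<^sub>R u + (perp u \<bullet> p) *\<^sub>R perp u"
  using coordinate_decomposition[of u "perp u" p] assms
  by (simp add: coordinate_def dot_square_norm)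

lemma linear_inj_perp_inner_nonzero:
  assumes f: "linear f" "inj f" and "perp u \<bullet> v \<noteq> 0"
  shows "perp (f u) \<bullet> f v \<noteq> 0"
proof
  assume parallel: "perp (f u) \<bullet> f v = 0"
  have "f ((perp (f u) \<bullet> p) *\<^sub>R v) = f ((perp (f v) \<bullet> p) *\<^sub>R u)" for p
    using perp_cramer[of "f u" "f v" p] parallel by (simp add: linear_scale[OF f(1)])
  then have "(perp (f u) \<bullet> p) *\<^sub>R v = (perp (f v) \<bullet> p) *\<^sub>R u" for p
    using f(2) by (simp add: inj_eq)
  then have "(perp (f u) \<bullet> p) * (perp u \<bullet> v) = 0" for p
    by (metis inner_scaleR_right mult_zero_right perp_inner_self(1))
  then have "perp (f u) \<bullet> perp (f u) = 0" using assms(3) by (metis mult_eq_0_iff)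
  then have "u = 0" using f by (simp add: linear_injective_0)
  then show False using assms(3) by simp
qed

lemma coordinate_linear_image:
  assumes "linear f" "perp u \<bullet> v \<noteq> 0" "perp (f u) \<bullet> f v \<noteq> 0"
  shows "coordinate (f u) (f v) (f p) = coordinate u v p"
proof -
  have "f p = coordinate u v p *\<^sub>R f u + coordinate v u p *\<^sub>R f v"
    using arg_cong[OF coordinate_decomposition[OF assms(2), of p], of f] assms(1)
    by (simp add: linear_add linear_scale)
  then show ?thesis using coordinate_combination(1)[OF assms(3)] by simp
qed

lemma in_span_singleton_iff_perp:
  assumes "u \<noteq> 0"
  shows "v \<in> span {u} \<longleftrightarrow> perp u \<bullet> v = 0"
proof
  assume "v \<in> span {u}"
  then show "perp u \<bullet> v = 0" by (auto simp: span_singleton)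
next
  assume "perp u \<bullet> v = 0"
  then have "v = coordinate u (perp u) v *\<^sub>R u"
    using coordinate_decomposition[of u "perp u" v] assms by (simp add: coordinate_def)
  then show "v \<in> span {u}" by (metis span_base span_mul singletonI)
qed

lemma span_singleton_eq_iff_perp:
  assumes "u \<noteq> 0" "v \<noteq> 0"
  shows "span {u} = span {v} \<longleftrightarrow> perp u \<bullet> v = 0"
proof
  assume "span {u} = span {v}"
  then show "perp u \<bullet> v = 0"
    using in_span_singleton_iff_perp[OF assms(1), of v] by (simp add: span_base)
next
  assume "perp u \<bullet> v = 0"
  then have "v \<in> span {u}" "u \<in> span {v}"
    using assms perp_inner_swap[of v u] by (simp_all add: in_span_singleton_iff_perp)
  then show "span {u} = span {v}" by (simp add: span_minimal subset_antisym)
qed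

lemma plane_basis_iff_perp: "plane_basis u v \<longleftrightarrow> perp u \<bullet> v \<noteq> 0"
proof
  assume basis: "plane_basis u v"
  then have u: "u \<noteq> 0" by (metis dependent_zero insertI1 plane_basis_def)
  have "v \<notin> span {u}"
  proof
    assume "v \<in> span {u}"
    then have "span {u, v} = span {u}" by (metis insert_commute span_redundant)
    then have "span {u} = UNIV" using basis by (simp add: plane_basis_def)
    then show False using in_span_singleton_iff_perp[OF u, of "perp u"] u by simp
  qed
  then show "perp u \<bullet> v \<noteq> 0" using in_span_singleton_iff_perp[OF u] by simp
next
  assume nonzero: "perp u \<bullet> v \<noteq> 0"
  then have "u \<noteq> 0" "v \<noteq> 0" "u \<noteq> v" by auto
  then have "independent {u, v}"
    using nonzero in_span_singleton_iff_perp[of v u] perp_inner_swap[of u v]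
    by (simp add: independent_insert)
  moreover have "p \<in> span {u, v}" for p
    by (subst coordinate_decomposition[OF nonzero, of p, symmetric])
      (intro span_add span_mul span_base; simp)
  ultimately show "plane_basis u v" unfolding plane_basis_def by blast
qed

lemma abs_perp_inner_le_infdist: "\<bar>perp u \<bullet> x\<bar> \<le> norm u * infdist x (span {u})"
proof -
  obtain h where h: "h \<in> span {u}" "infdist x (span {u}) = dist x h"
    using infdist_attains_inf[OF closed_span, of "{u}" x] span_zero by blast
  have "perp u \<bullet> x = perp u \<bullet> (x - h)"
    using h(1) by (auto simp: span_singleton inner_diff_right)
  then show ?thesis
    using Cauchy_Schwarz_ineq2[of "perp u" "x - h"] h(2) by (simp add: dist_norm)
qed

lemma bounded_Int_strips:
  assumes "perp u \<bullet> v \<noteq> 0"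
  shows "bounded ({x. infdist x (span {u}) \<le> A} \<inter> {x. infdist x (span {v}) \<le> B})"
proof -
  let ?D = "\<bar>perp u \<bullet> v\<bar>"
  have "norm x \<le> (norm u * A * norm v + norm v * B * norm u) / ?D"
    if "infdist x (span {u}) \<le> A" "infdist x (span {v}) \<le> B" for x
  proof -
    have "\<bar>perp u \<bullet> x\<bar> \<le> norm u * A" "\<bar>perp v \<bullet> x\<bar> \<le> norm v * B"
      using that abs_perp_inner_le_infdist by (meson mult_left_mono norm_ge_zero order_trans)+
    then have "\<bar>perp u \<bullet> x\<bar> * norm v + \<bar>perp v \<bullet> x\<bar> * norm u
        \<le> norm u * A * norm v + norm v * B * norm u"
      by (intro add_mono mult_right_mono) auto
    moreover have "?D * norm x \<le> \<bar>perp u \<bullet> x\<bar> * norm v + \<bar>perp v \<bullet> x\<bar> * norm u"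
      using norm_triangle_ineq4[of "(perp u \<bullet> x) *\<^sub>R v" "(perp v \<bullet> x) *\<^sub>R u"]
      by (simp flip: perp_cramer[of u v x])
    ultimately show ?thesis using assms by (simp add: field_simps)
  qed
  then show ?thesis by (intro boundedI) auto
qed

definition cdot :: "complex^2 \<Rightarrow> real^2 \<Rightarrow> complex" where
  "cdot z v = (\<Sum>i\<in>UNIV. z $ i * complex_of_real (v $ i))"

lemma cdot_vec2: "cdot z v = z$1 * of_real (v$1) + z$2 * of_real (v$2)"
  by (simp add: cdot_def sum_2)

lemma cdot_simps [simp]:
  "cdot 0 v = 0" "cdot (y - z) v = cdot y v - cdot z v" "cdot (c *s z) v = c * cdot z v"
  "cdot z (- v) = - cdot z v" "cdot z (a *\<^sub>R v) = of_real a * cdot z v"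
  by (simp_all add: cdot_vec2 algebra_simps)

lemma cdot_basis_eq_0_imp:
  assumes "perp u \<bullet> v \<noteq> 0" "cdot z u = 0" "cdot z v = 0"
  shows "z = 0"
proof -
  let ?D = "complex_of_real (perp u \<bullet> v)"
  have "z$1 * ?D = cdot z u * of_real (v$2) - cdot z v * of_real (u$2)"
    "z$2 * ?D = cdot z v * of_real (u$1) - cdot z u * of_real (v$1)"
    by (simp_all add: cdot_vec2 inner_vec2 algebra_simps)
  moreover have "?D \<noteq> 0" using assms(1) by (simp only: of_real_eq_0_iff) simp
  ultimately show ?thesis using assms(2,3) by (simp add: vec2_eq_iff)
qed

lemma infinitesimal_flex_iff_cdot:
  "infinitesimal_flex G u \<longleftrightarrow>
    (\<forall>v w. {v, w} \<in> bars G \<longrightarrow> cdot (u (place G v) - u (place G w)) (place G v - place G w) = 0)"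
  by (simp add: infinitesimal_flex_def cdot_def)

section \<open>Phase fields\<close>

lemma in_lattice_cell_iff:
  assumes "perp t1 \<bullet> t2 \<noteq> 0"
  shows "p \<in> lattice_cell t1 t2 k1 k2 \<longleftrightarrow> k1 = \<lfloor>coordinate t1 t2 p\<rfloor> \<and> k2 = \<lfloor>coordinate t2 t1 p\<rfloor>"
  unfolding lattice_cell_def in_combinations_iff_coordinates[OF assms] by linarith

lemma phase_field_eq:
  assumes "perp t1 \<bullet> t2 \<noteq> 0"
  shows "phase_field \<omega>1 \<omega>2 t1 t2 p = \<omega>1 powi \<lfloor>coordinate t1 t2 p\<rfloor> * \<omega>2 powi \<lfloor>coordinate t2 t1 p\<rfloor>"
  by (simp add: phase_field_def in_lattice_cell_iff[OF assms] ex_simps)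

lemma translated_unit_subcell_eq_lattice_cell:
  assumes "perp t1 \<bullet> t2 \<noteq> 0"
  shows "(+) (of_int k1 *\<^sub>R t1 + of_int k2 *\<^sub>R t2) ` unit_subcell t1 t2 1 1 0 0
      = lattice_cell t1 t2 k1 k2"
    (is "(+) ?k ` _ = _")
proof (rule set_eqI)
  fix p
  have "p \<in> (+) ?k ` unit_subcell t1 t2 1 1 0 0 \<longleftrightarrow> p - ?k \<in> unit_subcell t1 t2 1 1 0 0"
    by (force simp: image_iff algebra_simps)
  also have "\<dots> \<longleftrightarrow> p \<in> lattice_cell t1 t2 k1 k2"
    unfolding unit_subcell_def lattice_cell_def in_combinations_iff_coordinates[OF assms]
    by (auto simp: coordinate_diff coordinate_combination[OF assms])
  finally show "p \<in> (+) ?k ` unit_subcell t1 t2 1 1 0 0 \<longleftrightarrow> p \<in> lattice_cell t1 t2 k1 k2" .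
qed

lemma phase_tensor_constant:
  assumes "perp t1 \<bullet> t2 \<noteq> 0"
  shows "phase_tensor \<omega>1 \<omega>2 t1 t2 1 1 (\<lambda>_ _. b) = modulation (phase_field \<omega>1 \<omega>2 t1 t2) (\<lambda>_. b)"
  using translated_unit_subcell_eq_lattice_cell[OF assms]
  by (intro ext) (simp add: phase_tensor_def modulation_def phase_field_eq[OF assms]
      in_lattice_cell_iff[OF assms])

lemma phase_monomials_independent:
  fixes X Y :: complex
  assumes eq: "\<And>\<omega>. norm \<omega> = 1 \<Longrightarrow> \<omega> powi a * X = \<omega> powi b * Y" and "a \<noteq> b"
  shows "X = 0" "Y = 0"
proof -
  have equal: "X = Y" using eq[of 1] by simp
  let ?w = "cis (pi / of_int (a - b))"
  have "?w powi (a - b) = -1" using \<open>a \<noteq> b\<close> by (simp only: cis_power_int) simp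
  moreover have "?w powi a = ?w powi (a - b) * ?w powi b"
    by (subst power_int_add[symmetric]) auto
  ultimately have "- (?w powi b * X) = ?w powi b * X" using eq[of ?w] equal by simp
  then have "?w powi b * X = 0" by (simp add: neg_eq_iff_add_eq_0)
  then show "X = 0" by simp
  then show "Y = 0" using equal by simp
qed

definition modulated_flex ::
    "'v framework \<Rightarrow> complex \<Rightarrow> real^2 \<Rightarrow> real^2 \<Rightarrow> velocity_field \<Rightarrow> bool" where
  "modulated_flex G \<omega>1 t1 t2 u \<longleftrightarrow>
     (\<forall>\<omega>\<in>sphere 0 1. infinitesimal_flex G (modulation (phase_field \<omega>1 \<omega> t1 t2) u))"

definition strip :: "real^2 \<Rightarrow> real^2 \<Rightarrow> int \<Rightarrow> (real^2) set" where
  "strip t1 t2 m = {p. \<lfloor>coordinate t2 t1 p\<rfloor> = m}"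

text \<open>The modulated flex equation of a bar that joins two different strips is an identity between
  two different powers of the phase, so it holds for each end separately.\<close>

lemma modulated_flex_restricted_to_strip:
  assumes basis: "perp t1 \<bullet> t2 \<noteq> 0" and flex: "modulated_flex G \<omega>1 t1 t2 u"
  shows "infinitesimal_flex G
    (\<lambda>p. if p \<in> strip t1 t2 m then \<omega>1 powi \<lfloor>coordinate t1 t2 p\<rfloor> *s u p else 0)"
  unfolding infinitesimal_flex_iff_cdot
proof (intro allI impI)
  fix v w assume "{v, w} \<in> bars G"
  let ?p = "place G v" and ?q = "place G w" and ?k = "\<lambda>p. \<lfloor>coordinate t2 t1 p\<rfloor>"
  let ?u = "\<lambda>p. \<omega>1 powi \<lfloor>coordinate t1 t2 p\<rfloor> *s u p"
  have phases: "\<omega> powi ?k ?p * cdot (?u ?p) (?p - ?q) = \<omega> powi ?k ?q * cdot (?u ?q) (?p - ?q)"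
    if "norm \<omega> = 1" for \<omega>
  proof -
    have "infinitesimal_flex G (modulation (phase_field \<omega>1 \<omega> t1 t2) u)"
      using flex that by (simp add: modulated_flex_def)
    then show ?thesis using \<open>{v, w} \<in> bars G\<close>
      by (auto simp: infinitesimal_flex_iff_cdot modulation_def
          phase_field_eq[OF basis] algebra_simps)
  qed
  show "cdot ((if ?p \<in> strip t1 t2 m then ?u ?p else 0)
      - (if ?q \<in> strip t1 t2 m then ?u ?q else 0)) (?p - ?q) = 0"
  proof (cases "?k ?p = ?k ?q")
    case True
    then show ?thesis using phases[of 1] by (simp add: strip_def)
  next
    case False
    then have "cdot (?u ?p) (?p - ?q) = 0" "cdot (?u ?q) (?p - ?q) = 0"
      using phase_monomials_independent[OF phases] by blast+
    then show ?thesis by (simp del: cdot_simps(3))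
  qed
qed

section \<open>Delone sets\<close>

lemma finite_uniform_discrete_Int_bounded:
  fixes J :: "'a::heine_borel set"
  assumes "uniform_discrete J" "bounded S"
  shows "finite (J \<inter> S)"
  using assms bounded_Int uniform_discrete_subset[of J "J \<inter> S"] uniform_discrete_finite_iff by blast

lemma countable_uniform_discrete:
  fixes J :: "'a::{real_normed_vector, heine_borel} set"
  assumes "uniform_discrete J"
  shows "countable J"
proof -
  have "J = (\<Union>n::nat. J \<inter> cball 0 (real n))"
    using real_arch_simple by auto
  moreover have "countable (\<Union>n::nat. J \<inter> cball 0 (real n))"
    using finite_uniform_discrete_Int_bounded[OF assms bounded_cball]
    by (intro countable_UN countableI_type countable_finite)
  ultimately show ?thesis by (rule ssubst)
qed

lemma uniform_discrete_if_finite_differences: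
  fixes S :: "'a::real_normed_vector set"
  assumes "finite {x - y | x y. x \<in> S \<and> y \<in> S \<and> dist x y < 1}" (is "finite ?F")
  shows "uniform_discrete S"
proof -
  define e where "e = Min (insert 1 (norm ` (?F - {0})))"
  have finite_norms: "finite (insert 1 (norm ` (?F - {0})))" using assms by blast
  have "e > 0" "e \<le> 1"
    unfolding e_def using finite_norms by (auto simp: Min_gr_iff[OF finite_norms])
  moreover have "x = y" if "x \<in> S" "y \<in> S" "dist x y < e" for x y
  proof (rule ccontr)
    assume "x \<noteq> y"
    then have "norm (x - y) \<in> norm ` (?F - {0})"
      using that \<open>e \<le> 1\<close> by (intro imageI) force
    then have "e \<le> norm (x - y)" unfolding e_def using finite_norms by (intro Min_le) auto
    then show False using that by (simp add: dist_norm)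
  qed
  ultimately show ?thesis unfolding uniform_discrete_def by blast
qed

definition square :: "real^2 \<Rightarrow> real \<Rightarrow> (real^2) set" where
  "square c N = (+) c ` cbox (vec (- N)) (vec N)"

definition window :: "(real^2) set \<Rightarrow> real^2 \<Rightarrow> real \<Rightarrow> (real^2) set" where
  "window J c N = J \<inter> square c N"

lemma in_square_iff:
  "x \<in> square c N \<longleftrightarrow> (\<forall>i. \<bar>x$i - c$i\<bar> \<le> N)"
proof -
  have "x \<in> square c N \<longleftrightarrow> x - c \<in> cbox (vec (- N)) (vec N)"
    by (auto simp: square_def image_iff algebra_simps intro: bexI[of _ "x - c"])
  also have "\<dots> \<longleftrightarrow> (\<forall>i. \<bar>x$i - c$i\<bar> \<le> N)"
    by (simp add: mem_box_cart abs_le_iff) (smt (verit))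
  finally show ?thesis .
qed

lemma norm_diff_centre_le:
  assumes "x \<in> window J c N"
  shows "norm (x - c) \<le> 2 * N"
proof -
  have "norm (x - c) \<le> (\<Sum>i\<in>UNIV. \<bar>x$i - c$i\<bar>)" using norm_le_l1_cart[of "x - c"] by simp
  also have "\<dots> \<le> 2 * N" using assms by (simp add: window_def in_square_iff sum_2 forall_2)
  finally show ?thesis .
qed

lemma abs_inner_diff_centre_le:
  assumes "x \<in> window J c N"
  shows "\<bar>v \<bullet> x - v \<bullet> c\<bar> \<le> 2 * norm v * N"
  using Cauchy_Schwarz_ineq2[of v "x - c"] mult_left_mono[OF norm_diff_centre_le[OF assms], of "norm v"]
  by (simp add: inner_diff_right)

lemma finite_window: "uniform_discrete J \<Longrightarrow> finite (window J c N)"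
  unfolding window_def square_def
  by (intro finite_uniform_discrete_Int_bounded bounded_translation bounded_cbox)

lemma measure_square:
  assumes "0 \<le> N"
  shows "measure lborel (square c N) = (2 * N)\<^sup>2"
proof -
  have "measure lborel (cbox (c + vec (- N)) (c + vec N)) = (2 * N)\<^sup>2"
    using assms by (simp add: content_cbox_if_cart interval_eq_empty_cart UNIV_2 power2_eq_square)
  then show ?thesis by (simp add: square_def cbox_translation)
qed

lemma square_covered_by_balls:
  assumes "\<And>x. \<exists>y\<in>J. dist x y \<le> R"
  shows "square c (N - R) \<subseteq> (\<Union>y\<in>window J c N. cball y R)"
proof
  fix x assume x: "x \<in> square c (N - R)"
  obtain y where y: "y \<in> J" "dist x y \<le> R" using assms by blast
  have "\<bar>y$i - c$i\<bar> \<le> N" for i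
  proof -
    have "\<bar>y$i - x$i\<bar> \<le> R"
      using component_le_norm_cart[of "y - x" i] y(2) by (simp add: dist_norm norm_minus_commute)
    moreover have "\<bar>x$i - c$i\<bar> \<le> N - R" using x unfolding in_square_iff by blast
    ultimately show ?thesis by linarith
  qed
  then have "y \<in> window J c N" using y(1) by (simp add: window_def in_square_iff)
  then show "x \<in> (\<Union>y\<in>window J c N. cball y R)" using y(2) by (auto simp: dist_commute)
qed

text \<open>The balls of a fixed radius around the points of a window cover a square of half its side, so
  their number is bounded below by the ratio of the areas.\<close>

lemma relatively_dense_card_window_ge:
  assumes "relatively_dense J" and discrete: "uniform_discrete J"
  obtains a N0 where "a > 0" "\<And>N c. N \<ge> N0 \<Longrightarrow> a * N\<^sup>2 \<le> real (card (window J c N))"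
proof -
  obtain R0 where R0: "\<And>x. \<exists>y\<in>J. dist x y \<le> R0"
    using assms(1) by (auto simp: relatively_dense_def)
  define R where "R = \<bar>R0\<bar> + 1"
  define V where "V = measure lborel (cball (0::real^2) R)"
  have "R > 0" by (simp add: R_def)
  then have "V > 0" by (simp add: V_def content_cball_pos)
  have near: "\<exists>y\<in>J. dist x y \<le> R" for x
    using R0[of x] unfolding R_def by (metis abs_ge_self add_increasing2 order_trans zero_le_one)
  show ?thesis
  proof (rule that[of "1 / V" "2 * R"])
    show "1 / V > 0" using \<open>V > 0\<close> by simp
    fix N and c :: "real^2"
    assume "2 * R \<le> N"
    have ball: "measure lborel (cball y R) = V" for y :: "real^2"
      using \<open>R > 0\<close> by (simp add: V_def content_cball_conv_ball content_ball_conv_unit_ball[of R])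
    have "square c (N - R) \<subseteq> (\<Union>y\<in>window J c N. cball y R)"
      using near by (rule square_covered_by_balls)
    then have "measure lborel (square c (N - R)) \<le> measure lborel (\<Union>y\<in>window J c N. cball y R)"
      using finite_window[OF discrete, of c N]
      by (intro measure_mono_fmeasurable fmeasurable.finite_UN)
        (auto intro!: fmeasurable_compact simp: square_def simp flip: cbox_translation)
    also have "\<dots> \<le> (\<Sum>y\<in>window J c N. measure lborel (cball y R))"
      using finite_window[OF discrete, of c N] by (intro measure_UNION_le) auto
    also have "\<dots> = real (card (window J c N)) * V" by (simp add: ball)
    finally have "(2 * (N - R))\<^sup>2 \<le> real (card (window J c N)) * V"
      using measure_square[of "N - R" c] \<open>2 * R \<le> N\<close> \<open>R > 0\<close> by simp
    moreover have "N\<^sup>2 \<le> (2 * (N - R))\<^sup>2"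
      using \<open>2 * R \<le> N\<close> \<open>R > 0\<close> by (intro power_mono) auto
    ultimately show "1 / V * N\<^sup>2 \<le> real (card (window J c N))"
      using \<open>V > 0\<close> by (simp add: field_simps)
  qed
qed

lemma card_floor_interval_le:
  fixes a b :: real
  assumes "a \<le> b"
  shows "real (card {\<lfloor>a\<rfloor>..\<lfloor>b\<rfloor>}) \<le> b - a + 2"
  using floor_mono[OF assms] by simp linarith

lemma norm_mult_less_of_rotated_coordinates_less:
  assumes "\<bar>w \<bullet> z\<bar> < h" "\<bar>perp w \<bullet> z\<bar> < h"
  shows "norm w * norm z < 2 * h"
proof -
  have "0 < h" using assms(1) by linarith
  then have "(w \<bullet> z)\<^sup>2 < h\<^sup>2" "(perp w \<bullet> z)\<^sup>2 < h\<^sup>2"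
    using assms by (metis abs_le_square_iff abs_of_pos linorder_not_le)+
  then have "(norm w)\<^sup>2 * (norm z)\<^sup>2 < 4 * h\<^sup>2"
    using perp_pythagoras[of w z] zero_le_power2[of h] by linarith
  then have "(norm w * norm z)\<^sup>2 < (2 * h)\<^sup>2" by (simp add: power_mult_distrib)
  then show ?thesis
    using \<open>0 < h\<close> by (meson less_imp_le mult_pos_pos power_less_imp_less_base zero_less_numeral)
qed

text \<open>A square of side \<open>h\<close> in the coordinates \<open>w \<bullet> x\<close> and \<open>perp w \<bullet> x\<close> contains at most one point of
  an \<open>e\<close>-separated set.\<close>

lemma separated_card_rectangle_le:
  assumes separated: "\<And>x y. x \<in> T \<Longrightarrow> y \<in> T \<Longrightarrow> dist x y < e \<Longrightarrow> x = y" and "0 < e" "w \<noteq> 0"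
    and rectangle: "\<And>x. x \<in> T \<Longrightarrow> \<bar>w \<bullet> x - \<alpha>\<bar> \<le> A" "\<And>x. x \<in> T \<Longrightarrow> \<bar>perp w \<bullet> x - \<beta>\<bar> \<le> B"
    and "0 \<le> A" "0 \<le> B"
  defines "h \<equiv> e * norm w / 2"
  shows "real (card T) \<le> (2 * A / h + 2) * (2 * B / h + 2)"
proof -
  have h: "h > 0" using \<open>0 < e\<close> \<open>w \<noteq> 0\<close> by (simp add: h_def)
  define F where "F x = (\<lfloor>w \<bullet> x / h\<rfloor>, \<lfloor>perp w \<bullet> x / h\<rfloor>)" for x
  let ?I = "{\<lfloor>(\<alpha> - A) / h\<rfloor>..\<lfloor>(\<alpha> + A) / h\<rfloor>}" and ?J = "{\<lfloor>(\<beta> - B) / h\<rfloor>..\<lfloor>(\<beta> + B) / h\<rfloor>}"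
  have "inj_on F T"
  proof (rule inj_onI)
    fix x y assume xy: "x \<in> T" "y \<in> T" "F x = F y"
    then have "\<bar>w \<bullet> x / h - w \<bullet> y / h\<bar> < 1" "\<bar>perp w \<bullet> x / h - perp w \<bullet> y / h\<bar> < 1"
      unfolding F_def prod.inject by linarith+
    then have "\<bar>w \<bullet> (x - y)\<bar> < h" "\<bar>perp w \<bullet> (x - y)\<bar> < h"
      using h by (simp_all add: inner_diff_right flip: diff_divide_distrib)
    then have "norm w * norm (x - y) < norm w * e"
      using norm_mult_less_of_rotated_coordinates_less[of w "x - y" h]
      by (simp add: h_def mult.commute)
    then have "norm (x - y) < e" using \<open>w \<noteq> 0\<close> by simp
    then show "x = y" using separated xy by (simp add: dist_norm)
  qed
  moreover have "F ` T \<subseteq> ?I \<times> ?J"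
  proof (rule image_subsetI)
    fix x assume "x \<in> T"
    then have "\<alpha> - A \<le> w \<bullet> x" "w \<bullet> x \<le> \<alpha> + A" "\<beta> - B \<le> perp w \<bullet> x" "perp w \<bullet> x \<le> \<beta> + B"
      using rectangle[of x] by linarith+
    then show "F x \<in> ?I \<times> ?J"
      using h by (auto simp: F_def intro!: floor_mono divide_right_mono)
  qed
  ultimately have "card T \<le> card (?I \<times> ?J)" by (intro card_inj_on_le) auto
  then have "real (card T) \<le> real (card ?I) * real (card ?J)"
    by (simp only: card_cartesian_product flip: of_nat_mult)
  also have "\<dots> \<le> ((\<alpha> + A) / h - (\<alpha> - A) / h + 2) * ((\<beta> + B) / h - (\<beta> - B) / h + 2)"
    using h \<open>0 \<le> A\<close> \<open>0 \<le> B\<close>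
    by (intro mult_mono card_floor_interval_le divide_right_mono) (auto simp: divide_right_mono)
  also have "\<dots> = (2 * A / h + 2) * (2 * B / h + 2)"
    using h by (simp add: field_simps)
  finally show ?thesis .
qed

definition bands :: "real^2 \<Rightarrow> real \<Rightarrow> real \<Rightarrow> (real^2) set" where
  "bands w W M = {x. \<exists>m::int. \<bar>w \<bullet> x - of_int m * M\<bar> \<le> W}"

lemma card_multiples_near_le:
  fixes a b M :: real
  assumes "0 < M" "0 \<le> b"
  shows "finite {m::int. \<bar>of_int m * M - a\<bar> \<le> b}"
    and "real (card {m::int. \<bar>of_int m * M - a\<bar> \<le> b}) \<le> 2 * b / M + 2"
proof -
  let ?I = "{\<lfloor>(a - b) / M\<rfloor>..\<lfloor>(a + b) / M\<rfloor>}"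
  have subset: "{m::int. \<bar>of_int m * M - a\<bar> \<le> b} \<subseteq> ?I"
  proof
    fix m :: int assume "m \<in> {m. \<bar>of_int m * M - a\<bar> \<le> b}"
    then have "(a - b) / M \<le> of_int m" "of_int m \<le> (a + b) / M"
      using assms(1) by (auto simp: field_simps)
    then show "m \<in> ?I" by (simp add: le_floor_iff) linarith
  qed
  then show "finite {m::int. \<bar>of_int m * M - a\<bar> \<le> b}" by (rule finite_subset) simp
  have "real (card {m::int. \<bar>of_int m * M - a\<bar> \<le> b}) \<le> real (card ?I)"
    using card_mono[OF _ subset] by simp
  also have "\<dots> \<le> (a + b) / M - (a - b) / M + 2"
    using assms by (intro card_floor_interval_le divide_right_mono) auto
  also have "\<dots> = 2 * b / M + 2" by (simp flip: diff_divide_distrib)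
  finally show "real (card {m::int. \<bar>of_int m * M - a\<bar> \<le> b}) \<le> 2 * b / M + 2" .
qed

lemma card_Int_bands_le:
  assumes "finite X" "0 < M" "0 \<le> W + b"
    and near: "\<And>x. x \<in> X \<Longrightarrow> \<bar>w \<bullet> x - a\<bar> \<le> b"
    and band: "\<And>m::int. real (card {x \<in> X. \<bar>w \<bullet> x - of_int m * M\<bar> \<le> W}) \<le> K"
  shows "real (card (X \<inter> bands w W M)) \<le> (2 * (W + b) / M + 2) * K"
proof -
  let ?X = "\<lambda>m::int. {x \<in> X. \<bar>w \<bullet> x - of_int m * M\<bar> \<le> W}"
  define I where "I = {m::int. \<bar>of_int m * M - a\<bar> \<le> W + b}"
  have I: "finite I" "real (card I) \<le> 2 * (W + b) / M + 2"
    unfolding I_def using assms(2,3) by (rule card_multiples_near_le)+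
  have "X \<inter> bands w W M \<subseteq> (\<Union>m\<in>I. ?X m)"
  proof
    fix x assume "x \<in> X \<inter> bands w W M"
    then obtain m :: int where m: "x \<in> X" "\<bar>w \<bullet> x - of_int m * M\<bar> \<le> W" by (auto simp: bands_def)
    then have "m \<in> I" using near[of x] by (simp add: I_def)
    then show "x \<in> (\<Union>m\<in>I. ?X m)" using m by auto
  qed
  then have "card (X \<inter> bands w W M) \<le> card (\<Union>m\<in>I. ?X m)"
    using \<open>finite X\<close> I(1) by (intro card_mono) auto
  also have "\<dots> \<le> (\<Sum>m\<in>I. card (?X m))" using I(1) by (rule card_UN_le)
  finally have "real (card (X \<inter> bands w W M)) \<le> (\<Sum>m\<in>I. real (card (?X m)))"
    by (simp only: flip: of_nat_sum)
  also have "\<dots> \<le> real (card I) * K" using band by (rule sum_bounded_above)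
  also have "\<dots> \<le> (2 * (W + b) / M + 2) * K"
    using I(2) order_trans[OF of_nat_0_le_iff band] by (rule mult_right_mono)
  finally show ?thesis .
qed

lemma card_window_Int_bands_le:
  assumes "uniform_discrete J" "w \<noteq> 0" "0 \<le> W"
  obtains C where "C > 0"
    "\<And>M N c. 0 < M \<Longrightarrow> M \<le> N \<Longrightarrow> W \<le> N \<Longrightarrow> 1 \<le> N \<Longrightarrow>
      real (card (window J c N \<inter> bands w W M)) \<le> C / M * N\<^sup>2"
proof -
  obtain e where e: "e > 0" "\<And>x y. x \<in> J \<Longrightarrow> y \<in> J \<Longrightarrow> dist x y < e \<Longrightarrow> x = y"
    using assms(1) unfolding uniform_discrete_def by blast
  define h where "h = e * norm w / 2"
  define \<kappa> where "\<kappa> = 2 * norm w"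
  define K where "K N = (2 * W / h + 2) * (2 * (\<kappa> * N) / h + 2)" for N
  have pos: "h > 0" "\<kappa> > 0" using e(1) \<open>w \<noteq> 0\<close> by (simp_all add: h_def \<kappa>_def)
  show ?thesis
  proof (rule that[of "(2 * \<kappa> + 4) * K 1"])
    show "0 < (2 * \<kappa> + 4) * K 1" unfolding K_def using pos \<open>0 \<le> W\<close>
      by (intro mult_pos_pos add_nonneg_pos) auto
    fix M N and c :: "real^2"
    assume M: "0 < M" "M \<le> N" and N: "W \<le> N" "1 \<le> N"
    have near: "\<bar>v \<bullet> x - v \<bullet> c\<bar> \<le> \<kappa> * N" if "x \<in> window J c N" "norm v = norm w" for x v
      using abs_inner_diff_centre_le[OF that(1), of v] that(2) by (simp add: \<kappa>_def)
    have nonneg: "0 \<le> \<kappa> * N" "0 \<le> W + \<kappa> * N" using pos N \<open>0 \<le> W\<close> by auto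
    have "real (card {x \<in> window J c N. \<bar>w \<bullet> x - of_int m * M\<bar> \<le> W}) \<le> K N" for m :: int
      unfolding h_def K_def
      by (rule separated_card_rectangle_le[where \<alpha> = "of_int m * M" and \<beta> = "perp w \<bullet> c"])
        (use e assms nonneg near[of _ "perp w"] in \<open>auto simp: window_def\<close>)
    then have "real (card (window J c N \<inter> bands w W M)) \<le> (2 * (W + \<kappa> * N) / M + 2) * K N"
      using near[of _ w]
      by (intro card_Int_bands_le[OF finite_window[OF assms(1)] M(1) nonneg(2)]) simp_all
    also have "\<dots> \<le> ((2 * \<kappa> + 4) * (N / M)) * (K 1 * N)"
    proof (rule mult_mono)
      have "2 * (W + \<kappa> * N) / M + 2 \<le> 2 * (N + \<kappa> * N) / M + 2 * N / M"
        using M N by (intro add_mono divide_right_mono) (auto simp: field_simps)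
      also have "\<dots> = (2 * \<kappa> + 4) * (N / M)" by (simp add: algebra_simps add_divide_distrib)
      finally show "2 * (W + \<kappa> * N) / M + 2 \<le> (2 * \<kappa> + 4) * (N / M)" .
      have "2 * (\<kappa> * N) / h + 2 \<le> (2 * \<kappa> / h + 2) * N" using N(2) by (simp add: algebra_simps)
      then show "K N \<le> K 1 * N"
        unfolding K_def using pos \<open>0 \<le> W\<close>
        by (simp only: mult.assoc mult_1_right) (intro mult_left_mono; simp)
    qed (use pos M N \<open>0 \<le> W\<close> nonneg in \<open>auto simp: K_def\<close>)
    also have "\<dots> = (2 * \<kappa> + 4) * K 1 / M * N\<^sup>2" by (simp add: power2_eq_square)
    finally show "real (card (window J c N \<inter> bands w W M)) \<le> (2 * \<kappa> + 4) * K 1 / M * N\<^sup>2" .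
  qed
qed

lemma Delone_sparse_bands:
  assumes "Delone_set J" "w \<noteq> 0" "0 \<le> W" "0 < \<epsilon>"
  obtains M :: nat and N0 where "M > 0"
    "\<And>N c. N \<ge> N0 \<Longrightarrow>
      real (card (window J c N \<inter> bands w W (real M))) < \<epsilon> * real (card (window J c N))"
proof -
  have J: "relatively_dense J" "uniform_discrete J" using assms(1) by (auto simp: Delone_set_def)
  obtain a N1 where a: "a > 0" "\<And>N c. N \<ge> N1 \<Longrightarrow> a * N\<^sup>2 \<le> real (card (window J c N))"
    using relatively_dense_card_window_ge[OF J] by metis
  obtain C where C: "C > 0"
    "\<And>M N c. 0 < M \<Longrightarrow> M \<le> N \<Longrightarrow> W \<le> N \<Longrightarrow> 1 \<le> N \<Longrightarrow>
      real (card (window J c N \<inter> bands w W M)) \<le> C / M * N\<^sup>2"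
    using card_window_Int_bands_le[OF J(2) assms(2,3)] by metis
  obtain M :: nat where M: "C / (\<epsilon> * a) < real M" using reals_Archimedean2 by blast
  have "0 < C / (\<epsilon> * a)" using C(1) a(1) \<open>0 < \<epsilon>\<close> by simp
  then have "0 < real M" using M by linarith
  show ?thesis
  proof (rule that[of M "max (max N1 1) (max (real M) W)"])
    show "M > 0" using \<open>0 < real M\<close> by simp
    fix N c assume "max (max N1 1) (max (real M) W) \<le> N"
    then have N: "N1 \<le> N" "1 \<le> N" "real M \<le> N" "W \<le> N" by auto
    have "real (card (window J c N \<inter> bands w W (real M))) \<le> C / real M * N\<^sup>2"
      using C(2) \<open>0 < real M\<close> N by blast
    also have "\<dots> < \<epsilon> * a * N\<^sup>2"
      using M \<open>0 < real M\<close> \<open>0 < \<epsilon>\<close> a(1) N(2)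
      by (intro mult_strict_right_mono) (auto simp: field_simps)
    also have "\<dots> \<le> \<epsilon> * real (card (window J c N))"
      using mult_left_mono[OF a(2)[OF N(1), of c], of \<epsilon>] \<open>0 < \<epsilon>\<close> by (simp add: mult.assoc)
    finally show "real (card (window J c N \<inter> bands w W (real M))) < \<epsilon> * real (card (window J c N))" .
  qed
qed

section \<open>Mostly close fields; slippage lines are localisation lines\<close>

lemma mostly_close_iff_window:
  "mostly_close J \<epsilon> u z \<longleftrightarrow> (\<exists>N0. \<forall>N\<ge>N0. \<forall>c.
     real (card {x \<in> window J c N. norm (u x - z x) > \<epsilon>}) < \<epsilon> * real (card (window J c N)))"
  by (simp add: mostly_close_def window_def square_def Let_def)

lemma mostly_close_mono:
  assumes "mostly_close J \<delta> u z" "\<delta> \<le> \<epsilon>"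
  shows "mostly_close J \<epsilon> u z"
  unfolding mostly_close_iff_window
proof -
  obtain N0 where N0: "\<And>N c. N \<ge> N0 \<Longrightarrow>
      real (card {x \<in> window J c N. norm (u x - z x) > \<delta>}) < \<delta> * real (card (window J c N))"
    using assms(1) unfolding mostly_close_iff_window by blast
  have "real (card {x \<in> window J c N. norm (u x - z x) > \<epsilon>}) < \<epsilon> * real (card (window J c N))"
    if "N0 \<le> N" for N c
  proof -
    have "finite (window J c N)"
    proof (rule ccontr)
      assume "infinite (window J c N)"
      then show False using N0[OF that, of c] by simp
    qed
    then have "card {x \<in> window J c N. norm (u x - z x) > \<epsilon>}
        \<le> card {x \<in> window J c N. norm (u x - z x) > \<delta>}"
      using assms(2) by (intro card_mono) auto
    moreover have "\<delta> * real (card (window J c N)) \<le> \<epsilon> * real (card (window J c N))"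
      using assms(2) by (rule mult_right_mono) simp
    ultimately show ?thesis using N0[OF that, of c] by linarith
  qed
  then show "\<exists>N0. \<forall>N\<ge>N0. \<forall>c.
     real (card {x \<in> window J c N. norm (u x - z x) > \<epsilon>}) < \<epsilon> * real (card (window J c N))" by blast
qed

lemma mostly_close_off_sparse_set:
  assumes "uniform_discrete J" "0 \<le> \<epsilon>"
    and agree: "\<And>x. x \<in> J \<Longrightarrow> x \<notin> X \<Longrightarrow> u x = z x"
    and sparse: "\<And>N c. N \<ge> N0 \<Longrightarrow> real (card (window J c N \<inter> X)) < \<epsilon> * real (card (window J c N))"
  shows "mostly_close J \<epsilon> u z"
  unfolding mostly_close_iff_window
proof (intro exI[of _ N0] allI impI)
  fix N c assume "N0 \<le> N"
  have "{x \<in> window J c N. norm (u x - z x) > \<epsilon>} \<subseteq> window J c N \<inter> X"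
    using agree \<open>0 \<le> \<epsilon>\<close> by (force simp: window_def)
  then have "card {x \<in> window J c N. norm (u x - z x) > \<epsilon>} \<le> card (window J c N \<inter> X)"
    using finite_window[OF assms(1)] by (intro card_mono) auto
  then show "real (card {x \<in> window J c N. norm (u x - z x) > \<epsilon>}) < \<epsilon> * real (card (window J c N))"
    using sparse[OF \<open>N0 \<le> N\<close>, of c] by linarith
qed

lemma mostly_close_imp_nonzero:
  assumes "mostly_close J \<epsilon> u z" "\<epsilon> \<le> 1" and large: "\<And>x. x \<in> J \<Longrightarrow> \<epsilon> < norm (z x)"
  shows "\<exists>x\<in>J. u x \<noteq> 0"
proof (rule ccontr)
  assume "\<not> (\<exists>x\<in>J. u x \<noteq> 0)"
  then have "{x \<in> window J c N. norm (u x - z x) > \<epsilon>} = window J c N" for c N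
    using large by (auto simp: window_def)
  then obtain N where "\<And>c. real (card (window J c N)) < \<epsilon> * real (card (window J c N))"
    using assms(1) unfolding mostly_close_iff_window by force
  from this[of 0] have "real (card (window J 0 N)) < \<epsilon> * real (card (window J 0 N))" .
  moreover have "\<epsilon> * real (card (window J 0 N)) \<le> 1 * real (card (window J 0 N))"
    using assms(2) by (rule mult_right_mono) simp
  ultimately show False by simp
qed

definition slippage_flex ::
    "'v framework \<Rightarrow> real^2 \<Rightarrow> real^2 \<Rightarrow> real^2 \<Rightarrow> real \<Rightarrow> nat \<Rightarrow> velocity_field \<Rightarrow> bool" where
  "slippage_flex G t1 t2 b \<epsilon> M u \<longleftrightarrow>
     infinitesimal_flex G u \<and> M > 0 \<and> modulated_flex G 1 t1 (real M *\<^sub>R t2) u \<and>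
     (\<forall>\<omega>\<in>sphere 0 1. mostly_close (joints G) \<epsilon>
        (modulation (phase_field 1 \<omega> t1 (real M *\<^sub>R t2)) u)
        (modulation (phase_field 1 \<omega> t1 (real M *\<^sub>R t2)) (const_velocity b)))"

lemma periodic_slippage_line_iff:
  "periodic_slippage_line G H \<longleftrightarrow> Delone_framework G \<and>
     (\<exists>t1 t2 b. H = span {t1} \<and> plane_basis t1 t2 \<and> b \<noteq> 0 \<and>
       (\<forall>\<epsilon>>0. \<exists>u M. slippage_flex G t1 t2 b \<epsilon> M u))"
  unfolding periodic_slippage_line_def slippage_flex_def modulated_flex_def ..

definition localisation_flex ::
    "'v framework \<Rightarrow> real^2 \<Rightarrow> real^2 \<Rightarrow> real \<Rightarrow> complex \<Rightarrow> nat \<Rightarrow> nat \<Rightarrow> velocity_field \<Rightarrow> bool" where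
  "localisation_flex G t1 t2 \<epsilon> \<omega>1 M1 M2 u \<longleftrightarrow>
     infinitesimal_flex G u \<and> (\<exists>x\<in>joints G. u x \<noteq> 0) \<and> M1 > 0 \<and> M2 > 0 \<and>
     modulated_flex G \<omega>1 (real M1 *\<^sub>R t1) (real M2 *\<^sub>R t2) u \<and>
     (\<exists>L M B. L > 0 \<and> M > 0 \<and> (\<forall>\<omega>\<in>sphere 0 1. mostly_close (joints G) \<epsilon>
        (modulation (phase_field \<omega>1 \<omega> (real M1 *\<^sub>R t1) (real M2 *\<^sub>R t2)) u)
        (phase_tensor \<omega>1 \<omega> (real M1 *\<^sub>R t1) (real M2 *\<^sub>R t2) L M B)))"

lemma periodic_localisation_line_iff:
  "periodic_localisation_line G H \<longleftrightarrow> Delone_framework G \<and>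
     (\<exists>t1 t2. H = span {t1} \<and> plane_basis t1 t2 \<and>
        (\<forall>\<epsilon>>0. \<exists>u. \<exists>\<omega>1\<in>sphere 0 1. \<exists>M1 M2. localisation_flex G t1 t2 \<epsilon> \<omega>1 M1 M2 u))"
  unfolding periodic_localisation_line_def localisation_flex_def modulated_flex_def ..

lemma slippage_flex_imp_localisation_flex:
  assumes "plane_basis t1 t2" "slippage_flex G t1 t2 b \<delta> M u"
    "\<delta> \<le> 1" "\<delta> < norm (const_velocity b 0)" "\<delta> \<le> \<epsilon>"
  shows "localisation_flex G t1 t2 \<epsilon> 1 1 M u"
proof -
  define \<beta> where "\<beta> = const_velocity b 0"
  have const: "const_velocity b = (\<lambda>_. \<beta>)" by (simp add: \<beta>_def const_velocity_def)
  let ?\<phi> = "\<lambda>\<omega>. phase_field 1 \<omega> t1 (real M *\<^sub>R t2)"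
  have u: "infinitesimal_flex G u" "M > 0" "modulated_flex G 1 t1 (real M *\<^sub>R t2) u"
    and close: "\<And>\<omega>. \<omega> \<in> sphere 0 1 \<Longrightarrow>
      mostly_close (joints G) \<delta> (modulation (?\<phi> \<omega>) u) (modulation (?\<phi> \<omega>) (\<lambda>_. \<beta>))"
    using assms(2) unfolding slippage_flex_def const by blast+
  have basis: "perp t1 \<bullet> (real M *\<^sub>R t2) \<noteq> 0"
    using assms(1) u(2) by (simp add: plane_basis_iff_perp)
  have "\<exists>x\<in>joints G. modulation (?\<phi> 1) u x \<noteq> 0"
  proof (rule mostly_close_imp_nonzero[OF close assms(3)])
    show "\<delta> < norm (modulation (?\<phi> 1) (\<lambda>_. \<beta>) x)" for x
      using assms(4) by (simp add: modulation_def phase_field_eq[OF basis] \<beta>_def)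
  qed simp
  then have "\<exists>x\<in>joints G. u x \<noteq> 0" by (auto simp: modulation_def)
  moreover have "mostly_close (joints G) \<epsilon> (modulation (?\<phi> \<omega>) u)
      (phase_tensor 1 \<omega> t1 (real M *\<^sub>R t2) 1 1 (\<lambda>_ _. \<beta>))" if "\<omega> \<in> sphere 0 1" for \<omega>
    unfolding phase_tensor_constant[OF basis] using close[OF that] assms(5)
    by (rule mostly_close_mono)
  ultimately show ?thesis
    unfolding localisation_flex_def using u
    by (auto intro!: exI[of _ "1::nat"] exI[of _ "\<lambda>_ _. \<beta>"])
qed

lemma slippage_imp_localisation:
  assumes "periodic_slippage_line G H"
  shows "periodic_localisation_line G H"
proof -
  obtain t1 t2 b where H: "Delone_framework G" "H = span {t1}" "plane_basis t1 t2" "b \<noteq> 0"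
    and slip: "\<And>\<epsilon>. \<epsilon> > 0 \<Longrightarrow> \<exists>u M. slippage_flex G t1 t2 b \<epsilon> M u"
    using assms unfolding periodic_slippage_line_iff by blast
  have "const_velocity b 0 \<noteq> 0" using H(4) by (auto simp: const_velocity_def vec_eq_iff)
  have "\<exists>u. \<exists>\<omega>1\<in>sphere 0 1. \<exists>M1 M2. localisation_flex G t1 t2 \<epsilon> \<omega>1 M1 M2 u" if "\<epsilon> > 0" for \<epsilon>
  proof -
    define \<delta> where "\<delta> = min \<epsilon> (min 1 (norm (const_velocity b 0) / 2))"
    have \<delta>: "\<delta> > 0" "\<delta> \<le> 1" "\<delta> < norm (const_velocity b 0)" "\<delta> \<le> \<epsilon>"
      using \<open>\<epsilon> > 0\<close> \<open>const_velocity b 0 \<noteq> 0\<close> by (auto simp: \<delta>_def min_def)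
    obtain u M where "slippage_flex G t1 t2 b \<delta> M u" using slip[OF \<delta>(1)] by blast
    from slippage_flex_imp_localisation_flex[OF H(3) this \<delta>(2-4)] show ?thesis by force
  qed
  then show ?thesis unfolding periodic_localisation_line_iff using H(1-3) by blast
qed

section \<open>Discrete sets of reals\<close>

lemma ex_gt_affine_in_Ints:
  fixes \<alpha> \<beta> a :: real
  assumes "\<beta> \<noteq> 0"
  shows "\<exists>t>a. \<alpha> + \<beta> * t \<in> \<int>"
proof -
  obtain k :: int where "a < (of_int k - \<alpha>) / \<beta>"
  proof (cases "\<beta> > 0")
    case True
    have "\<alpha> + \<beta> * a < of_int (\<lfloor>\<alpha> + \<beta> * a\<rfloor> + 1)" by linarith
    then show ?thesis using True
      by (intro that[of "\<lfloor>\<alpha> + \<beta> * a\<rfloor> + 1"]) (simp add: field_simps)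
  next
    case False
    have "of_int (\<lceil>\<alpha> + \<beta> * a\<rceil> - 1) < \<alpha> + \<beta> * a" by linarith
    then show ?thesis using False assms
      by (intro that[of "\<lceil>\<alpha> + \<beta> * a\<rceil> - 1"]) (simp add: field_simps)
  qed
  moreover have "\<alpha> + \<beta> * ((of_int k - \<alpha>) / \<beta>) = of_int k" using assms by simp
  ultimately show ?thesis by (metis Ints_of_int)
qed

lemma ex_lt_affine_in_Ints:
  fixes \<alpha> \<beta> a :: real
  assumes "\<beta> \<noteq> 0"
  shows "\<exists>t<a. \<alpha> + \<beta> * t \<in> \<int>"
proof -
  obtain t where "t > - a" "\<alpha> + (- \<beta>) * t \<in> \<int>"
    using ex_gt_affine_in_Ints[of "- \<beta>" "- a" \<alpha>] assms by auto
  then show ?thesis by (intro exI[of _ "- t"]) auto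
qed

lemma finite_affine_in_Ints:
  fixes \<alpha> \<beta> a b :: real
  assumes "\<beta> \<noteq> 0"
  shows "finite {t \<in> {a..b}. \<alpha> + \<beta> * t \<in> \<int>}"
proof -
  have "bounded ((\<lambda>t. \<alpha> + \<beta> * t) ` {a..b})"
    by (intro compact_imp_bounded compact_continuous_image continuous_intros) auto
  then obtain U where U: "\<forall>t\<in>{a..b}. \<bar>\<alpha> + \<beta> * t\<bar> \<le> U" by (auto simp: bounded_iff)
  have "{t \<in> {a..b}. \<alpha> + \<beta> * t \<in> \<int>} \<subseteq> (\<lambda>x. (x - \<alpha>) / \<beta>) ` {x \<in> \<int>. - U \<le> x \<and> x \<le> U}"
  proof
    fix t assume t: "t \<in> {t \<in> {a..b}. \<alpha> + \<beta> * t \<in> \<int>}"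
    then show "t \<in> (\<lambda>x. (x - \<alpha>) / \<beta>) ` {x \<in> \<int>. - U \<le> x \<and> x \<le> U}"
      using assms bspec[OF U, of t] by (intro image_eqI[of _ _ "\<alpha> + \<beta> * t"]) auto
  qed
  then show ?thesis by (rule finite_subset) (intro finite_imageI finite_int_segment)
qed

lemma locally_finite_successor:
  fixes X :: "real set"
  assumes finite: "\<And>a b. finite (X \<inter> {a..b})" and "b \<in> X" "x < b"
  shows "\<exists>y\<in>X. x < y \<and> X \<inter> {x<..<y} = {}"
proof -
  let ?F = "X \<inter> {x<..b}"
  have F: "finite ?F" "?F \<noteq> {}"
    using assms(2,3) by (auto intro: finite_subset[OF _ finite[of x b]])
  have "Min ?F \<in> ?F" using F by (rule Min_in)
  moreover have "z \<notin> {x<..<Min ?F}" if "z \<in> X" for z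
    using Min_le[OF F(1), of z] that \<open>Min ?F \<in> ?F\<close> by force
  ultimately show ?thesis by (intro bexI[of _ "Min ?F"]) auto
qed

lemma locally_finite_predecessor:
  fixes X :: "real set"
  assumes finite: "\<And>a b. finite (X \<inter> {a..b})" and "b \<in> X" "b < x"
  shows "\<exists>y\<in>X. y < x \<and> X \<inter> {y<..<x} = {}"
proof -
  have "finite (uminus ` X \<inter> {a..b})" for a b
    using finite_imageI[OF finite[of "- b" "- a"], of uminus] by (simp add: image_Int)
  then have "\<exists>y\<in>uminus ` X. - x < y \<and> uminus ` X \<inter> {- x<..<y} = {}"
    using assms(2,3) by (intro locally_finite_successor[of "uminus ` X" "- b"]) auto
  then obtain y where "y \<in> X" "y < x" "uminus ` X \<inter> {- x<..<- y} = {}" by auto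
  then show ?thesis by (intro bexI[of _ y]) force+
qed

lemma bi_infinite_chain:
  assumes "x0 \<in> X" "\<And>x. x \<in> X \<Longrightarrow> \<exists>y\<in>X. R x y" "\<And>y. y \<in> X \<Longrightarrow> \<exists>x\<in>X. R x y"
  obtains \<theta> :: "int \<Rightarrow> 'a" where "\<And>n. \<theta> n \<in> X" "\<And>n. R (\<theta> n) (\<theta> (n + 1))"
proof -
  obtain succ pred where step: "\<And>x. x \<in> X \<Longrightarrow> succ x \<in> X \<and> R x (succ x)"
    "\<And>x. x \<in> X \<Longrightarrow> pred x \<in> X \<and> R (pred x) x"
    using assms(2,3) by metis
  define \<theta> where "\<theta> n = (if 0 \<le> n then (succ ^^ nat n) x0 else (pred ^^ nat (- n)) x0)" for n :: int
  have "(succ ^^ k) x0 \<in> X" "(pred ^^ k) x0 \<in> X" for k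
    using \<open>x0 \<in> X\<close> step by (induction k) auto
  then have theta_in_X: "\<theta> n \<in> X" for n by (simp add: \<theta>_def)
  have "\<theta> (n + 1) = succ (\<theta> n) \<or> \<theta> n = pred (\<theta> (n + 1))" for n
  proof (cases "0 \<le> n")
    case True
    then have "nat (n + 1) = Suc (nat n)" by simp
    then show ?thesis using True by (simp add: \<theta>_def)
  next
    case False
    then have "nat (- n) = Suc (nat (- (n + 1)))" by simp
    moreover have "\<theta> (n + 1) = (pred ^^ nat (- (n + 1))) x0" using False by (auto simp: \<theta>_def)
    ultimately show ?thesis using False by (simp add: \<theta>_def)
  qed
  then have "R (\<theta> n) (\<theta> (n + 1))" for n using theta_in_X step by metis
  then show ?thesis using that theta_in_X by blast
qed

lemma locally_finite_enumeration:
  fixes X :: "real set"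
  assumes finite: "\<And>a b. finite (X \<inter> {a..b})"
    and above: "\<And>a. \<exists>x>a. x \<in> X" and below: "\<And>a. \<exists>x<a. x \<in> X"
  obtains \<theta> :: "int \<Rightarrow> real" where "\<And>n. \<theta> n \<in> X" "\<And>n. \<theta> n < \<theta> (n + 1)"
    "\<And>n. X \<inter> {\<theta> n<..<\<theta> (n + 1)} = {}"
proof -
  obtain x0 where "x0 \<in> X" using above by blast
  then obtain \<theta> :: "int \<Rightarrow> real" where "\<And>n. \<theta> n \<in> X"
      "\<And>n. \<theta> n < \<theta> (n + 1) \<and> X \<inter> {\<theta> n<..<\<theta> (n + 1)} = {}"
  proof (rule bi_infinite_chain[where R = "\<lambda>x y. x < y \<and> X \<inter> {x<..<y} = {}"])
    fix x assume "x \<in> X"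
    show "\<exists>y\<in>X. x < y \<and> X \<inter> {x<..<y} = {}"
      using above locally_finite_successor[OF finite] by blast
    show "\<exists>y\<in>X. y < x \<and> X \<inter> {y<..<x} = {}"
      using below locally_finite_predecessor[OF finite] by blast
  qed (rule that)
  then show ?thesis using that by blast
qed

section \<open>Parallelograms and their ribbons\<close>

definition parallelogram :: "real^2 \<Rightarrow> real^2 \<Rightarrow> real^2 \<Rightarrow> (real^2) set" where
  "parallelogram p a b = convex hull {p, p + a, p + b, p + a + b}"

lemma corner_in_parallelogram: "p \<in> parallelogram p a b"
  by (simp add: parallelogram_def hull_inc)

lemma parallelogram_subset_cball: "parallelogram p a b \<subseteq> cball p (norm a + norm b)"
proof -
  have "norm (a + b) \<le> norm a + norm b" by (rule norm_triangle_ineq)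
  then show ?thesis
    unfolding parallelogram_def
    by (intro hull_minimal convex_cball) (auto simp: dist_norm norm_minus_commute algebra_simps)
qed

lemma parallelogram_shift: "parallelogram (p + b) a (- b) = parallelogram p a b"
proof -
  have "{p + b, p + b + a, p + b + - b, p + b + a + - b} = {p, p + a, p + b, p + a + b}"
    by (auto simp: algebra_simps)
  then show ?thesis by (simp only: parallelogram_def)
qed

lemma edge_of_parallelogram:
  assumes "perp a \<bullet> b \<noteq> 0"
  shows "closed_segment p (p + a) edge_of parallelogram p a b"
    and "closed_segment (p + b) (p + b + a) edge_of parallelogram p a b"
proof -
  have edge: "closed_segment p (p + a) edge_of parallelogram p a b" if "perp a \<bullet> b \<noteq> 0" for p b
  proof -
    let ?S = "{p, p + a, p + b, p + a + b}"
    have "affine hull {p, p + a} \<subseteq> {x. perp a \<bullet> x = perp a \<bullet> p}"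
      by (rule hull_minimal) (auto simp: affine_hyperplane inner_add_right)
    moreover have "convex hull (?S - {p, p + a}) \<subseteq> {x. perp a \<bullet> x = perp a \<bullet> p + perp a \<bullet> b}"
      by (rule hull_minimal) (auto simp: convex_hyperplane inner_add_right)
    ultimately have "affine hull {p, p + a} \<inter> convex hull (?S - {p, p + a}) = {}"
      using that by fastforce
    then have "convex hull {p, p + a} face_of convex hull ?S"
      by (intro face_of_convex_hulls) auto
    moreover have "a \<noteq> 0" using that by auto
    ultimately show ?thesis
      by (simp add: edge_of_def parallelogram_def segment_convex_hull aff_dim_convex_hull aff_dim_2)
  qed
  show "closed_segment p (p + a) edge_of parallelogram p a b" using assms by (rule edge)
  show "closed_segment (p + b) (p + b + a) edge_of parallelogram p a b"
    using edge[of "- b" "p + b"] assms by (simp add: parallelogram_shift)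
qed

lemma face_of_contains_crossing_segment:
  fixes F C :: "'a::real_normed_vector set"
  assumes F: "F face_of C" and "x \<in> F" "y \<in> F" "x' \<in> C" "y' \<in> C" "x' \<noteq> y'" "x + y = x' + y'"
  shows "x' \<in> F" "y' \<in> F"
proof -
  have "midpoint x y \<in> F"
    using face_of_imp_convex[OF F] assms(2,3)
    by (meson convex_contains_segment midpoint_in_closed_segment subsetD)
  then have "midpoint x' y' \<in> F" using assms(7) by (simp add: midpoint_def)
  moreover have "midpoint x' y' \<in> open_segment x' y'" using assms(6) by simp
  ultimately show "x' \<in> F" "y' \<in> F" using face_ofD[OF F] assms(4,5) by blast+
qed

lemma collinear_three_points_imp_perp_eq_0:
  assumes "collinear e" "p \<in> e" "p + a \<in> e" "p + b \<in> e"
  shows "perp a \<bullet> b = 0"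
proof -
  obtain u where u: "\<And>x y. x \<in> e \<Longrightarrow> y \<in> e \<Longrightarrow> \<exists>c. x - y = c *\<^sub>R u"
    using assms(1) unfolding collinear_def by blast
  obtain c d where "p + a - p = c *\<^sub>R u" "p + b - p = d *\<^sub>R u" using u assms(2-4) by meson
  then show ?thesis by simp
qed

lemma edge_of_parallelogramD:
  assumes edge: "e edge_of parallelogram p a b" and transversal: "perp a \<bullet> b \<noteq> 0"
  shows "e \<in> {closed_segment p (p + a), closed_segment (p + b) (p + b + a),
    closed_segment p (p + b), closed_segment (p + a) (p + a + b)}"
proof -
  let ?S = "{p, p + a, p + b, p + a + b}"
  have face: "e face_of convex hull ?S" and dim: "aff_dim e = 1"
    using edge by (auto simp: edge_of_def parallelogram_def)
  obtain c where corners: "c \<subseteq> ?S" "e = convex hull c"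
    by (rule face_of_convex_hull_subset[OF _ face]) (simp_all add: finite_imp_compact)
  have diagonal: "x' \<in> e \<and> y' \<in> e"
    if "x \<in> e" "y \<in> e" "x' \<in> ?S" "y' \<in> ?S" "x' \<noteq> y'" "x + y = x' + y'" for x y x' y'
    using face_of_contains_crossing_segment[OF face that(1,2) _ _ that(5,6)] that(3,4)
    by (simp add: hull_inc)
  have "collinear e" using dim by (simp add: collinear_aff_dim)
  then have not_three: "\<not> (p \<in> e \<and> p + a \<in> e \<and> p + b \<in> e)"
    using collinear_three_points_imp_perp_eq_0 transversal by blast
  have nonzero: "a \<noteq> 0" "b \<noteq> 0" "a \<noteq> b" "a + b \<noteq> 0"
    using transversal by (auto simp: add_eq_0_iff)
  have "\<not> (p \<in> e \<and> p + a + b \<in> e)"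
    using diagonal[of p "p + a + b" "p + a" "p + b"] not_three nonzero by (auto simp: algebra_simps)
  moreover have "\<not> (p + a \<in> e \<and> p + b \<in> e)"
    using diagonal[of "p + a" "p + b" p "p + a + b"] not_three nonzero by (auto simp: algebra_simps)
  moreover have "c \<subseteq> e" unfolding corners(2) by (rule hull_subset)
  ultimately have "c \<subseteq> {p, p + a} \<or> c \<subseteq> {p + b, p + b + a} \<or> c \<subseteq> {p, p + b} \<or> c \<subseteq> {p + a, p + a + b}"
    using corners(1) by (auto simp: algebra_simps)
  moreover have "e = closed_segment x y" if "c \<subseteq> {x, y}" for x y
  proof -
    have "aff_dim c = 1" using dim corners(2) by (simp add: aff_dim_convex_hull)
    then have "c \<noteq> {}" "c \<noteq> {x}" "c \<noteq> {y}" by auto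
    then have "c = {x, y}" using that by blast
    then show ?thesis using corners(2) by (simp add: segment_convex_hull)
  qed
  ultimately show ?thesis by blast
qed

lemma closed_segment_same_vector_eqD:
  fixes p q d :: "'a::euclidean_space"
  assumes "closed_segment p (p + d) = closed_segment q (q + d)" "d \<noteq> 0"
  shows "p = q"
proof -
  have "{p, p + d} = {q, q + d}" using assms(1) by simp
  then have "p = q \<or> q + 2 *\<^sub>R d = q" by (auto simp: doubleton_eq_iff scaleR_2 add.assoc)
  then show ?thesis using assms(2) by simp
qed

lemma inj_stacked_parallelograms:
  fixes q :: "int \<Rightarrow> real^2"
  assumes ascending: "\<And>n. perp d \<bullet> q n < perp d \<bullet> q (n + 1)"
  shows "inj (\<lambda>n. parallelogram (q n) d (q (n + 1) - q n))"
proof (rule linorder_injI)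
  fix m n :: int assume "m < n"
  have "perp d \<bullet> q (m + 1) \<le> perp d \<bullet> q n"
    using \<open>m < n\<close>
    by (induction n rule: int_gr_induct) (auto intro: order_trans less_imp_le ascending)
  then have "perp d \<bullet> q m < perp d \<bullet> q n" using ascending[of m] by simp
  moreover have "parallelogram (q n) d (q (n + 1) - q n) \<subseteq> {x. perp d \<bullet> x \<ge> perp d \<bullet> q n}"
    unfolding parallelogram_def using ascending[of n]
    by (intro hull_minimal) (auto simp: convex_halfspace_ge inner_add_right inner_diff_right)
  moreover have "q m \<in> parallelogram (q m) d (q (m + 1) - q m)"
    by (rule corner_in_parallelogram)
  ultimately show "parallelogram (q m) d (q (m + 1) - q m) \<noteq> parallelogram (q n) d (q (n + 1) - q n)"
    by fastforce
qed

lemma ribbon_of_stacked_parallelograms: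
  fixes q :: "int \<Rightarrow> real^2"
  assumes ascending: "\<And>n. perp d \<bullet> q n < perp d \<bullet> q (n + 1)"
    and tile: "\<And>n. parallelogram (q n) d (q (n + 1) - q n) \<in> P"
  shows "ribbon P (\<lambda>n. parallelogram (q n) d (q (n + 1) - q n))"
  unfolding ribbon_def
proof (intro conjI exI[of _ "\<lambda>n. closed_segment (q (n + 1)) (q (n + 1) + d)"] allI)
  show "inj (\<lambda>n. parallelogram (q n) d (q (n + 1) - q n))"
    using ascending by (rule inj_stacked_parallelograms)
  have transversal: "perp d \<bullet> (q (n + 1) - q n) \<noteq> 0" for n
    using ascending[of n] by (simp add: inner_diff_right)
  fix n m :: int
  show "closed_segment (q (n + 1)) (q (n + 1) + d) edge_of parallelogram (q n) d (q (n + 1) - q n)"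
    using edge_of_parallelogram(2)[OF transversal, of "q n" n] by simp
  show "closed_segment (q (n + 1)) (q (n + 1) + d)
      edge_of parallelogram (q (n + 1)) d (q (n + 1 + 1) - q (n + 1))"
    using transversal by (rule edge_of_parallelogram(1))
  show "\<exists>c. closed_segment (q (m + 1)) (q (m + 1) + d) =
      (+) c ` closed_segment (q (n + 1)) (q (n + 1) + d)"
    by (intro exI[of _ "q (m + 1) - q (n + 1)"])
      (simp add: add.assoc[symmetric] flip: closed_segment_translation)
qed (use tile in blast)

section \<open>The dual map of a multigrid\<close>

lemma ceiling_near:
  fixes a :: real
  shows "\<forall>\<^sub>F b in nhds a. \<lceil>b\<rceil> = \<lceil>a\<rceil> + of_bool (a \<in> \<int> \<and> a < b) \<and> (b \<in> \<int> \<longleftrightarrow> a \<in> \<int> \<and> b = a)"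
proof -
  have "of_int \<lceil>a\<rceil> - 1 < a" "a < of_int \<lfloor>a\<rfloor> + 1" by linarith+
  then have "\<forall>\<^sub>F b in nhds a. of_int \<lceil>a\<rceil> - 1 < b" "\<forall>\<^sub>F b in nhds a. b < of_int \<lfloor>a\<rfloor> + 1"
    using order_tendstoD[OF filterlim_ident] by blast+
  then show ?thesis
  proof eventually_elim
    case (elim b)
    show ?case
    proof (cases "a \<in> \<int>")
      case True
      then obtain k where k: "a = of_int k" by (auto elim: Ints_cases)
      then have "b \<in> \<int> \<longleftrightarrow> b = a" using elim by (auto elim!: Ints_cases)
      moreover have "\<lceil>b\<rceil> = k + of_bool (a < b)"
        using elim k by (auto simp: ceiling_eq_iff)
      ultimately show ?thesis using True k by simp
    next
      case False
      then have "of_int \<lceil>a\<rceil> - 1 < b" "b < of_int \<lceil>a\<rceil>"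
        using elim by (simp_all add: ceiling_altdef) (metis Ints_of_int)
      then have "\<lceil>b\<rceil> = \<lceil>a\<rceil>" "b \<notin> \<int>" by (auto simp: ceiling_eq_iff elim!: Ints_cases)
      then show ?thesis using False by simp
    qed
  qed
qed

lemma not_Ints_ceiling_eq_iff:
  fixes a :: real
  shows "a \<notin> \<int> \<and> \<lceil>a\<rceil> = k \<longleftrightarrow> of_int k - 1 < a \<and> a < of_int k"
proof
  assume "a \<notin> \<int> \<and> \<lceil>a\<rceil> = k"
  moreover from this have "a \<noteq> of_int k" by (metis Ints_of_int)
  ultimately show "of_int k - 1 < a \<and> a < of_int k" by linarith
next
  assume "of_int k - 1 < a \<and> a < of_int k"
  then show "a \<notin> \<int> \<and> \<lceil>a\<rceil> = k" by (auto simp: ceiling_eq_iff elim!: Ints_cases)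
qed

lemma closed_unit_interval_iff_ceiling:
  fixes a :: real
  shows "of_int k - 1 \<le> a \<and> a \<le> of_int k \<longleftrightarrow> k = \<lceil>a\<rceil> \<or> a \<in> \<int> \<and> k = \<lceil>a\<rceil> + 1"
proof
  assume bounds: "of_int k - 1 \<le> a \<and> a \<le> of_int k"
  show "k = \<lceil>a\<rceil> \<or> a \<in> \<int> \<and> k = \<lceil>a\<rceil> + 1"
  proof (cases "a = of_int (k - 1)")
    case True
    then show ?thesis by simp
  next
    case False
    then have "k = \<lceil>a\<rceil>" using bounds by linarith
    then show ?thesis ..
  qed
next
  assume "k = \<lceil>a\<rceil> \<or> a \<in> \<int> \<and> k = \<lceil>a\<rceil> + 1"
  then show "of_int k - 1 \<le> a \<and> a \<le> of_int k"
  proof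
    assume "k = \<lceil>a\<rceil>"
    then show ?thesis by linarith
  qed (auto elim!: Ints_cases)
qed

lemma ceiling_diff_mult_pos:
  fixes a b :: real
  assumes "\<lceil>a\<rceil> \<noteq> \<lceil>b\<rceil>"
  shows "0 < (of_int \<lceil>b\<rceil> - of_int \<lceil>a\<rceil>) * (b - a)"
proof (cases "\<lceil>a\<rceil> < \<lceil>b\<rceil>")
  case True
  then have "a < b" by (meson ceiling_mono linorder_not_le)
  then show ?thesis using True by simp
next
  case False
  then have "\<lceil>b\<rceil> < \<lceil>a\<rceil>" using assms by simp
  moreover from this have "b < a" by (meson ceiling_mono linorder_not_le)
  ultimately show ?thesis by (intro mult_neg_neg) auto
qed

lemma floor_neq_imp_of_int_near:
  fixes a b :: real
  assumes "\<lfloor>a\<rfloor> \<noteq> \<lfloor>b\<rfloor>"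
  shows "\<exists>m::int. \<bar>a - of_int m\<bar> \<le> \<bar>a - b\<bar>"
proof (cases "a < b")
  case True
  then have "\<lfloor>a\<rfloor> < \<lfloor>b\<rfloor>" using floor_mono[of a b] assms by simp
  then have "a < of_int \<lfloor>b\<rfloor>" "of_int \<lfloor>b\<rfloor> \<le> b" by (simp_all add: floor_less_iff)
  then show ?thesis using True by (intro exI[of _ "\<lfloor>b\<rfloor>"]) linarith
next
  case False
  then have "\<lfloor>b\<rfloor> < \<lfloor>a\<rfloor>" using floor_mono[of b a] assms by simp
  then have "b < of_int \<lfloor>a\<rfloor>" "of_int \<lfloor>a\<rfloor> \<le> a" by (simp_all add: floor_less_iff)
  then show ?thesis using False by (intro exI[of _ "\<lfloor>a\<rfloor>"]) linarith
qed

locale multigrid_tiling =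
  fixes \<Gamma> :: multigrid and len :: "nat \<Rightarrow> real"
  assumes regular: "regular_multigrid \<Gamma>"
    and len_pos: "\<And>j. j < grid_count \<Gamma> \<Longrightarrow> 0 < len j"
begin

abbreviation "r \<equiv> grid_count \<Gamma>"
abbreviation "nrm \<equiv> normal \<Gamma>"
abbreviation "dual \<equiv> dual_point \<Gamma> len"
abbreviation "grid_dir j \<equiv> perp (nrm j)"

definition level :: "nat \<Rightarrow> real^2 \<Rightarrow> real" where
  "level j x = (x \<bullet> nrm j + shift \<Gamma> j) / spacing \<Gamma> j"

definition index :: "nat \<Rightarrow> real^2 \<Rightarrow> int" where
  "index j x = \<lceil>level j x\<rceil>"

definition grids_at :: "real^2 \<Rightarrow> nat set" where
  "grids_at x = {j. j < r \<and> level j x \<in> \<int>}"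

definition edge_vec :: "nat \<Rightarrow> real^2" where
  "edge_vec j = len j *\<^sub>R nrm j"

lemma is_multigrid: "is_multigrid \<Gamma>"
  using regular by (simp add: regular_multigrid_def)

lemma two_le_grid_count: "2 \<le> r"
  using is_multigrid by (simp add: is_multigrid_def)

lemma spacing_pos: "j < r \<Longrightarrow> 0 < spacing \<Gamma> j"
  using is_multigrid by (simp add: is_multigrid_def)

lemma norm_normal [simp]: "j < r \<Longrightarrow> norm (nrm j) = 1"
  using is_multigrid by (simp add: is_multigrid_def)

lemma normal_nonzero: "j < r \<Longrightarrow> nrm j \<noteq> 0"
  by (metis norm_normal norm_zero zero_neq_one)

lemma normals_not_parallel: "i < r \<Longrightarrow> j < r \<Longrightarrow> i \<noteq> j \<Longrightarrow> grid_dir i \<bullet> nrm j \<noteq> 0"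
  using is_multigrid normal_nonzero span_singleton_eq_iff_perp[of "nrm i" "nrm j"]
  by (simp add: is_multigrid_def)

lemma edge_vecs_not_parallel:
  "i < r \<Longrightarrow> j < r \<Longrightarrow> i \<noteq> j \<Longrightarrow> perp (edge_vec i) \<bullet> edge_vec j \<noteq> 0"
  using normals_not_parallel[of i j] len_pos[of i] len_pos[of j] by (simp add: edge_vec_def)

lemma norm_edge_vec [simp]: "j < r \<Longrightarrow> norm (edge_vec j) = len j"
  using len_pos[of j] by (simp add: edge_vec_def)

lemma edge_vec_nonzero: "j < r \<Longrightarrow> edge_vec j \<noteq> 0"
  by (metis len_pos less_irrefl norm_edge_vec norm_zero)

lemma grids_atD: "j \<in> grids_at x \<Longrightarrow> j < r"
  by (simp add: grids_at_def)

lemma level_eq_index: "j \<in> grids_at x \<Longrightarrow> level j x = of_int (index j x)"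
  by (auto simp: grids_at_def index_def elim: Ints_cases)

lemma level_add: "level j (x + v) = level j x + (v \<bullet> nrm j) / spacing \<Gamma> j"
  by (simp add: level_def inner_add_left add_divide_distrib)

lemma level_diff: "level j y = level j x + ((y - x) \<bullet> nrm j) / spacing \<Gamma> j"
  using level_add[of j x "y - x"] by simp

lemma level_midpoint: "2 * level j (midpoint x y) = level j x + level j y"
  by (simp add: level_def midpoint_def inner_add_left add_divide_distrib)

lemma level_along_grid [simp]: "level j (x + t *\<^sub>R grid_dir j) = level j x"
  by (simp add: level_add)

lemma level_less_iff: "j < r \<Longrightarrow> level j x < c \<longleftrightarrow> nrm j \<bullet> x < c * spacing \<Gamma> j - shift \<Gamma> j"
  and less_level_iff: "j < r \<Longrightarrow> c < level j x \<longleftrightarrow> nrm j \<bullet> x > c * spacing \<Gamma> j - shift \<Gamma> j"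
  using spacing_pos[of j] by (auto simp: level_def field_simps inner_commute)

lemma level_less_level_iff: "j < r \<Longrightarrow> level j x < level j y \<longleftrightarrow> 0 < (y - x) \<bullet> nrm j"
  using level_diff[of j y x] spacing_pos[of j] by (simp add: zero_less_divide_iff)

lemma level_eq_level_iff: "j < r \<Longrightarrow> level j y = level j x \<longleftrightarrow> (y - x) \<bullet> nrm j = 0"
  using level_diff[of j y x] spacing_pos[of j] by simp

lemma eq_if_two_levels_eq:
  assumes "i < r" "j < r" "i \<noteq> j" "level i x = level i y" "level j x = level j y"
  shows "x = y"
proof -
  have "nrm i \<bullet> (x - y) = 0" "nrm j \<bullet> (x - y) = 0"
    using assms level_eq_level_iff[of _ x y] by (auto simp: inner_commute)
  then have "x - y = 0"
    using orthogonal_to_basis_imp_0[OF normals_not_parallel] assms(1-3) by blast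
  then show ?thesis by simp
qed

lemma in_grid_line_iff: "j < r \<Longrightarrow> x \<in> grid_line \<Gamma> j k \<longleftrightarrow> level j x = of_int k"
  using spacing_pos[of j] by (auto simp: grid_line_def level_def field_simps)

lemma grids_at_iff: "j \<in> grids_at x \<longleftrightarrow> j < r \<and> (\<exists>k. x \<in> grid_line \<Gamma> j k)"
  by (auto simp: grids_at_def in_grid_line_iff Ints_def)

lemma grid_lines_eqD:
  assumes "i < r" "j < r" "x \<in> grid_line \<Gamma> i k" "grid_line \<Gamma> i k = grid_line \<Gamma> j l"
  shows "i = j"
proof (rule ccontr)
  assume "i \<noteq> j"
  have "x + 1 *\<^sub>R grid_dir i \<in> grid_line \<Gamma> i k"
    using assms(1,3) by (simp only: in_grid_line_iff level_along_grid)
  then have "level j (x + grid_dir i) = level j x"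
    using assms by (simp add: in_grid_line_iff[OF assms(2)])
  then show False
    using normals_not_parallel[OF assms(1,2) \<open>i \<noteq> j\<close>] spacing_pos[OF assms(2)]
    by (simp add: level_add)
qed

lemma grids_at_eq_pair:
  assumes "i \<in> grids_at x" "j \<in> grids_at x" "i \<noteq> j"
  shows "grids_at x = {i, j}"
proof (rule ccontr)
  assume "grids_at x \<noteq> {i, j}"
  then obtain l where l: "l \<in> grids_at x" "l \<noteq> i" "l \<noteq> j" using assms by blast
  obtain a b c where x: "x \<in> grid_line \<Gamma> i a" "x \<in> grid_line \<Gamma> j b" "x \<in> grid_line \<Gamma> l c"
    using assms l(1) by (auto simp: grids_at_iff)
  have "i < r" "j < r" "l < r" using assms l(1) by (auto dest: grids_atD)
  then have "distinct [grid_line \<Gamma> i a, grid_line \<Gamma> j b, grid_line \<Gamma> l c]"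
    using grid_lines_eqD[OF _ _ x(1)] grid_lines_eqD[OF _ _ x(2)] assms(3) l(2,3) by auto
  moreover have "{grid_line \<Gamma> i a, grid_line \<Gamma> j b, grid_line \<Gamma> l c} \<subseteq> grid_lines \<Gamma>"
    using assms l(1) by (auto simp: grid_lines_def dest: grids_atD)
  ultimately show False using regular x unfolding regular_multigrid_def by blast
qed

definition crossing :: "nat \<Rightarrow> nat \<Rightarrow> real^2 \<Rightarrow> bool" where
  "crossing i j x \<longleftrightarrow> i \<noteq> j \<and> grids_at x = {i, j}"

lemma crossingI: "i \<in> grids_at x \<Longrightarrow> j \<in> grids_at x \<Longrightarrow> i \<noteq> j \<Longrightarrow> crossing i j x"
  unfolding crossing_def using grids_at_eq_pair by blast

lemma crossingD:
  assumes "crossing i j x"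
  shows "i < r" "j < r" "i \<noteq> j" "i \<in> grids_at x" "j \<in> grids_at x"
  using assms by (auto simp: crossing_def dest: equalityD2 grids_atD)

lemma crossing_commute: "crossing i j x \<longleftrightarrow> crossing j i x"
  by (auto simp: crossing_def)

lemma direction_with_prescribed_products: "\<exists>v. \<forall>j\<in>grids_at x. v \<bullet> nrm j = \<sigma> j"
proof (cases "\<exists>i l. crossing i l x")
  case True
  then obtain i l where il: "crossing i l x" by blast
  let ?v = "(\<sigma> i / (grid_dir l \<bullet> nrm i)) *\<^sub>R grid_dir l + (\<sigma> l / (grid_dir i \<bullet> nrm l)) *\<^sub>R grid_dir i"
  have "?v \<bullet> nrm i = \<sigma> i" "?v \<bullet> nrm l = \<sigma> l"
    using normals_not_parallel crossingD[OF il] by (simp_all add: inner_add_left)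
  then show ?thesis using il unfolding crossing_def by (intro exI[of _ ?v]) auto
next
  case False
  show ?thesis
  proof (cases "grids_at x = {}")
    case False
    then obtain i where i: "grids_at x = {i}" using \<open>\<nexists>i l. crossing i l x\<close> crossingI by blast
    then have "(\<sigma> i *\<^sub>R nrm i) \<bullet> nrm i = \<sigma> i"
      using grids_atD[of i x] by (simp add: dot_square_norm)
    then show ?thesis using i by (intro exI[of _ "\<sigma> i *\<^sub>R nrm i"]) auto
  qed auto
qed

text \<open>The regions that meet at \<open>x\<close> correspond to the sets \<open>S\<close> of grids through \<open>x\<close>: \<open>corner x S y\<close>
  says that \<open>y\<close> has the ceilings of the region beyond the lines of the grids in \<open>S\<close>.\<close>

definition corner :: "real^2 \<Rightarrow> nat set \<Rightarrow> real^2 \<Rightarrow> bool" where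
  "corner x S y \<longleftrightarrow> S \<subseteq> grids_at x \<and> (\<forall>j<r. index j y = index j x + of_bool (j \<in> S))"

lemma cornerD:
  assumes "corner x S y"
  shows "S \<subseteq> grids_at x" "j < r \<Longrightarrow> index j y = index j x + of_bool (j \<in> S)"
  using assms by (auto simp: corner_def)

definition crossed :: "real^2 \<Rightarrow> real^2 \<Rightarrow> nat set" where
  "crossed x v = {j \<in> grids_at x. 0 < v \<bullet> nrm j}"

lemma corner_near:
  "\<forall>\<^sub>F y in nhds x. corner x (crossed x (y - x)) y \<and>
    grids_at y = {j \<in> grids_at x. (y - x) \<bullet> nrm j = 0}"
proof -
  have "\<forall>\<^sub>F y in nhds x. index j y = index j x + of_bool (level j x \<in> \<int> \<and> level j x < level j y) \<and>
      (level j y \<in> \<int> \<longleftrightarrow> level j x \<in> \<int> \<and> level j y = level j x)" if "j < r" for j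
  proof -
    have "(level j \<longlongrightarrow> level j x) (nhds x)"
      unfolding level_def using spacing_pos[OF that]
      by (auto intro!: tendsto_intros filterlim_ident)
    from eventually_compose_filterlim[OF ceiling_near this] show ?thesis by (simp add: index_def)
  qed
  then have "\<forall>\<^sub>F y in nhds x. \<forall>j\<in>{..<r}.
      index j y = index j x + of_bool (level j x \<in> \<int> \<and> level j x < level j y) \<and>
      (level j y \<in> \<int> \<longleftrightarrow> level j x \<in> \<int> \<and> level j y = level j x)"
    by (intro eventually_ball_finite) auto
  then show ?thesis
  proof eventually_elim
    case (elim y)
    then show ?case
      by (auto simp: corner_def crossed_def grids_at_def level_less_level_iff level_eq_level_iff)
  qed
qed

lemma dual_eq: "dual x = (\<Sum>j<r. of_int (index j x) *\<^sub>R edge_vec j)"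
  by (simp add: dual_point_def index_def level_def edge_vec_def)

lemma dual_corner:
  assumes "corner x S y"
  shows "dual y = dual x + sum edge_vec S"
proof -
  have "S \<subseteq> {..<r}" using cornerD(1)[OF assms] by (auto dest: grids_atD)
  have "dual y = (\<Sum>j<r. of_int (index j x) *\<^sub>R edge_vec j + (if j \<in> S then edge_vec j else 0))"
    unfolding dual_eq by (intro sum.cong) (auto simp: cornerD(2)[OF assms] scaleR_add_left)
  also have "\<dots> = dual x + sum edge_vec S"
    using \<open>S \<subseteq> {..<r}\<close> by (simp add: sum.distrib dual_eq sum.If_cases Int_absorb1)
  finally show ?thesis .
qed

lemma dual_near: "\<forall>\<^sub>F y in nhds x. dual y = dual x + sum edge_vec (crossed x (y - x))"
  using corner_near[of x] by eventually_elim (simp add: dual_corner)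

lemma dual_near_on_line:
  "\<forall>\<^sub>F t in nhds s. dual (x + t *\<^sub>R v) =
     dual (x + s *\<^sub>R v) + sum edge_vec (crossed (x + s *\<^sub>R v) ((t - s) *\<^sub>R v))"
proof -
  have "((\<lambda>t. x + t *\<^sub>R v) \<longlongrightarrow> x + s *\<^sub>R v) (nhds s)"
    by (intro tendsto_intros filterlim_ident)
  from eventually_compose_filterlim[OF dual_near this] show ?thesis
    by (simp add: scaleR_diff_left)
qed

lemma ex_corner_in_direction:
  "\<exists>t>0. corner x (crossed x v) (x + t *\<^sub>R v) \<and>
    grids_at (x + t *\<^sub>R v) = {j \<in> grids_at x. v \<bullet> nrm j = 0}"
proof -
  have "((\<lambda>t. x + t *\<^sub>R v) \<longlongrightarrow> x + 0 *\<^sub>R v) (at_right (0::real))"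
    by (intro tendsto_intros)
  then have "filterlim (\<lambda>t. x + t *\<^sub>R v) (nhds x) (at_right (0::real))" by simp
  from eventually_compose_filterlim[OF corner_near this] eventually_at_right_less[of "0::real"]
  have "\<forall>\<^sub>F t in at_right 0. t > 0 \<and> corner x (crossed x v) (x + t *\<^sub>R v) \<and>
      grids_at (x + t *\<^sub>R v) = {j \<in> grids_at x. v \<bullet> nrm j = 0}"
    by eventually_elim (simp add: crossed_def zero_less_mult_iff)
  then show ?thesis
    using eventually_happens'[OF trivial_limit_at_right_real] by blast
qed

lemma ex_generic_corner:
  assumes "S \<subseteq> grids_at x"
  shows "\<exists>y. grids_at y = {} \<and> corner x S y"
proof -
  obtain v where v: "\<And>j. j \<in> grids_at x \<Longrightarrow> v \<bullet> nrm j = (if j \<in> S then 1 else -1)"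
    using direction_with_prescribed_products[of x "\<lambda>j. if j \<in> S then 1 else -1"] by blast
  then have "crossed x v = S" "{j \<in> grids_at x. v \<bullet> nrm j = 0} = {}"
    using assms by (auto simp: crossed_def split: if_splits)
  then show ?thesis using ex_corner_in_direction[of x v] by metis
qed

lemma dual_plus_edge_vec:
  assumes "j \<in> grids_at x"
  obtains y where "dual y = dual x + edge_vec j" "corner x {j} y"
proof -
  obtain y where "corner x {j} y" using ex_generic_corner[of "{j}" x] assms by blast
  then show ?thesis using that[of y] dual_corner[of x "{j}" y] by simp
qed

lemma dual_plus_edge_vec_on_grid:
  assumes "crossing i j x"
  obtains y where "dual y = dual x + edge_vec i" "j \<in> grids_at y"
proof -
  obtain v where v: "\<And>l. l \<in> grids_at x \<Longrightarrow> v \<bullet> nrm l = (if l = i then 1 else 0)"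
    using direction_with_prescribed_products[of x "\<lambda>l. if l = i then 1 else 0"] by blast
  have "crossed x v = {i}" "j \<in> {l \<in> grids_at x. v \<bullet> nrm l = 0}"
    using v crossingD[OF assms] by (auto simp: crossed_def split: if_splits)
  then obtain t where "corner x {i} (x + t *\<^sub>R v)" "j \<in> grids_at (x + t *\<^sub>R v)"
    using ex_corner_in_direction[of x v] by metis
  then show ?thesis using that[of "x + t *\<^sub>R v"] dual_corner[of x "{i}"] by simp
qed

text \<open>The dual map is monotone: \<open>(y - x) \<bullet> (dual y - dual x)\<close> is a sum of nonnegative terms, with a
  positive term for every grid that separates \<open>x\<close> from \<open>y\<close>.\<close>

lemma dual_eq_imp_index_eq:
  assumes "dual x = dual y" "j < r"
  shows "index j x = index j y"
proof (rule ccontr)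
  assume separated: "index j x \<noteq> index j y"
  have summand: "(of_int (index i y) - of_int (index i x)) * ((y - x) \<bullet> edge_vec i) =
      len i * spacing \<Gamma> i * ((of_int (index i y) - of_int (index i x)) * (level i y - level i x))"
    if "i < r" for i
    using level_diff[of i y x] spacing_pos[OF that] by (simp add: edge_vec_def)
  have pos: "0 < (of_int (index i y) - of_int (index i x)) * ((y - x) \<bullet> edge_vec i)"
    if "i < r" "index i x \<noteq> index i y" for i
    unfolding summand[OF that(1)]
    using ceiling_diff_mult_pos[of "level i x" "level i y", folded index_def, OF that(2)]
    by (intro mult_pos_pos[OF mult_pos_pos[OF len_pos[OF that(1)] spacing_pos[OF that(1)]]])
  have "0 < (\<Sum>i<r. (of_int (index i y) - of_int (index i x)) * ((y - x) \<bullet> edge_vec i))"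
  proof (rule sum_pos2[of _ j])
    fix i assume "i \<in> {..<r}"
    then show "0 \<le> (of_int (index i y) - of_int (index i x)) * ((y - x) \<bullet> edge_vec i)"
      using pos[of i] by (cases "index i x = index i y") (auto intro: less_imp_le)
  qed (use pos assms(2) separated in auto)
  also have "\<dots> = (y - x) \<bullet> (dual y - dual x)"
    by (simp add: dual_eq inner_sum_right flip: sum_subtractf scaleR_diff_left)
  finally show False using assms(1) by simp
qed

section \<open>Regions, vertices, edges and tiles\<close>

definition region :: "real^2 \<Rightarrow> (real^2) set" where
  "region x = {y. grids_at y = {} \<and> (\<forall>j<r. index j y = index j x)}"

lemma region_self: "grids_at x = {} \<Longrightarrow> x \<in> region x"
  by (simp add: region_def)

lemma region_cong: "(\<And>j. j < r \<Longrightarrow> index j x = index j y) \<Longrightarrow> region x = region y"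
  by (auto simp: region_def)

lemma in_region_iff:
  "y \<in> region x \<longleftrightarrow> (\<forall>j<r. of_int (index j x) - 1 < level j y \<and> level j y < of_int (index j x))"
  unfolding region_def grids_at_def index_def using not_Ints_ceiling_eq_iff by blast

definition region_halfspaces :: "real^2 \<Rightarrow> (real^2) set set" where
  "region_halfspaces x =
     (\<lambda>j. {y. of_int (index j x) - 1 < level j y}) ` {..<r} \<union>
     (\<lambda>j. {y. level j y < of_int (index j x)}) ` {..<r}"

lemma region_eq_Inter_halfspaces: "region x = \<Inter> (region_halfspaces x)"
  unfolding region_halfspaces_def Inter_Un_distrib by (auto simp: in_region_iff)

lemma region_halfspaces_convex_open: "S \<in> region_halfspaces x \<Longrightarrow> convex S \<and> open S"
  by (auto simp: region_halfspaces_def level_less_iff less_level_iff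
      convex_halfspace_lt convex_halfspace_gt open_halfspace_lt open_halfspace_gt)

lemma convex_region: "convex (region x)"
  unfolding region_eq_Inter_halfspaces using region_halfspaces_convex_open
  by (intro convex_Inter) blast

lemma closure_level_halfspaces:
  assumes "j < r"
  shows "closure {y. level j y < c} = {y. level j y \<le> c}"
    "closure {y. c < level j y} = {y. c \<le> level j y}"
  using closure_halfspace_lt[of "nrm j"] closure_halfspace_gt[of "nrm j"] normal_nonzero[OF assms]
  by (simp_all add: level_less_iff[OF assms] less_level_iff[OF assms] flip: not_less)

lemma in_closure_region_iff:
  assumes "grids_at y = {}"
  shows "z \<in> closure (region y) \<longleftrightarrow>
      (\<forall>j<r. of_int (index j y) - 1 \<le> level j z \<and> level j z \<le> of_int (index j y))"
proof -
  have "closure (region y) = \<Inter> (closure ` region_halfspaces y)"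
    using region_self[OF assms] region_halfspaces_convex_open
      closure_Inter_convex_open[of "region_halfspaces y"]
    by (auto simp flip: region_eq_Inter_halfspaces)
  also have "\<dots> = (\<Inter>j<r. {z. of_int (index j y) - 1 \<le> level j z}) \<inter>
      (\<Inter>j<r. {z. level j z \<le> of_int (index j y)})"
    by (simp add: region_halfspaces_def image_Un image_image Inter_Un_distrib
        closure_level_halfspaces)
  finally show ?thesis by auto
qed

lemma in_closure_region_iff_corner:
  assumes "grids_at y = {}"
  shows "z \<in> closure (region y) \<longleftrightarrow> (\<exists>S. corner z S y)"
proof -
  have "z \<in> closure (region y) \<longleftrightarrow>
      (\<forall>j<r. index j y = index j z \<or> j \<in> grids_at z \<and> index j y = index j z + 1)"
    unfolding in_closure_region_iff[OF assms] closed_unit_interval_iff_ceiling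
    by (auto simp: index_def grids_at_def)
  also have "\<dots> \<longleftrightarrow> (\<exists>S. corner z S y)"
  proof
    assume ceilings: "\<forall>j<r. index j y = index j z \<or> j \<in> grids_at z \<and> index j y = index j z + 1"
    have "corner z {j. j < r \<and> index j y = index j z + 1} y"
      using ceilings by (auto simp: corner_def)
    then show "\<exists>S. corner z S y" ..
  qed (auto simp: corner_def split: if_splits)
  finally show ?thesis .
qed

lemma complement_grid_lines: "- \<Union> (grid_lines \<Gamma>) = {x. grids_at x = {}}"
  unfolding grid_lines_def using grids_at_iff by blast

lemma connected_component_eq_region:
  assumes "grids_at x = {}"
  shows "connected_component_set {x. grids_at x = {}} x = region x"
proof
  show "region x \<subseteq> connected_component_set {x. grids_at x = {}} x"
    using region_self[OF assms] convex_connected[OF convex_region]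
    by (intro connected_component_maximal) (auto simp: region_def)
  show "connected_component_set {x. grids_at x = {}} x \<subseteq> region x"
  proof
    fix y assume "y \<in> connected_component_set {x. grids_at x = {}} x"
    then obtain T where T: "connected T" "T \<subseteq> {x. grids_at x = {}}" "x \<in> T" "y \<in> T"
      by (auto simp: connected_component_def)
    have "index j x = index j y" if "j < r" for j
    proof (rule connected_local_const[OF T(1,3,4)], intro ballI)
      fix a assume "a \<in> T"
      then have "grids_at a = {}" using T(2) by blast
      have "\<forall>\<^sub>F b in nhds a. index j a = index j b"
        using corner_near[of a]
        by eventually_elim (use \<open>grids_at a = {}\<close> that in \<open>auto simp: corner_def\<close>)
      then show "\<forall>\<^sub>F b in at a within T. index j a = index j b"
        by (simp add: eventually_at_filter eventually_mono)
    qed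
    then show "y \<in> region x" using T by (auto simp: region_def)
  qed
qed

lemma grid_regions_eq: "grid_regions \<Gamma> = region ` {x. grids_at x = {}}"
  unfolding grid_regions_def complement_grid_lines components_def
  using connected_component_eq_region by auto

lemma grid_regionD:
  assumes "C \<in> grid_regions \<Gamma>" "x \<in> C"
  shows "grids_at x = {}" "C = region x"
  using assms region_cong[of x] by (auto simp: grid_regions_eq region_def)

lemma region_in_grid_regions: "grids_at x = {} \<Longrightarrow> region x \<in> grid_regions \<Gamma>"
  by (auto simp: grid_regions_eq)

lemma tiling_vertices_eq: "tiling_vertices \<Gamma> len = range dual"
proof
  show "range dual \<subseteq> tiling_vertices \<Gamma> len"
  proof (rule image_subsetI)
    fix x
    obtain y where y: "grids_at y = {}" "corner x {} y" using ex_generic_corner[of "{}" x] by blast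
    then have "dual x = dual y" using dual_corner[of x "{}" y] by simp
    then show "dual x \<in> tiling_vertices \<Gamma> len"
      unfolding tiling_vertices_def using region_in_grid_regions[OF y(1)] region_self[OF y(1)]
      by blast
  qed
qed (auto simp: tiling_vertices_def)

lemma corner_at_midpoint:
  assumes "grids_at w = {}" "a \<in> closure (region w)" "b \<in> closure (region w)" "a \<noteq> b"
    and "j < r" "level j a = level j b" and corner: "corner (midpoint a b) S w"
  shows "S \<subseteq> {j}"
proof
  let ?z = "midpoint a b"
  fix i assume "i \<in> S"
  then have i: "i \<in> grids_at ?z" "i < r" using cornerD(1)[OF corner] by (auto dest: grids_atD)
  then have "index i w = index i ?z + 1" using cornerD(2)[OF corner] \<open>i \<in> S\<close> by simp
  then have "level i ?z \<le> level i a" "level i ?z \<le> level i b"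
    using assms(1-3) i(2) level_eq_index[OF i(1)] by (force simp: in_closure_region_iff)+
  then have "level i a = level i b" using level_midpoint[of i a b] by linarith
  then show "i \<in> {j}" using eq_if_two_levels_eq[of i j a b] i(2) assms(4-6) by auto
qed

lemma corners_of_adjacent_regions:
  assumes adj: "adjacent_regions \<Gamma> (region x) (region y)"
    and generic: "grids_at x = {}" "grids_at y = {}"
  obtains z j where "j \<in> grids_at z"
    "corner z {} x \<and> corner z {j} y \<or> corner z {j} x \<and> corner z {} y"
proof -
  obtain A a b where A: "A \<in> grid_lines \<Gamma>" "a \<noteq> b"
      "closed_segment a b \<subseteq> A \<inter> closure (region x) \<inter> closure (region y)"
    using adj unfolding adjacent_regions_def by blast
  obtain j k where j: "j < r" "A = grid_line \<Gamma> j k" using A(1) unfolding grid_lines_def by blast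
  have closure: "{a, b, midpoint a b} \<subseteq> closure (region x) \<inter> closure (region y)"
    using A(3) by (auto simp: subset_iff)
  have line: "level j a = of_int k" "level j b = of_int k"
    using A(3) j in_grid_line_iff by (auto simp: subset_iff)
  obtain S S' where S: "corner (midpoint a b) S x" "corner (midpoint a b) S' y"
    using closure generic by (auto simp: in_closure_region_iff_corner)
  have "S \<noteq> S'"
  proof
    assume "S = S'"
    then have "region x = region y" using S by (intro region_cong) (simp add: corner_def)
    then show False using adj by (simp add: adjacent_regions_def)
  qed
  moreover have "S \<subseteq> {j}" "S' \<subseteq> {j}"
    using corner_at_midpoint[OF generic(1) _ _ A(2) j(1) _ S(1)]
      corner_at_midpoint[OF generic(2) _ _ A(2) j(1) _ S(2)] closure line by auto
  ultimately have "S = {} \<and> S' = {j} \<or> S = {j} \<and> S' = {}" by blast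
  moreover have "j \<in> grids_at (midpoint a b)"
    using line j(1) level_midpoint[of j a b] by (simp add: grids_at_def)
  ultimately show ?thesis using that S by blast
qed

lemma ex_direction_along_grid:
  assumes "j \<in> grids_at x"
  shows "\<exists>v. v \<noteq> 0 \<and> v \<bullet> nrm j = 0 \<and> crossed x v = {}"
proof (cases "crossed x (grid_dir j) = {}")
  case True
  then show ?thesis
    using normal_nonzero[OF grids_atD[OF assms]] by (intro exI[of _ "grid_dir j"]) simp
next
  case False
  then obtain i where i: "i \<in> grids_at x" "0 < grid_dir j \<bullet> nrm i" by (auto simp: crossed_def)
  then have "grids_at x = {i, j}" using assms by (intro grids_at_eq_pair) auto
  then have "crossed x (- grid_dir j) = {}" using i(2) by (auto simp: crossed_def)
  then show ?thesis
    using normal_nonzero[OF grids_atD[OF assms]] by (intro exI[of _ "- grid_dir j"]) simp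
qed

lemma convex_grid_line: "convex (grid_line \<Gamma> j k)"
proof -
  have "grid_line \<Gamma> j k = {x. nrm j \<bullet> x = of_int k * spacing \<Gamma> j - shift \<Gamma> j}"
    by (auto simp: grid_line_def inner_commute)
  then show ?thesis by (simp add: convex_hyperplane)
qed

lemma adjacent_regions_beside_grid:
  assumes j: "j \<in> grids_at x"
    and y: "grids_at y = {}" "corner x {} y" and y': "grids_at y' = {}" "corner x {j} y'"
  shows "adjacent_regions \<Gamma> (region y) (region y')"
proof -
  have "j < r" using j by (rule grids_atD)
  obtain v where v: "v \<noteq> 0" "v \<bullet> nrm j = 0" "crossed x v = {}"
    using ex_direction_along_grid[OF j] by blast
  obtain t where t: "t > 0" "corner x {} (x + t *\<^sub>R v)"
      "grids_at (x + t *\<^sub>R v) = {l \<in> grids_at x. v \<bullet> nrm l = 0}"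
    using ex_corner_in_direction[of x v] v(3) by auto
  let ?z = "x + t *\<^sub>R v" and ?L = "grid_line \<Gamma> j (index j x)"
  have "j \<in> grids_at ?z" using j v(2) t(3) by simp
  then have "corner ?z {} y" "corner ?z {j} y'"
    using t(2) y(2) y'(2) by (simp_all add: corner_def)
  then have closure: "{x, ?z} \<subseteq> closure (region y) \<inter> closure (region y')"
    using y y' by (auto simp: in_closure_region_iff_corner)
  have "{x, ?z} \<subseteq> ?L"
    using v(2) level_eq_index[OF j] \<open>j < r\<close> by (simp add: in_grid_line_iff level_add)
  then have "closed_segment x ?z \<subseteq> ?L \<inter> closure (region y) \<inter> closure (region y')"
    using closure
    by (intro closed_segment_subset convex_Int convex_closure convex_region convex_grid_line) auto
  moreover have "x \<noteq> ?z" using t(1) v(1) by simp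
  moreover have "?L \<in> grid_lines \<Gamma>" using \<open>j < r\<close> by (auto simp: grid_lines_def)
  moreover have "region y \<noteq> region y'"
  proof
    assume "region y = region y'"
    then have "y \<in> region y'" using region_self[OF y(1)] by simp
    then have "index j y = index j y'" using \<open>j < r\<close> by (simp add: region_def)
    then show False using cornerD(2)[OF y(2) \<open>j < r\<close>] cornerD(2)[OF y'(2) \<open>j < r\<close>] by simp
  qed
  ultimately show ?thesis
    unfolding adjacent_regions_def using region_in_grid_regions y(1) y'(1) by blast
qed

lemma tiling_edges_eq: "tiling_edges \<Gamma> len = {{dual x, dual x + edge_vec j} | x j. j \<in> grids_at x}"
proof
  show "tiling_edges \<Gamma> len \<subseteq> {{dual x, dual x + edge_vec j} | x j. j \<in> grids_at x}"
  proof
    fix e assume "e \<in> tiling_edges \<Gamma> len"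
    then obtain x y C D where e: "e = {dual x, dual y}"
      and adjacent: "adjacent_regions \<Gamma> C D" "x \<in> C" "y \<in> D"
      unfolding tiling_edges_def by blast
    then have "adjacent_regions \<Gamma> (region x) (region y)" "grids_at x = {}" "grids_at y = {}"
      using grid_regionD unfolding adjacent_regions_def by metis+
    then obtain z j where "j \<in> grids_at z"
        "corner z {} x \<and> corner z {j} y \<or> corner z {j} x \<and> corner z {} y"
      by (rule corners_of_adjacent_regions)
    moreover from this have "e = {dual z, dual z + edge_vec j}"
      unfolding e using dual_corner[of z "{}"] dual_corner[of z "{j}"] by auto
    ultimately show "e \<in> {{dual x, dual x + edge_vec j} | x j. j \<in> grids_at x}" by blast
  qed
  show "{{dual x, dual x + edge_vec j} | x j. j \<in> grids_at x} \<subseteq> tiling_edges \<Gamma> len"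
  proof clarify
    fix x j assume j: "j \<in> grids_at x"
    obtain y where y: "grids_at y = {}" "corner x {} y" using ex_generic_corner[of "{}" x] by blast
    obtain y' where y': "grids_at y' = {}" "corner x {j} y'"
      using ex_generic_corner[of "{j}" x] j by blast
    have "{dual y, dual y'} \<in> tiling_edges \<Gamma> len"
      using adjacent_regions_beside_grid[OF j y y'] region_self[OF y(1)] region_self[OF y'(1)]
      unfolding tiling_edges_def by blast
    then show "{dual x, dual x + edge_vec j} \<in> tiling_edges \<Gamma> len"
      using dual_corner[OF y(2)] dual_corner[OF y'(2)] by simp
  qed
qed

lemma tile_at_crossing:
  assumes "crossing i j x"
  shows "tile_at \<Gamma> len x = parallelogram (dual x) (edge_vec i) (edge_vec j)"
proof -
  have "{dual y | y C. C \<in> grid_regions \<Gamma> \<and> x \<in> closure C \<and> y \<in> C} =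
      (\<lambda>S. dual x + sum edge_vec S) ` Pow (grids_at x)" (is "?V = ?W")
  proof
    show "?V \<subseteq> ?W"
    proof clarify
      fix y C assume "C \<in> grid_regions \<Gamma>" "x \<in> closure C" "y \<in> C"
      then obtain S where "corner x S y"
        using grid_regionD[of C y] in_closure_region_iff_corner[of y x] by auto
      then show "dual y \<in> ?W" using dual_corner by (auto simp: corner_def)
    qed
    show "?W \<subseteq> ?V"
    proof (rule image_subsetI)
      fix S assume "S \<in> Pow (grids_at x)"
      then obtain y where y: "grids_at y = {}" "corner x S y" using ex_generic_corner by blast
      then have "x \<in> closure (region y)" by (auto simp: in_closure_region_iff_corner)
      then show "dual x + sum edge_vec S \<in> ?V"
        using y region_self[OF y(1)] region_in_grid_regions[OF y(1)] dual_corner[OF y(2), symmetric]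
        by blast
    qed
  qed
  also have "\<dots> =
      {dual x, dual x + edge_vec i, dual x + edge_vec j, dual x + edge_vec i + edge_vec j}"
    using assms by (auto simp: crossing_def Pow_insert algebra_simps)
  finally show ?thesis by (simp add: tile_at_def parallelogram_def)
qed

lemma tiling_tiles_eq: "tiling_tiles \<Gamma> len = {tile_at \<Gamma> len x | x i j. crossing i j x}"
proof
  show "tiling_tiles \<Gamma> len \<subseteq> {tile_at \<Gamma> len x | x i j. crossing i j x}"
  proof
    fix P assume "P \<in> tiling_tiles \<Gamma> len"
    then obtain x A B where P: "P = tile_at \<Gamma> len x" "A \<in> grid_lines \<Gamma>" "B \<in> grid_lines \<Gamma>"
          "A \<noteq> B" "x \<in> A" "x \<in> B"
      unfolding tiling_tiles_def by blast
    then obtain i k j l where ij: "i < r" "A = grid_line \<Gamma> i k" "j < r" "B = grid_line \<Gamma> j l"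
      unfolding grid_lines_def by blast
    have "i \<noteq> j" using P ij by (auto simp: in_grid_line_iff)
    then have "crossing i j x" using P ij by (intro crossingI) (auto simp: grids_at_iff)
    then show "P \<in> {tile_at \<Gamma> len x | x i j. crossing i j x}" using P(1) by blast
  qed
  show "{tile_at \<Gamma> len x | x i j. crossing i j x} \<subseteq> tiling_tiles \<Gamma> len"
  proof clarify
    fix x i j assume "crossing i j x"
    then have ij: "i < r" "j < r" "i \<noteq> j" "i \<in> grids_at x" "j \<in> grids_at x"
      by (auto dest: crossingD)
    then obtain k l where kl: "x \<in> grid_line \<Gamma> i k" "x \<in> grid_line \<Gamma> j l"
      by (auto simp: grids_at_iff)
    moreover have "grid_line \<Gamma> i k \<noteq> grid_line \<Gamma> j l" using grid_lines_eqD ij kl by blast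
    ultimately show "tile_at \<Gamma> len x \<in> tiling_tiles \<Gamma> len"
      using ij unfolding tiling_tiles_def grid_lines_def by blast
  qed
qed

section \<open>The linear approximation of the dual map\<close>

definition frame_op :: "real^2 \<Rightarrow> real^2" where
  "frame_op x = (\<Sum>j<r. (len j / spacing \<Gamma> j * (x \<bullet> nrm j)) *\<^sub>R nrm j)"

lemma linear_frame_op: "linear frame_op"
  unfolding frame_op_def
  by (intro linearI)
    (simp_all add: inner_add_left sum.distrib[symmetric] scaleR_sum_right algebra_simps)

lemma inj_frame_op: "inj frame_op"
proof (subst linear_injective_0[OF linear_frame_op], intro allI impI)
  fix x assume "frame_op x = 0"
  then have "0 = x \<bullet> frame_op x" by simp
  also have "\<dots> = (\<Sum>j<r. len j / spacing \<Gamma> j * (x \<bullet> nrm j)\<^sup>2)"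
    by (simp add: frame_op_def inner_sum_right power2_eq_square mult.assoc)
  finally have "(\<Sum>j<r. len j / spacing \<Gamma> j * (x \<bullet> nrm j)\<^sup>2) = 0" by simp
  moreover have pos: "0 < len j / spacing \<Gamma> j" if "j < r" for j
    using len_pos spacing_pos that by simp
  then have "0 \<le> len j / spacing \<Gamma> j * (x \<bullet> nrm j)\<^sup>2" if "j < r" for j
    using that by (intro mult_nonneg_nonneg less_imp_le[OF pos]) auto
  ultimately have zero: "\<forall>j\<in>{..<r}. len j / spacing \<Gamma> j * (x \<bullet> nrm j)\<^sup>2 = 0"
    by (subst (asm) sum_nonneg_eq_0_iff) auto
  have "nrm j \<bullet> x = 0" if "j < r" for j
    using bspec[OF zero, of j] pos[OF that] that by (auto simp: inner_commute)
  then have "nrm 0 \<bullet> x = 0" "nrm 1 \<bullet> x = 0" using two_le_grid_count by auto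
  then show "x = 0"
    using orthogonal_to_basis_imp_0[OF normals_not_parallel[of 0 1]] two_le_grid_count by auto
qed

lemma surj_frame_op: "surj frame_op"
  by (rule linear_inj_imp_surj[OF linear_frame_op inj_frame_op])

lemma dual_near_frame_op: obtains E where "\<And>x. norm (dual x - frame_op x) \<le> E"
proof (rule that)
  fix x
  have "dual x - frame_op x = (\<Sum>j<r. (of_int (index j x) - (x \<bullet> nrm j) / spacing \<Gamma> j) *\<^sub>R edge_vec j)"
    unfolding dual_eq frame_op_def sum_subtractf[symmetric]
    by (intro sum.cong) (simp_all add: edge_vec_def algebra_simps)
  also have "norm \<dots> \<le> (\<Sum>j<r. (1 + \<bar>shift \<Gamma> j / spacing \<Gamma> j\<bar>) * len j)"
  proof (rule sum_norm_le)
    fix j assume "j \<in> {..<r}"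
    then have "j < r" by simp
    have "(x \<bullet> nrm j) / spacing \<Gamma> j = level j x - shift \<Gamma> j / spacing \<Gamma> j"
      by (simp add: level_def add_divide_distrib)
    moreover have "\<bar>of_int (index j x) - level j x\<bar> \<le> 1" unfolding index_def by linarith
    ultimately have "\<bar>of_int (index j x) - (x \<bullet> nrm j) / spacing \<Gamma> j\<bar>
        \<le> 1 + \<bar>shift \<Gamma> j / spacing \<Gamma> j\<bar>"
      by linarith
    then show "norm ((of_int (index j x) - (x \<bullet> nrm j) / spacing \<Gamma> j) *\<^sub>R edge_vec j)
        \<le> (1 + \<bar>shift \<Gamma> j / spacing \<Gamma> j\<bar>) * len j"
      using \<open>j < r\<close> len_pos[OF \<open>j < r\<close>] by (simp add: mult_right_mono)
  qed
  finally show "norm (dual x - frame_op x) \<le> (\<Sum>j<r. (1 + \<bar>shift \<Gamma> j / spacing \<Gamma> j\<bar>) * len j)" .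
qed

lemma dual_near_line:
  obtains D where "\<And>t. norm (dual (x + t *\<^sub>R v) - t *\<^sub>R frame_op v) \<le> D"
proof -
  obtain E where E: "\<And>x. norm (dual x - frame_op x) \<le> E" using dual_near_frame_op by blast
  have "norm (dual (x + t *\<^sub>R v) - t *\<^sub>R frame_op v) \<le> E + norm (frame_op x)" for t
  proof -
    have "dual (x + t *\<^sub>R v) - t *\<^sub>R frame_op v =
        (dual (x + t *\<^sub>R v) - frame_op (x + t *\<^sub>R v)) + frame_op x"
      by (simp add: linear_add[OF linear_frame_op] linear_scale[OF linear_frame_op])
    then show ?thesis by (simp only: norm_triangle_mono[OF E order_refl])
  qed
  then show ?thesis by (rule that)
qed

lemma dual_close_imp_close:
  obtains D where "\<And>x y. dist (dual x) (dual y) < 1 \<Longrightarrow> norm (x - y) \<le> D"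
proof -
  obtain E where E: "\<And>x. norm (dual x - frame_op x) \<le> E" using dual_near_frame_op by blast
  obtain B where B: "B > 0" "\<And>x. B * norm x \<le> norm (frame_op x)"
    using linear_inj_bounded_below_pos[OF linear_frame_op inj_frame_op] by metis
  have "norm (x - y) \<le> (1 + 2 * E) / B" if "dist (dual x) (dual y) < 1" for x y
  proof -
    have "norm (frame_op x - frame_op y) \<le>
        norm (dual x - dual y) + norm (dual x - frame_op x) + norm (dual y - frame_op y)"
      by norm
    then have "norm (frame_op (x - y)) \<le> 1 + 2 * E"
      using E[of x] E[of y] that by (simp add: linear_diff[OF linear_frame_op] dist_norm)
    then have "B * norm (x - y) \<le> 1 + 2 * E" using B(2)[of "x - y"] by linarith
    then show ?thesis using B(1) by (simp add: field_simps)
  qed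
  then show ?thesis by (rule that)
qed

section \<open>The tiling framework is a Delone framework\<close>

abbreviation "G \<equiv> tiling_framework \<Gamma> len"

lemma joints_tiling_framework: "joints G = range dual"
  by (simp add: joints_def tiling_framework_def tiling_vertices_eq)

lemma len_le_sum: "j < r \<Longrightarrow> len j \<le> sum len {..<r}"
  using len_pos by (intro member_le_sum) (auto intro: less_imp_le)

lemma abs_index_diff_le:
  assumes "j < r"
  shows "\<bar>real_of_int (index j x - index j y)\<bar> \<le> norm (x - y) / spacing \<Gamma> j + 1"
proof -
  have "\<bar>(x - y) \<bullet> nrm j\<bar> \<le> norm (x - y)"
    using Cauchy_Schwarz_ineq2[of "x - y" "nrm j"] assms by simp
  then have "\<bar>level j x - level j y\<bar> \<le> norm (x - y) / spacing \<Gamma> j"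
    using level_diff[of j x y] spacing_pos[OF assms] by (simp add: divide_right_mono)
  then show ?thesis unfolding index_def by linarith
qed

lemma uniform_discrete_range_dual: "uniform_discrete (range dual)"
proof (rule uniform_discrete_if_finite_differences)
  obtain D where D: "\<And>x y. dist (dual x) (dual y) < 1 \<Longrightarrow> norm (x - y) \<le> D"
    using dual_close_imp_close by blast
  define Q where "Q j = \<lceil>D / spacing \<Gamma> j + 1\<rceil>" for j
  let ?M = "PiE {..<r} (\<lambda>j. {- Q j..Q j})"
  have "dual x - dual y \<in> (\<lambda>m. \<Sum>j<r. real_of_int (m j) *\<^sub>R edge_vec j) ` ?M"
    if "dist (dual x) (dual y) < 1" for x y
  proof (rule image_eqI)
    let ?m = "\<lambda>j\<in>{..<r}. index j x - index j y"
    show "dual x - dual y = (\<Sum>j<r. real_of_int (?m j) *\<^sub>R edge_vec j)"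
      unfolding dual_eq sum_subtractf[symmetric] by (intro sum.cong) (auto simp: scaleR_diff_left)
    have "index j x - index j y \<in> {- Q j..Q j}" if "j < r" for j
    proof -
      have "norm (x - y) / spacing \<Gamma> j \<le> D / spacing \<Gamma> j"
        using D[OF \<open>dist (dual x) (dual y) < 1\<close>] spacing_pos[OF that]
        by (simp add: divide_right_mono)
      then have "\<bar>real_of_int (index j x - index j y)\<bar> \<le> of_int (Q j)"
        using abs_index_diff_le[OF that, of x y] unfolding Q_def by linarith
      then show ?thesis unfolding atLeastAtMost_iff by linarith
    qed
    then show "?m \<in> ?M" by simp
  qed
  then have "{p - q | p q. p \<in> range dual \<and> q \<in> range dual \<and> dist p q < 1}
      \<subseteq> (\<lambda>m. \<Sum>j<r. real_of_int (m j) *\<^sub>R edge_vec j) ` ?M" by blast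
  then show "finite {p - q | p q. p \<in> range dual \<and> q \<in> range dual \<and> dist p q < 1}"
    by (rule finite_subset) (intro finite_imageI finite_PiE; simp)
qed

lemma Delone_set_range_dual: "Delone_set (range dual)"
proof -
  obtain E where E: "\<And>x. norm (dual x - frame_op x) \<le> E" using dual_near_frame_op by blast
  have "\<exists>y\<in>range dual. dist p y \<le> E" for p
  proof -
    obtain x where "p = frame_op x" using surj_frame_op by (metis surjD)
    then show ?thesis using E[of x] by (auto simp: dist_norm norm_minus_commute)
  qed
  then show ?thesis
    unfolding Delone_set_def relatively_dense_def using uniform_discrete_range_dual by blast
qed

lemma Delone_framework_tiling: "Delone_framework G"
proof -
  have bar: "\<exists>v\<in>range dual. \<exists>w\<in>range dual. v \<noteq> w \<and> e = {v, w}"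
    if edge: "e \<in> tiling_edges \<Gamma> len" for e
  proof -
    obtain x j where e: "e = {dual x, dual x + edge_vec j}" "j \<in> grids_at x"
      using edge unfolding tiling_edges_eq by blast
    obtain y where y: "dual y = dual x + edge_vec j" using dual_plus_edge_vec[OF e(2)] by blast
    then have "dual x \<noteq> dual y" using edge_vec_nonzero[OF grids_atD[OF e(2)]] by simp
    then show ?thesis unfolding e(1) y[symmetric] by blast
  qed
  have "norm (v - w) \<le> sum len {..<r}" if edge: "{v, w} \<in> tiling_edges \<Gamma> len" for v w
  proof -
    obtain x j where "{v, w} = {dual x, dual x + edge_vec j}" "j < r"
      using edge grids_atD unfolding tiling_edges_eq by blast
    then have "norm (v - w) = len j" by (auto simp: doubleton_eq_iff)
    then show ?thesis using len_le_sum[OF \<open>j < r\<close>] by simp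
  qed
  then show ?thesis
    unfolding Delone_framework_def bar_joint_framework_def joints_tiling_framework
    using bar countable_uniform_discrete[OF uniform_discrete_range_dual] Delone_set_range_dual
    by (auto simp: tiling_framework_def tiling_vertices_eq)
qed

section \<open>Flexes and localisation lines\<close>

definition jump :: "velocity_field \<Rightarrow> nat \<Rightarrow> real^2 \<Rightarrow> complex^2" where
  "jump u j x = u (dual x + edge_vec j) - u (dual x)"

lemma flex_iff_jump:
  "infinitesimal_flex G u \<longleftrightarrow> (\<forall>x. \<forall>j\<in>grids_at x. cdot (jump u j x) (nrm j) = 0)"
proof -
  have bar: "cdot (u v - u w) (v - w) = 0 \<longleftrightarrow> cdot (jump u j x) (nrm j) = 0"
    if "{v, w} = {dual x, dual x + edge_vec j}" "j \<in> grids_at x" for v w x j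
    using that(1) len_pos[OF grids_atD[OF that(2)]]
    by (auto simp: doubleton_eq_iff jump_def edge_vec_def)
  have "infinitesimal_flex G u \<longleftrightarrow> (\<forall>v w. {v, w} \<in> tiling_edges \<Gamma> len \<longrightarrow> cdot (u v - u w) (v - w) = 0)"
    by (simp add: infinitesimal_flex_iff_cdot tiling_framework_def)
  also have "\<dots> \<longleftrightarrow> (\<forall>x. \<forall>j\<in>grids_at x. cdot (jump u j x) (nrm j) = 0)"
  proof (intro iffI allI impI ballI)
    fix x j assume flex: "\<forall>v w. {v, w} \<in> tiling_edges \<Gamma> len \<longrightarrow> cdot (u v - u w) (v - w) = 0"
      and j: "j \<in> grids_at x"
    have "{dual x, dual x + edge_vec j} \<in> tiling_edges \<Gamma> len"
      using j unfolding tiling_edges_eq by blast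
    then show "cdot (jump u j x) (nrm j) = 0" using flex bar[OF refl j] by blast
  next
    fix v w assume flex: "\<forall>x. \<forall>j\<in>grids_at x. cdot (jump u j x) (nrm j) = 0"
      and "{v, w} \<in> tiling_edges \<Gamma> len"
    then obtain x j where "{v, w} = {dual x, dual x + edge_vec j}" "j \<in> grids_at x"
      unfolding tiling_edges_eq by blast
    then show "cdot (u v - u w) (v - w) = 0" using bar flex by blast
  qed
  finally show ?thesis .
qed

lemma flex_opposite_edges_jump_eq:
  assumes flex: "infinitesimal_flex G u" and crossing: "crossing i j z"
  shows "u (dual z + edge_vec i + edge_vec j) - u (dual z + edge_vec i) = jump u j z" (is "?l = _")
proof -
  have "i < r" "j < r" "i \<noteq> j" using crossing by (auto dest: crossingD)
  obtain z1 where z1: "dual z1 = dual z + edge_vec i" "j \<in> grids_at z1"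
    using dual_plus_edge_vec_on_grid[OF crossing] .
  obtain z2 where z2: "dual z2 = dual z + edge_vec j" "i \<in> grids_at z2"
    using dual_plus_edge_vec_on_grid[OF crossing[unfolded crossing_commute[of i j]]] .
  have left_jump: "?l = jump u j z1" by (simp add: jump_def z1(1))
  have "?l - jump u j z = jump u i z2 - jump u i z"
    by (simp add: jump_def z2(1) algebra_simps)
  moreover have "cdot (jump u i z2 - jump u i z) (nrm i) = 0"
    "cdot (jump u j z1 - jump u j z) (nrm j) = 0"
    using flex z1(2) z2(2) crossingD[OF crossing] by (simp_all add: flex_iff_jump)
  ultimately have "?l - jump u j z = 0"
    using cdot_basis_eq_0_imp[OF normals_not_parallel[OF \<open>i < r\<close> \<open>j < r\<close> \<open>i \<noteq> j\<close>]]
    unfolding left_jump by metis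
  then show ?thesis by simp
qed

lemma on_grid_along_grid: "j \<in> grids_at (x + t *\<^sub>R grid_dir j) \<longleftrightarrow> j \<in> grids_at x"
  by (simp add: grids_at_def)

lemma crossed_along_grid:
  assumes "j \<in> grids_at z"
  shows "crossed z (s *\<^sub>R grid_dir j) = {} \<or>
    (\<exists>i. crossing i j z \<and> crossed z (s *\<^sub>R grid_dir j) = {i})"
proof (cases "crossed z (s *\<^sub>R grid_dir j) = {}")
  case False
  then obtain i where i: "i \<in> crossed z (s *\<^sub>R grid_dir j)" by blast
  then have "crossing i j z" using assms by (intro crossingI) (auto simp: crossed_def)
  moreover from this have "crossed z (s *\<^sub>R grid_dir j) = {i}"
    using i by (auto simp: crossed_def crossing_def)
  ultimately show ?thesis by blast
qed simp

lemma flex_jump_along_grid: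
  assumes flex: "infinitesimal_flex G u" and j: "j \<in> grids_at x"
  shows "jump u j (x + t *\<^sub>R grid_dir j) = jump u j x"
proof -
  let ?v = "grid_dir j"
  have local_const: "\<forall>\<^sub>F b in at a. jump u j (x + a *\<^sub>R ?v) = jump u j (x + b *\<^sub>R ?v)" for a
  proof -
    let ?z = "x + a *\<^sub>R ?v"
    have "\<forall>\<^sub>F b in nhds a. jump u j ?z = jump u j (x + b *\<^sub>R ?v)"
      using dual_near_on_line[of x ?v a]
    proof eventually_elim
      case (elim b)
      consider "crossed ?z ((b - a) *\<^sub>R ?v) = {}"
        | i where "crossing i j ?z" "crossed ?z ((b - a) *\<^sub>R ?v) = {i}"
        using crossed_along_grid[of j ?z "b - a"] j on_grid_along_grid by blast
      then show ?case
      proof cases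
        case 1
        then show ?thesis using elim by (simp add: jump_def)
      next
        case 2
        then show ?thesis
          using elim flex_opposite_edges_jump_eq[OF flex 2(1)] by (simp add: jump_def)
      qed
    qed
    then show ?thesis by (simp add: eventually_at_filter eventually_mono)
  qed
  have "jump u j (x + 0 *\<^sub>R ?v) = jump u j (x + t *\<^sub>R ?v)"
    by (rule connected_local_const[of UNIV 0 t "\<lambda>t. jump u j (x + t *\<^sub>R ?v)"])
      (use local_const in auto)
  then show ?thesis by simp
qed

lemma no_jumps_imp_constant_at_corner:
  assumes no_jump: "\<And>x j. j \<in> grids_at x \<Longrightarrow> jump u j x = 0" and S: "S \<subseteq> grids_at x"
  shows "u (dual x + sum edge_vec S) = u (dual x)"
proof -
  consider "S = {}" | i where "S = {i}" "i \<in> grids_at x" | i l where "S = {i, l}" "crossing i l x"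
  proof (cases "\<exists>i\<in>S. \<exists>l\<in>S. i \<noteq> l")
    case True
    then obtain i l where "i \<in> S" "l \<in> S" "crossing i l x" using S crossingI by blast
    then have "S = {i, l}" using S by (auto simp: crossing_def)
    then show ?thesis using that(3) \<open>crossing i l x\<close> by blast
  next
    case False
    then show ?thesis using S that(1,2) by blast
  qed
  then show ?thesis
  proof cases
    case (2 i)
    then show ?thesis using no_jump[of i x] by (simp add: jump_def)
  next
    case (3 i l)
    obtain y where "dual y = dual x + edge_vec i" "l \<in> grids_at y"
      using dual_plus_edge_vec_on_grid[OF 3(2)] .
    then have "u (dual x + edge_vec i + edge_vec l) = u (dual x + edge_vec i)"
      using no_jump[of l y] by (simp add: jump_def)
    moreover have "u (dual x + edge_vec i) = u (dual x)"
      using no_jump[OF crossingD(4)[OF 3(2)]] by (simp add: jump_def)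
    ultimately show ?thesis using 3 crossingD(3)[OF 3(2)] by (simp add: add.assoc)
  qed simp
qed

lemma no_jumps_imp_constant:
  assumes "\<And>x j. j \<in> grids_at x \<Longrightarrow> jump u j x = 0"
  shows "u (dual x) = u (dual y)"
proof (rule connected_local_const[of UNIV x y "\<lambda>x. u (dual x)"])
  show "\<forall>a\<in>UNIV. \<forall>\<^sub>F b in at a. u (dual a) = u (dual b)"
  proof
    fix a
    have "\<forall>\<^sub>F b in nhds a. u (dual a) = u (dual b)"
      using dual_near[of a]
      by eventually_elim (use no_jumps_imp_constant_at_corner[OF assms] in \<open>auto simp: crossed_def\<close>)
    then show "\<forall>\<^sub>F b in at a. u (dual a) = u (dual b)"
      by (simp add: eventually_at_filter eventually_mono)
  qed
qed auto

definition ribbon_dir :: "nat \<Rightarrow> real^2" where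
  "ribbon_dir j = frame_op (grid_dir j)"

definition ribbon_line :: "nat \<Rightarrow> (real^2) set" where
  "ribbon_line j = span {ribbon_dir j}"

lemma ribbon_dir_nonzero: "j < r \<Longrightarrow> ribbon_dir j \<noteq> 0"
  unfolding ribbon_dir_def using inj_frame_op linear_frame_op normal_nonzero
  by (metis linear_injective_0 perp_eq_0_iff)

lemma dual_grid_line_leaves_strip:
  assumes "j < r" "perp t1 \<bullet> t2 \<noteq> 0" "span {t1} \<noteq> ribbon_line j"
  shows "\<exists>t. \<forall>e. norm e \<le> B \<longrightarrow> dual (x + t *\<^sub>R grid_dir j) + e \<notin> strip t1 t2 m"
proof -
  let ?f = "coordinate t2 t1"
  obtain D where D: "\<And>t. norm (dual (x + t *\<^sub>R grid_dir j) - t *\<^sub>R ribbon_dir j) \<le> D"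
    using dual_near_line unfolding ribbon_dir_def by blast
  define C where "C = norm t1 / \<bar>perp t1 \<bullet> t2\<bar>"
  have C: "\<bar>?f p\<bar> \<le> C * norm p" for p unfolding C_def by (rule abs_coordinate_le)
  have "t1 \<noteq> 0" using assms(2) by auto
  then have slope: "?f (ribbon_dir j) \<noteq> 0"
    using assms span_singleton_eq_iff_perp[of t1] ribbon_dir_nonzero
    by (simp add: coordinate_def ribbon_line_def)
  define t where "t = (\<bar>of_int m\<bar> + 1 + C * (D + B)) / ?f (ribbon_dir j)"
  have "dual (x + t *\<^sub>R grid_dir j) + e \<notin> strip t1 t2 m" if "norm e \<le> B" for e
  proof -
    let ?p = "dual (x + t *\<^sub>R grid_dir j)"
    have "\<bar>?f (?p - t *\<^sub>R ribbon_dir j + e)\<bar> \<le> C * (D + B)"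
      by (rule order_trans[OF C mult_left_mono])
        (use norm_triangle_mono[OF D that] in \<open>auto simp: C_def\<close>)
    moreover have "?f (?p + e) = ?f (?p - t *\<^sub>R ribbon_dir j + e) + t * ?f (ribbon_dir j)"
      by (simp add: coordinate_add coordinate_diff coordinate_scaleR)
    moreover have "t * ?f (ribbon_dir j) = \<bar>of_int m\<bar> + 1 + C * (D + B)"
      using slope by (simp add: t_def)
    ultimately have "?f (?p + e) \<ge> of_int m + 1" by linarith
    then show ?thesis by (simp add: strip_def) linarith
  qed
  then show ?thesis by blast
qed

lemma flex_in_strip_eq_0:
  assumes basis: "perp t1 \<bullet> t2 \<noteq> 0" and not_ribbon: "\<And>j. j < r \<Longrightarrow> span {t1} \<noteq> ribbon_line j"
    and flex: "infinitesimal_flex G u" and support: "\<And>p. p \<notin> strip t1 t2 m \<Longrightarrow> u p = 0"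
  shows "u (dual x) = 0"
proof -
  have "jump u j y = 0" if j: "j \<in> grids_at y" for y j
  proof -
    have "j < r" using j by (rule grids_atD)
    then obtain t where t: "\<And>e. norm e \<le> len j \<Longrightarrow> dual (y + t *\<^sub>R grid_dir j) + e \<notin> strip t1 t2 m"
      using dual_grid_line_leaves_strip[OF _ basis not_ribbon] by blast
    have "jump u j (y + t *\<^sub>R grid_dir j) = 0"
      using support t[of 0] t[of "edge_vec j"] len_pos[OF \<open>j < r\<close>] \<open>j < r\<close> by (simp add: jump_def)
    then show ?thesis using flex_jump_along_grid[OF flex j] by simp
  qed
  then have const: "u (dual x) = u (dual y)" for y by (rule no_jumps_imp_constant)
  have "0 < r" using two_le_grid_count by simp
  then obtain t where "\<And>e. norm e \<le> 0 \<Longrightarrow> dual (x + t *\<^sub>R grid_dir 0) + e \<notin> strip t1 t2 m"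
    using dual_grid_line_leaves_strip[OF _ basis not_ribbon] by blast
  from this[of 0] have "u (dual (x + t *\<^sub>R grid_dir 0)) = 0" by (intro support) simp
  then show ?thesis using const by metis
qed

lemma modulated_flex_direction:
  assumes basis: "perp t1 \<bullet> t2 \<noteq> 0" and "norm \<omega>1 = 1" and "u (dual x) \<noteq> 0"
    and flex: "modulated_flex G \<omega>1 t1 t2 u"
  shows "\<exists>j<r. span {t1} = ribbon_line j"
proof (rule ccontr)
  assume "\<not> (\<exists>j<r. span {t1} = ribbon_line j)"
  then have not_ribbon: "span {t1} \<noteq> ribbon_line j" if "j < r" for j using that by blast
  define m where "m = \<lfloor>coordinate t2 t1 (dual x)\<rfloor>"
  let ?U = "\<lambda>p. if p \<in> strip t1 t2 m then \<omega>1 powi \<lfloor>coordinate t1 t2 p\<rfloor> *s u p else 0"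
  have "?U (dual x) = 0"
    using flex_in_strip_eq_0[OF basis not_ribbon
        modulated_flex_restricted_to_strip[OF basis flex], of m]
    by simp
  moreover have "\<omega>1 \<noteq> 0" using \<open>norm \<omega>1 = 1\<close> by auto
  ultimately show False using \<open>u (dual x) \<noteq> 0\<close> by (simp add: strip_def m_def)
qed

lemma periodic_localisation_line_direction:
  assumes "periodic_localisation_line G H"
  shows "\<exists>j<r. H = ribbon_line j"
proof -
  obtain t1 t2 where t: "H = span {t1}" "plane_basis t1 t2"
      "\<exists>u. \<exists>\<omega>1\<in>sphere 0 1. \<exists>M1 M2. localisation_flex G t1 t2 1 \<omega>1 M1 M2 u"
    using assms unfolding periodic_localisation_line_iff by (metis zero_less_one)
  then obtain u \<omega>1 x and M1 M2 :: nat where u: "\<omega>1 \<in> sphere 0 1" "u (dual x) \<noteq> 0" "M1 > 0" "M2 > 0"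
      "modulated_flex G \<omega>1 (real M1 *\<^sub>R t1) (real M2 *\<^sub>R t2) u"
    unfolding localisation_flex_def joints_tiling_framework by blast
  have "perp (real M1 *\<^sub>R t1) \<bullet> (real M2 *\<^sub>R t2) \<noteq> 0"
    using t(2) u(3,4) by (simp add: plane_basis_iff_perp)
  then have "\<exists>j<r. span {real M1 *\<^sub>R t1} = ribbon_line j"
    using modulated_flex_direction[OF _ _ u(2,5)] u(1) by simp
  moreover have "span {real M1 *\<^sub>R t1} = span {t1}"
    using span_image_scale[of "{t1}" "\<lambda>_. real M1"] u(3) by simp
  ultimately show ?thesis using t(1) by simp
qed

section \<open>Slippage lines\<close>

lemma flex_if_orthogonal_and_constant_on_index:
  assumes "j < r" and const: "\<And>x y. index j x = index j y \<Longrightarrow> u (dual x) = u (dual y)"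
    and orthogonal: "\<And>x. cdot (u (dual x)) (nrm j) = 0"
  shows "infinitesimal_flex G u"
  unfolding flex_iff_jump
proof (intro allI ballI)
  fix x l assume l: "l \<in> grids_at x"
  obtain y where y: "dual y = dual x + edge_vec l" "corner x {l} y" using dual_plus_edge_vec[OF l] .
  show "cdot (jump u l x) (nrm l) = 0"
  proof (cases "l = j")
    case True
    then show ?thesis using orthogonal y(1)[symmetric] by (simp add: jump_def)
  next
    case False
    then have "index j y = index j x" using cornerD(2)[OF y(2) \<open>j < r\<close>] by simp
    then have "u (dual y) = u (dual x)" by (rule const)
    then show ?thesis using y(1) by (simp add: jump_def)
  qed
qed

definition transversal_dir :: "nat \<Rightarrow> real^2" where
  "transversal_dir j = frame_op (nrm j)"

abbreviation transversal_coordinate :: "nat \<Rightarrow> real^2 \<Rightarrow> real" where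
  "transversal_coordinate j \<equiv> coordinate (transversal_dir j) (ribbon_dir j)"

lemma ribbon_transversal_basis: "j < r \<Longrightarrow> perp (ribbon_dir j) \<bullet> transversal_dir j \<noteq> 0"
  unfolding ribbon_dir_def transversal_dir_def
  using linear_inj_perp_inner_nonzero[OF linear_frame_op inj_frame_op, of "grid_dir j" "nrm j"]
  by (simp add: normal_nonzero)

lemma transversal_coordinate_frame_op:
  assumes "j < r"
  shows "transversal_coordinate j (frame_op x) = nrm j \<bullet> x"
proof -
  have "grid_dir j \<bullet> grid_dir j \<noteq> 0" using normal_nonzero[OF assms] by simp
  moreover from this have "perp (frame_op (nrm j)) \<bullet> frame_op (grid_dir j) \<noteq> 0"
    by (rule linear_inj_perp_inner_nonzero[OF linear_frame_op inj_frame_op])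
  ultimately show ?thesis
    unfolding transversal_dir_def ribbon_dir_def
    using coordinate_linear_image[OF linear_frame_op]
      coordinate_perp_of_unit[OF norm_normal[OF assms]]
    by simp
qed

lemma transversal_coordinate_variation:
  assumes "j < r"
  defines "f \<equiv> transversal_coordinate j"
  obtains W where "0 \<le> W" "\<And>x y. index j x = index j y \<Longrightarrow> \<bar>f (dual x) - f (dual y)\<bar> \<le> W"
proof -
  obtain E where E: "\<And>x. norm (dual x - frame_op x) \<le> E" using dual_near_frame_op by blast
  define C where "C = norm (ribbon_dir j) / \<bar>perp (ribbon_dir j) \<bullet> transversal_dir j\<bar>"
  have near: "\<bar>f (dual x) - nrm j \<bullet> x\<bar> \<le> C * E" for x
  proof -
    have "f (dual x) - nrm j \<bullet> x = f (dual x - frame_op x)"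
      using transversal_coordinate_frame_op[OF assms(1)] by (simp add: f_def coordinate_diff)
    then show ?thesis
      using order_trans[OF abs_coordinate_le mult_left_mono[OF E]] by (simp add: f_def C_def)
  qed
  have "\<bar>f (dual x) - f (dual y)\<bar> \<le> 2 * (C * E) + spacing \<Gamma> j" if "index j x = index j y" for x y
  proof -
    have "\<bar>level j x - level j y\<bar> \<le> 1" using that unfolding index_def by linarith
    then have "\<bar>nrm j \<bullet> x - nrm j \<bullet> y\<bar> \<le> spacing \<Gamma> j"
      using level_diff[of j x y] spacing_pos[OF assms(1)]
      by (simp add: inner_diff_right inner_commute)
    then show ?thesis using near[of x] near[of y] by linarith
  qed
  moreover have "0 \<le> 2 * (C * E) + spacing \<Gamma> j"
    using near[of 0] spacing_pos[OF assms(1)] by linarith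
  ultimately show ?thesis using that by blast
qed

definition strip_index :: "nat \<Rightarrow> nat \<Rightarrow> real^2 \<Rightarrow> int" where
  "strip_index j M p = \<lfloor>coordinate (real M *\<^sub>R transversal_dir j) (ribbon_dir j) p\<rfloor>"

definition confined_to_strip :: "nat \<Rightarrow> nat \<Rightarrow> real^2 \<Rightarrow> bool" where
  "confined_to_strip j M x \<longleftrightarrow>
     (\<forall>y. index j y = index j x \<longrightarrow> strip_index j M (dual y) = strip_index j M (dual x))"

text \<open>The strips of the phase field are cut out by straight lines, while the flexes of the tiling
  jump across ribbons, which follow these lines only up to a bounded distance. Hence the constant
  velocity field is set to zero between two consecutive ribbons that are not confined to one strip.\<close>

definition slip_field :: "nat \<Rightarrow> nat \<Rightarrow> velocity_field" where
  "slip_field j M p =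
     (if \<exists>x. dual x = p \<and> confined_to_strip j M x then const_velocity (grid_dir j) p else 0)"

lemma confined_to_strip_cong:
  "index j x = index j y \<Longrightarrow> confined_to_strip j M x \<longleftrightarrow> confined_to_strip j M y"
  unfolding confined_to_strip_def by metis

lemma slip_field_dual:
  assumes "j < r"
  shows "slip_field j M (dual x) =
    (if confined_to_strip j M x then const_velocity (grid_dir j) (dual x) else 0)"
proof -
  have "(\<exists>y. dual y = dual x \<and> confined_to_strip j M y) \<longleftrightarrow> confined_to_strip j M x"
    using confined_to_strip_cong dual_eq_imp_index_eq[OF _ assms] by blast
  then show ?thesis by (simp add: slip_field_def)
qed

lemma slip_field_weighted_flex:
  assumes "j < r"
  shows "infinitesimal_flex G (\<lambda>p. g (strip_index j M p) *s slip_field j M p)"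
proof (rule flex_if_orthogonal_and_constant_on_index[OF assms])
  show "g (strip_index j M (dual x)) *s slip_field j M (dual x) =
      g (strip_index j M (dual y)) *s slip_field j M (dual y)" if "index j x = index j y" for x y
  proof (cases "confined_to_strip j M x")
    case True
    then have "strip_index j M (dual y) = strip_index j M (dual x)"
      using that[symmetric] unfolding confined_to_strip_def by blast
    then show ?thesis
      using confined_to_strip_cong[OF that]
      by (simp add: slip_field_dual[OF assms] const_velocity_def)
  next
    case False
    then show ?thesis
      using confined_to_strip_cong[OF that] by (simp add: slip_field_dual[OF assms])
  qed
  show "cdot (g (strip_index j M (dual x)) *s slip_field j M (dual x)) (nrm j) = 0" for x
    by (simp add: slip_field_dual[OF assms] const_velocity_def cdot_vec2)
qed

lemma slip_field_eq_const_off_bands: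
  assumes "j < r" "M > 0"
    and W: "\<And>x y. index j x = index j y \<Longrightarrow>
      \<bar>transversal_coordinate j (dual x) - transversal_coordinate j (dual y)\<bar> \<le> W"
    and w: "\<And>p. w \<bullet> p = transversal_coordinate j p"
    and "dual x \<notin> bands w W (real M)"
  shows "slip_field j M (dual x) = const_velocity (grid_dir j) (dual x)"
proof -
  have floor: "strip_index j M p = \<lfloor>(w \<bullet> p) / real M\<rfloor>" for p
    by (simp add: strip_index_def coordinate_scaleR_vector w)
  have "strip_index j M (dual y) = strip_index j M (dual x)" if "index j y = index j x" for y
  proof (rule ccontr)
    assume "strip_index j M (dual y) \<noteq> strip_index j M (dual x)"
    then obtain m :: int where
      "\<bar>(w \<bullet> dual x) / real M - of_int m\<bar> \<le> \<bar>(w \<bullet> dual x) / real M - (w \<bullet> dual y) / real M\<bar>"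
      using floor_neq_imp_of_int_near unfolding floor by metis
    moreover have "(w \<bullet> dual x) / real M - of_int m = (w \<bullet> dual x - of_int m * real M) / real M"
      using \<open>M > 0\<close> by (simp add: diff_divide_distrib)
    ultimately have "\<bar>w \<bullet> dual x - of_int m * real M\<bar> \<le> \<bar>w \<bullet> dual x - w \<bullet> dual y\<bar>"
      using \<open>M > 0\<close> by (simp add: divide_le_cancel flip: diff_divide_distrib)
    then have "\<bar>w \<bullet> dual x - of_int m * real M\<bar> \<le> W"
      using W[OF that[symmetric]] by (simp add: w)
    then show False using \<open>dual x \<notin> bands w W (real M)\<close> by (auto simp: bands_def)
  qed
  then have "confined_to_strip j M x" unfolding confined_to_strip_def by blast
  then show ?thesis by (simp add: slip_field_dual[OF assms(1)])
qed

lemma slippage_flex_slip_field: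
  assumes "j < r" "0 < \<epsilon>"
  shows "\<exists>M. slippage_flex G (ribbon_dir j) (transversal_dir j) (grid_dir j) \<epsilon> M (slip_field j M)"
proof -
  let ?t1 = "ribbon_dir j" and ?t2 = "transversal_dir j"
  define w where "w = (1 / (perp ?t1 \<bullet> ?t2)) *\<^sub>R perp ?t1"
  have basis: "perp ?t1 \<bullet> ?t2 \<noteq> 0" by (rule ribbon_transversal_basis[OF assms(1)])
  then have "w \<noteq> 0" by (auto simp: w_def)
  have w: "w \<bullet> p = coordinate ?t2 ?t1 p" for p by (simp add: w_def coordinate_def)
  obtain W where W: "0 \<le> W"
      "\<And>x y. index j x = index j y \<Longrightarrow> \<bar>coordinate ?t2 ?t1 (dual x) - coordinate ?t2 ?t1 (dual y)\<bar> \<le> W"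
    using transversal_coordinate_variation[OF assms(1)] by blast
  obtain M :: nat and N0 where M: "M > 0" and sparse: "\<And>N c. N \<ge> N0 \<Longrightarrow>
      real (card (window (range dual) c N \<inter> bands w W (real M)))
          < \<epsilon> * real (card (window (range dual) c N))"
    using Delone_sparse_bands[OF Delone_set_range_dual \<open>w \<noteq> 0\<close> W(1) assms(2)] by blast
  let ?\<phi> = "\<lambda>\<omega>. phase_field 1 \<omega> ?t1 (real M *\<^sub>R ?t2)" and ?u = "slip_field j M"
  have \<phi>: "?\<phi> \<omega> p = \<omega> powi strip_index j M p" for \<omega> p
    using phase_field_eq[of ?t1 "real M *\<^sub>R ?t2"] basis M by (simp add: strip_index_def)
  have "infinitesimal_flex G (modulation (?\<phi> \<omega>) ?u)" for \<omega>
    unfolding modulation_def \<phi> by (rule slip_field_weighted_flex[OF assms(1)])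
  moreover have "infinitesimal_flex G ?u"
    using slip_field_weighted_flex[OF assms(1), of "\<lambda>_. 1"] by simp
  moreover have "mostly_close (joints G) \<epsilon> (modulation (?\<phi> \<omega>) ?u)
      (modulation (?\<phi> \<omega>) (const_velocity (grid_dir j)))" for \<omega>
    unfolding joints_tiling_framework
  proof (rule mostly_close_off_sparse_set[OF uniform_discrete_range_dual _ _ sparse])
    fix p assume "p \<in> range dual" "p \<notin> bands w W (real M)"
    then show "modulation (?\<phi> \<omega>) ?u p = modulation (?\<phi> \<omega>) (const_velocity (grid_dir j)) p"
      using slip_field_eq_const_off_bands[OF assms(1) M W(2) w] by (auto simp: modulation_def)
  qed (use assms(2) in auto)
  ultimately show ?thesis unfolding slippage_flex_def modulated_flex_def using M by blast
qed

lemma ribbon_line_slippage: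
  assumes "j < r"
  shows "periodic_slippage_line G (ribbon_line j)"
proof -
  have "plane_basis (ribbon_dir j) (transversal_dir j)"
    using ribbon_transversal_basis[OF assms] by (simp add: plane_basis_iff_perp)
  moreover have "grid_dir j \<noteq> 0" using normal_nonzero[OF assms] by simp
  ultimately show ?thesis
    unfolding periodic_slippage_line_iff ribbon_line_def
    using Delone_framework_tiling slippage_flex_slip_field[OF assms] by blast
qed

lemma PSF_eq: "PSF G = (\<Union>j<r. ribbon_line j)"
  unfolding PSF_def
  using ribbon_line_slippage slippage_imp_localisation periodic_localisation_line_direction by blast

lemma PLLF_eq: "PLLF G = (\<Union>j<r. ribbon_line j)"
  unfolding PLLF_def
  using ribbon_line_slippage slippage_imp_localisation periodic_localisation_line_direction by blast

section \<open>Ribbons\<close>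

lemma eq_along_grid_if_level_eq:
  assumes "j < r" "level j y = level j x"
  shows "\<exists>t. y = x + t *\<^sub>R grid_dir j"
proof -
  have "nrm j \<bullet> (y - x) = 0"
    using assms by (simp add: level_eq_level_iff inner_commute)
  then have "y - x = (grid_dir j \<bullet> (y - x)) *\<^sub>R grid_dir j"
    using unit_perp_expansion[OF norm_normal[OF assms(1)], of "y - x"] by simp
  then show ?thesis by (metis add.commute diff_add_cancel)
qed

lemma tiles_along_grid_near_ribbon_line:
  assumes "j < r"
  obtains R where "\<And>t i p. crossing i j (x + t *\<^sub>R grid_dir j) \<Longrightarrow>
    p \<in> tile_at \<Gamma> len (x + t *\<^sub>R grid_dir j) \<Longrightarrow> infdist p (ribbon_line j) \<le> R"
proof -
  obtain D where D: "\<And>t. norm (dual (x + t *\<^sub>R grid_dir j) - t *\<^sub>R ribbon_dir j) \<le> D"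
    using dual_near_line unfolding ribbon_dir_def by blast
  have "infdist p (ribbon_line j) \<le> sum len {..<r} + sum len {..<r} + D"
    if ij: "crossing i j (x + t *\<^sub>R grid_dir j)"
      and p: "p \<in> tile_at \<Gamma> len (x + t *\<^sub>R grid_dir j)" for t i p
  proof -
    let ?q = "dual (x + t *\<^sub>R grid_dir j)"
    have "dist ?q p \<le> norm (edge_vec i) + norm (edge_vec j)"
      using p parallelogram_subset_cball unfolding tile_at_crossing[OF ij]
      by (auto simp: subset_iff)
    then have "dist p ?q \<le> sum len {..<r} + sum len {..<r}"
      using crossingD(1,2)[OF ij] len_le_sum[of i] len_le_sum[of j] by (simp add: dist_commute)
    then have "dist p (t *\<^sub>R ribbon_dir j) \<le> sum len {..<r} + sum len {..<r} + D"
      using dist_triangle[of p "t *\<^sub>R ribbon_dir j" ?q] D[of t] by (simp add: dist_norm)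
    moreover have "t *\<^sub>R ribbon_dir j \<in> ribbon_line j"
      unfolding ribbon_line_def by (intro span_mul span_base) simp
    ultimately show ?thesis by (rule infdist_le2[rotated])
  qed
  then show ?thesis by (rule that)
qed

lemma finite_tiles_in_bounded_set:
  assumes "bounded S"
  shows "finite {P \<in> tiling_tiles \<Gamma> len. P \<subseteq> S}"
proof -
  have "{P \<in> tiling_tiles \<Gamma> len. P \<subseteq> S}
      \<subseteq> (\<lambda>(p, i, j). parallelogram p (edge_vec i) (edge_vec j)) `
          ((range dual \<inter> S) \<times> {..<r} \<times> {..<r})"
  proof clarify
    fix P assume "P \<in> tiling_tiles \<Gamma> len" "P \<subseteq> S"
    then obtain x i j where ij: "crossing i j x"
      and P: "P = parallelogram (dual x) (edge_vec i) (edge_vec j)"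
      using tile_at_crossing unfolding tiling_tiles_eq by auto
    then have "dual x \<in> S" using \<open>P \<subseteq> S\<close> corner_in_parallelogram by blast
    then show "P \<in> (\<lambda>(p, i, j). parallelogram p (edge_vec i) (edge_vec j)) `
        ((range dual \<inter> S) \<times> {..<r} \<times> {..<r})"
      using crossingD(1,2)[OF ij] by (intro image_eqI[of _ _ "(dual x, i, j)"]) (simp_all add: P)
  qed
  moreover have "finite (range dual \<inter> S)"
    using uniform_discrete_range_dual assms by (rule finite_uniform_discrete_Int_bounded)
  ultimately show ?thesis by (auto intro: finite_subset)
qed

lemma ribbon_unbounded:
  assumes "ribbon (tiling_tiles \<Gamma> len) T"
  shows "\<not> bounded (\<Union> (range T))"
proof
  assume "bounded (\<Union> (range T))"
  then have "finite {P \<in> tiling_tiles \<Gamma> len. P \<subseteq> \<Union> (range T)}" by (rule finite_tiles_in_bounded_set)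
  moreover have "range T \<subseteq> {P \<in> tiling_tiles \<Gamma> len. P \<subseteq> \<Union> (range T)}" "inj T"
    using assms by (auto simp: ribbon_def)
  ultimately show False using finite_subset finite_imageD infinite_UNIV_int by blast
qed

abbreviation "edge_from p j \<equiv> closed_segment p (p + edge_vec j)"

lemma translated_edges_same_grid:
  assumes "i < r" "j < r" "edge_from p i = (+) c ` edge_from q j"
  shows "i = j"
proof (rule ccontr)
  assume "i \<noteq> j"
  have "{p, p + edge_vec i} = {c + q, c + (q + edge_vec j)}"
    using assms(3) unfolding closed_segment_translation[symmetric] by simp
  then have "edge_vec i = edge_vec j \<or> edge_vec i = - edge_vec j"
    by (auto simp: doubleton_eq_iff algebra_simps add_eq_0_iff)
  then show False
    using edge_vecs_not_parallel[OF assms(1,2) \<open>i \<noteq> j\<close>] by auto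
qed

lemma edge_of_tile:
  assumes ij: "crossing i j x" and e: "e edge_of tile_at \<Gamma> len x"
  shows "\<exists>l z. l \<in> grids_at x \<and> e = edge_from (dual z) l \<and> index l z = index l x"
proof -
  have side: "\<exists>z. e = edge_from (dual z) k \<and> index k z = index k x"
    if kl: "crossing k l x" and e: "e = edge_from (dual x) k \<or>
      e = edge_from (dual x + edge_vec l) k" for k l
  proof -
    obtain y where y: "dual y = dual x + edge_vec l" "corner x {l} y"
      using dual_plus_edge_vec[OF crossingD(5)[OF kl]] .
    then have "index k y = index k x" using cornerD(2)[OF y(2)] crossingD[OF kl] by simp
    then show ?thesis using e unfolding y(1)[symmetric] by blast
  qed
  have "perp (edge_vec i) \<bullet> edge_vec j \<noteq> 0" using edge_vecs_not_parallel crossingD[OF ij] by blast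
  from edge_of_parallelogramD[OF e[unfolded tile_at_crossing[OF ij]] this]
  show ?thesis
    using side[OF ij] side[OF ij[unfolded crossing_commute[of i j]]] crossingD(4,5)[OF ij] by blast
qed

lemma edge_of_tile_parallel_to:
  assumes "crossing i k x" "e edge_of tile_at \<Gamma> len x"
    and "j < r" and parallel: "e = (+) c ` edge_from q j"
  shows "j \<in> grids_at x \<and> (\<exists>z. e = edge_from (dual z) j \<and> index j z = index j x)"
proof -
  obtain l z where l: "l \<in> grids_at x" "e = edge_from (dual z) l" "index l z = index l x"
    using edge_of_tile[OF assms(1,2)] by blast
  moreover have "l = j"
    using translated_edges_same_grid[OF grids_atD[OF l(1)] \<open>j < r\<close>] parallel l(2) by metis
  ultimately show ?thesis by blast
qed

lemma ribbon_on_grid_line: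
  assumes "ribbon (tiling_tiles \<Gamma> len) T"
  obtains j x where "\<And>n. \<exists>i. crossing i j (x n) \<and> T n = tile_at \<Gamma> len (x n)"
    "\<And>n. level j (x n) = level j (x 0)"
proof -
  obtain e where T: "range T \<subseteq> tiling_tiles \<Gamma> len"
    and e: "\<And>n. e n edge_of T n" "\<And>n. e n edge_of T (n + 1)" "\<And>n m. \<exists>c. e m = (+) c ` e n"
    using assms unfolding ribbon_def by blast
  have "\<exists>x i l. crossing i l x \<and> T n = tile_at \<Gamma> len x" for n
    using T unfolding tiling_tiles_eq by blast
  then obtain x where x: "\<And>n. \<exists>i l. crossing i l (x n) \<and> T n = tile_at \<Gamma> len (x n)" by metis
  obtain j z0 where j: "j < r" "e 0 = edge_from (dual z0) j"
    using x[of 0] edge_of_tile[of _ _ "x 0" "e 0"] e(1)[of 0] grids_atD by metis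
  have edge: "j \<in> grids_at (x n) \<and> (\<exists>z. e m = edge_from (dual z) j \<and> index j z = index j (x n))"
    if "e m edge_of T n" for m n
    using x[of n] that e(3)[of m 0] edge_of_tile_parallel_to[OF _ _ j(1)] unfolding j(2) by metis
  have on_j: "j \<in> grids_at (x n)" for n using edge[OF e(1)] by blast
  have step: "index j (x (n + 1)) = index j (x n)" for n
  proof -
    obtain z z' where "e n = edge_from (dual z) j" "index j z = index j (x n)"
      "e n = edge_from (dual z') j" "index j z' = index j (x (n + 1))"
      using edge[OF e(1)[of n]] edge[OF e(2)[of n]] by blast
    then show ?thesis
      using closed_segment_same_vector_eqD[OF _ edge_vec_nonzero[OF j(1)]]
        dual_eq_imp_index_eq[OF _ j(1)]
      by metis
  qed
  have "index j (x n) = index j (x 0)" for n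
  proof (induction n rule: int_induct[where k = 0])
    case (step2 n)
    then show ?case using step[of "n - 1"] by simp
  qed (simp_all add: step)
  then have "level j (x n) = level j (x 0)" for n using level_eq_index[OF on_j] by simp
  moreover have "\<exists>i. crossing i j (x n) \<and> T n = tile_at \<Gamma> len (x n)" for n
  proof -
    obtain i l where il: "crossing i l (x n)" "T n = tile_at \<Gamma> len (x n)" using x by blast
    then have "j = i \<or> j = l" using on_j[of n] by (simp add: crossing_def)
    then show ?thesis using il crossing_commute by blast
  qed
  ultimately show ?thesis using that by blast
qed

text \<open>A ribbon stays close to the line of its grid. If it stayed close to another line as well, it
  would lie in the bounded intersection of two strips.\<close>

lemma ribbon_direction:
  assumes ribbon: "ribbon (tiling_tiles \<Gamma> len) T" and "origin_line H"
    and near: "\<forall>p\<in>\<Union> (range T). infdist p H \<le> R"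
  shows "\<exists>j<r. H = ribbon_line j"
proof -
  obtain j x where tile: "\<And>n. \<exists>i. crossing i j (x n) \<and> T n = tile_at \<Gamma> len (x n)"
    and level: "\<And>n. level j (x n) = level j (x 0)"
    using ribbon_on_grid_line[OF ribbon] by blast
  have "j < r" using tile[of 0] crossingD(2) by blast
  obtain R' where R': "\<And>t i p. crossing i j (x 0 + t *\<^sub>R grid_dir j) \<Longrightarrow>
      p \<in> tile_at \<Gamma> len (x 0 + t *\<^sub>R grid_dir j) \<Longrightarrow> infdist p (ribbon_line j) \<le> R'"
    using tiles_along_grid_near_ribbon_line[OF \<open>j < r\<close>] by blast
  have near_ribbon_line: "infdist p (ribbon_line j) \<le> R'" if "p \<in> T n" for p n
    using tile[of n] eq_along_grid_if_level_eq[OF \<open>j < r\<close> level[of n]] R' that by metis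
  obtain v where v: "v \<noteq> 0" "H = span {v}" using \<open>origin_line H\<close> by (auto simp: origin_line_def)
  have "H = ribbon_line j"
  proof (rule ccontr)
    assume "H \<noteq> ribbon_line j"
    then have "perp v \<bullet> ribbon_dir j \<noteq> 0"
      using span_singleton_eq_iff_perp[OF v(1) ribbon_dir_nonzero[OF \<open>j < r\<close>]] v(2)
      by (simp add: ribbon_line_def)
    then have "bounded ({p. infdist p H \<le> R} \<inter> {p. infdist p (ribbon_line j) \<le> R'})"
      unfolding v(2) ribbon_line_def by (rule bounded_Int_strips)
    then have "bounded (\<Union> (range T))"
      by (rule bounded_subset) (use near near_ribbon_line in auto)
    then show False using ribbon_unbounded[OF ribbon] by contradiction
  qed
  then show ?thesis using \<open>j < r\<close> by blast
qed

lemma dual_constant_between_crossings: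
  assumes j: "j \<in> grids_at x"
    and no_crossing: "\<And>t i. a < t \<Longrightarrow> t < b \<Longrightarrow> \<not> crossing i j (x + t *\<^sub>R grid_dir j)"
    and in_interval: "s \<in> {a<..<b}" "t \<in> {a<..<b}"
  shows "dual (x + s *\<^sub>R grid_dir j) = dual (x + t *\<^sub>R grid_dir j)"
proof (rule connected_local_const[of "{a<..<b}" s t "\<lambda>t. dual (x + t *\<^sub>R grid_dir j)"],
    rule connected_Ioo, rule in_interval, rule in_interval, rule ballI)
  fix c assume between: "c \<in> {a<..<b}"
  let ?z = "x + c *\<^sub>R grid_dir j"
  have "crossed ?z ((t - c) *\<^sub>R grid_dir j) = {}" for t
    using crossed_along_grid[of j ?z "t - c"] no_crossing between j
    by (auto simp: on_grid_along_grid)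
  then have "\<forall>\<^sub>F t in nhds c. dual ?z = dual (x + t *\<^sub>R grid_dir j)"
    using dual_near_on_line[of x "grid_dir j" c] by (auto elim!: eventually_mono)
  then show "\<forall>\<^sub>F t in at c within {a<..<b}. dual ?z = dual (x + t *\<^sub>R grid_dir j)"
    by (simp add: eventually_at_filter eventually_mono)
qed

lemma tile_between_adjacent_sides:
  assumes ij: "crossing i j z"
  defines "side \<equiv> \<lambda>t. dual (z + t *\<^sub>R grid_dir j)"
  obtains \<delta> where "\<delta> > 0" "\<And>s t. - \<delta> < s \<Longrightarrow> s < 0 \<Longrightarrow> 0 < t \<Longrightarrow> t < \<delta> \<Longrightarrow>
    perp (edge_vec j) \<bullet> side s < perp (edge_vec j) \<bullet> side t \<and>
    tile_at \<Gamma> len z = parallelogram (side s) (edge_vec j) (side t - side s)"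
proof -
  have indices: "i < r" "j < r" "i \<noteq> j" using ij by (auto dest: crossingD)
  obtain \<delta> where "\<delta> > 0" and \<delta>: "\<And>t. \<bar>t\<bar> < \<delta> \<Longrightarrow>
      side t = dual z + sum edge_vec (crossed z (t *\<^sub>R grid_dir j))"
    using dual_near_on_line[where s = 0 and x = z and v = "grid_dir j"]
    unfolding eventually_nhds_metric side_def by auto
  have crossed: "crossed z (t *\<^sub>R grid_dir j) =
      (if 0 < t * (grid_dir j \<bullet> nrm i) then {i} else {})" for t
    using ij by (auto simp: crossed_def crossing_def)
  have tile: "tile_at \<Gamma> len z = parallelogram (dual z) (edge_vec j) (edge_vec i)"
    using tile_at_crossing[of j i z] ij by (simp add: crossing_commute)
  have product: "perp (edge_vec j) \<bullet> edge_vec i = len j * len i * (grid_dir j \<bullet> nrm i)"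
    by (simp add: edge_vec_def)
  have pos: "0 < len j * len i" using len_pos indices by simp
  have "perp (edge_vec j) \<bullet> side s < perp (edge_vec j) \<bullet> side t \<and>
      tile_at \<Gamma> len z = parallelogram (side s) (edge_vec j) (side t - side s)"
    if "- \<delta> < s" "s < 0" "0 < t" "t < \<delta>" for s t
  proof (cases "0 < grid_dir j \<bullet> nrm i")
    case True
    then have "side s = dual z" "side t = dual z + edge_vec i"
      using \<delta>[of s] \<delta>[of t] that by (simp_all add: crossed zero_less_mult_iff)
    moreover have "0 < perp (edge_vec j) \<bullet> edge_vec i"
      unfolding product using pos True by (rule mult_pos_pos)
    ultimately show ?thesis by (simp add: tile inner_add_right)
  next
    case False
    then have neg: "grid_dir j \<bullet> nrm i < 0"
      using normals_not_parallel[OF indices(2,1)] indices(3) by (simp add: less_le)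
    then have "side s = dual z + edge_vec i" "side t = dual z"
      using \<delta>[of s] \<delta>[of t] that by (simp_all add: crossed zero_less_mult_iff)
    moreover have "perp (edge_vec j) \<bullet> edge_vec i < 0"
      unfolding product using pos neg by (rule mult_pos_neg)
    ultimately show ?thesis by (simp add: tile inner_add_right parallelogram_shift)
  qed
  then show ?thesis using that \<open>\<delta> > 0\<close> by blast
qed

lemma tile_between_constant_sides:
  assumes ij: "crossing i j (x + \<theta> *\<^sub>R grid_dir j)" and "a < \<theta>" "\<theta> < b"
    and left: "\<And>t. a < t \<Longrightarrow> t < \<theta> \<Longrightarrow> dual (x + t *\<^sub>R grid_dir j) = p"
    and right: "\<And>t. \<theta> < t \<Longrightarrow> t < b \<Longrightarrow> dual (x + t *\<^sub>R grid_dir j) = q"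
  shows "perp (edge_vec j) \<bullet> p < perp (edge_vec j) \<bullet> q \<and>
    tile_at \<Gamma> len (x + \<theta> *\<^sub>R grid_dir j) = parallelogram p (edge_vec j) (q - p)"
proof -
  have shift: "x + \<theta> *\<^sub>R grid_dir j + t *\<^sub>R grid_dir j = x + (\<theta> + t) *\<^sub>R grid_dir j" for t
    by (simp add: algebra_simps)
  obtain \<delta> where "\<delta> > 0" and sides: "\<And>s t. - \<delta> < s \<Longrightarrow> s < 0 \<Longrightarrow> 0 < t \<Longrightarrow> t < \<delta> \<Longrightarrow>
      perp (edge_vec j) \<bullet> dual (x + (\<theta> + s) *\<^sub>R grid_dir j)
        < perp (edge_vec j) \<bullet> dual (x + (\<theta> + t) *\<^sub>R grid_dir j) \<and>
      tile_at \<Gamma> len (x + \<theta> *\<^sub>R grid_dir j) =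
        parallelogram (dual (x + (\<theta> + s) *\<^sub>R grid_dir j)) (edge_vec j)
          (dual (x + (\<theta> + t) *\<^sub>R grid_dir j) - dual (x + (\<theta> + s) *\<^sub>R grid_dir j))"
    using tile_between_adjacent_sides[OF ij] unfolding shift by blast
  define s where "s = max (- \<delta>) (a - \<theta>) / 2"
  define t where "t = min \<delta> (b - \<theta>) / 2"
  have s: "- \<delta> < s" "s < 0" "a < \<theta> + s"
    using \<open>a < \<theta>\<close> \<open>\<delta> > 0\<close> unfolding s_def by (auto simp: max_def field_simps)
  have t: "0 < t" "t < \<delta>" "\<theta> + t < b"
    using \<open>\<theta> < b\<close> \<open>\<delta> > 0\<close> unfolding t_def by (auto simp: min_def field_simps)
  show ?thesis using sides[OF s(1,2) t(1,2)] left[of "\<theta> + s"] right[of "\<theta> + t"] s t by simp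
qed

lemma crossing_along_grid_iff:
  assumes "j \<in> grids_at x"
  shows "crossing i j (x + t *\<^sub>R grid_dir j) \<longleftrightarrow>
    i < r \<and> i \<noteq> j \<and> level i x + (grid_dir j \<bullet> nrm i) / spacing \<Gamma> i * t \<in> \<int>"
proof -
  have "crossing i j (x + t *\<^sub>R grid_dir j) \<longleftrightarrow> i \<in> grids_at (x + t *\<^sub>R grid_dir j) \<and> i \<noteq> j"
    using assms crossingI crossingD on_grid_along_grid by metis
  then show ?thesis by (auto simp: grids_at_def level_add mult.commute)
qed

lemma enumerate_crossings_along_grid:
  assumes j: "j \<in> grids_at x"
  obtains \<theta> :: "int \<Rightarrow> real" where "\<And>n. \<exists>i. crossing i j (x + \<theta> n *\<^sub>R grid_dir j)"
    "\<And>n. \<theta> n < \<theta> (n + 1)"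
    "\<And>n t i. \<theta> n < t \<Longrightarrow> t < \<theta> (n + 1) \<Longrightarrow> \<not> crossing i j (x + t *\<^sub>R grid_dir j)"
proof -
  define X where "X = {t. \<exists>i. crossing i j (x + t *\<^sub>R grid_dir j)}"
  have "j < r" using j by (rule grids_atD)
  define slope where "slope i = (grid_dir j \<bullet> nrm i) / spacing \<Gamma> i" for i
  have slope: "slope i \<noteq> 0" if "i < r" "i \<noteq> j" for i
    using normals_not_parallel[OF \<open>j < r\<close> that(1)] spacing_pos[OF that(1)] that(2)
    by (simp add: slope_def)
  have X: "t \<in> X \<longleftrightarrow> (\<exists>i<r. i \<noteq> j \<and> level i x + slope i * t \<in> \<int>)" for t
    by (auto simp: X_def crossing_along_grid_iff[OF j] slope_def)
  obtain l where l: "l < r" "l \<noteq> j"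
    using two_le_grid_count that[of 0] that[of 1] by fastforce
  obtain \<theta> :: "int \<Rightarrow> real" where \<theta>: "\<And>n. \<theta> n \<in> X" "\<And>n. \<theta> n < \<theta> (n + 1)"
      "\<And>n. X \<inter> {\<theta> n<..<\<theta> (n + 1)} = {}"
  proof (rule locally_finite_enumeration[of X])
    fix a b
    have "X \<inter> {a..b} \<subseteq> (\<Union>i\<in>{..<r} - {j}. {t \<in> {a..b}. level i x + slope i * t \<in> \<int>})"
      by (auto simp: X)
    moreover have "finite (\<Union>i\<in>{..<r} - {j}. {t \<in> {a..b}. level i x + slope i * t \<in> \<int>})"
      using finite_affine_in_Ints[OF slope] by blast
    ultimately show "finite (X \<inter> {a..b})" by (rule finite_subset)
  next
    fix a
    show "\<exists>t>a. t \<in> X" "\<exists>t<a. t \<in> X"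
      using ex_gt_affine_in_Ints[OF slope[OF l]] ex_lt_affine_in_Ints[OF slope[OF l]] l unfolding X
      by blast+
  qed (rule that)
  have "\<not> crossing i j (x + t *\<^sub>R grid_dir j)" if "\<theta> n < t" "t < \<theta> (n + 1)" for n t i
    using \<theta>(3)[of n] that by (auto simp: X_def)
  then show ?thesis using that[of \<theta>] \<theta>(1,2) by (simp add: X_def)
qed

lemma ribbon_along_grid:
  assumes j: "j \<in> grids_at x"
  obtains \<theta> where "ribbon (tiling_tiles \<Gamma> len) (\<lambda>n. tile_at \<Gamma> len (x + \<theta> n *\<^sub>R grid_dir j))"
    "\<And>n. \<exists>i. crossing i j (x + \<theta> n *\<^sub>R grid_dir j)"
proof -
  let ?y = "\<lambda>t. x + t *\<^sub>R grid_dir j"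
  obtain \<theta> :: "int \<Rightarrow> real" where crossing: "\<And>n. \<exists>i. crossing i j (?y (\<theta> n))"
    and less: "\<And>n. \<theta> n < \<theta> (n + 1)"
    and no_crossing: "\<And>n t i. \<theta> n < t \<Longrightarrow> t < \<theta> (n + 1) \<Longrightarrow> \<not> crossing i j (?y t)"
    using enumerate_crossings_along_grid[OF j] by blast
  define q where "q n = dual (?y ((\<theta> (n - 1) + \<theta> n) / 2))" for n
  have q: "dual (?y t) = q n" if "\<theta> (n - 1) < t" "t < \<theta> n" for n t
    unfolding q_def
    by (rule dual_constant_between_crossings[OF j, of "\<theta> (n - 1)" "\<theta> n"])
      (use that no_crossing[of "n - 1"] less[of "n - 1"] in auto)
  have tile: "perp (edge_vec j) \<bullet> q n < perp (edge_vec j) \<bullet> q (n + 1) \<and>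
      tile_at \<Gamma> len (?y (\<theta> n)) = parallelogram (q n) (edge_vec j) (q (n + 1) - q n)" for n
  proof -
    obtain i where "crossing i j (?y (\<theta> n))" using crossing by blast
    then show ?thesis
      by (rule tile_between_constant_sides[where a = "\<theta> (n - 1)" and b = "\<theta> (n + 1)"])
        (use less[of "n - 1"] less[of n] q[of n] q[of "n + 1"] in auto)
  qed
  have "tile_at \<Gamma> len (?y (\<theta> n)) \<in> tiling_tiles \<Gamma> len" for n
    using crossing unfolding tiling_tiles_eq by blast
  then have "ribbon (tiling_tiles \<Gamma> len) (\<lambda>n. tile_at \<Gamma> len (?y (\<theta> n)))"
    using ribbon_of_stacked_parallelograms[of "edge_vec j" q] tile by simp
  then show ?thesis using crossing by (rule that)
qed

lemma ex_ribbon_near_ribbon_line: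
  assumes "j < r"
  shows "\<exists>T. ribbon (tiling_tiles \<Gamma> len) T \<and> (\<exists>R. \<forall>p\<in>\<Union> (range T). infdist p (ribbon_line j) \<le> R)"
proof -
  define x where "x = (- shift \<Gamma> j) *\<^sub>R nrm j"
  have "level j x = 0" using assms by (simp add: level_def x_def dot_square_norm)
  then have "j \<in> grids_at x" using assms by (simp add: grids_at_def)
  then obtain \<theta> where \<theta>: "ribbon (tiling_tiles \<Gamma> len) (\<lambda>n. tile_at \<Gamma> len (x + \<theta> n *\<^sub>R grid_dir j))"
    "\<And>n. \<exists>i. crossing i j (x + \<theta> n *\<^sub>R grid_dir j)"
    using ribbon_along_grid by blast
  obtain R where "\<And>t i p. crossing i j (x + t *\<^sub>R grid_dir j) \<Longrightarrow>
      p \<in> tile_at \<Gamma> len (x + t *\<^sub>R grid_dir j) \<Longrightarrow> infdist p (ribbon_line j) \<le> R"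
    using tiles_along_grid_near_ribbon_line[OF assms] by blast
  then show ?thesis using \<theta> by blast
qed

lemma ribbon_figure_eq: "ribbon_figure (tiling_tiles \<Gamma> len) = (\<Union>j<r. ribbon_line j)"
proof
  show "ribbon_figure (tiling_tiles \<Gamma> len) \<subseteq> (\<Union>j<r. ribbon_line j)"
    unfolding ribbon_figure_def
  proof (rule Union_least, elim CollectE conjE exE)
    fix H T R assume "origin_line H" "ribbon (tiling_tiles \<Gamma> len) T"
          "\<forall>p\<in>\<Union> (range T). infdist p H \<le> R"
    then obtain j where "j < r" "H = ribbon_line j" using ribbon_direction by blast
    then show "H \<subseteq> (\<Union>j<r. ribbon_line j)" by blast
  qed
  have "origin_line (ribbon_line j)" if "j < r" for j
    unfolding origin_line_def ribbon_line_def using ribbon_dir_nonzero[OF that] by blast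
  then show "(\<Union>j<r. ribbon_line j) \<subseteq> ribbon_figure (tiling_tiles \<Gamma> len)"
    unfolding ribbon_figure_def
    by (intro UN_least Union_upper CollectI conjI ex_ribbon_near_ribbon_line) simp_all
qed

end

theorem theorem4p16:
  fixes \<Gamma> :: multigrid and len :: "nat \<Rightarrow> real" and a1 a2 :: "real^2"
  assumes "regular_multigrid \<Gamma>"
    and "\<forall>j<grid_count \<Gamma>. len j > 0"
    and "plane_basis a1 a2"
  shows "limit_spectrum (tiling_framework \<Gamma> len) a1 a2
           = slippage_spectrum (tiling_framework \<Gamma> len) a1 a2 \<and>
         slippage_spectrum (tiling_framework \<Gamma> len) a1 a2
           = reciprocal_figure a1 a2 (ribbon_figure (tiling_tiles \<Gamma> len))"
proof -
  interpret multigrid_tiling \<Gamma> len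
    using assms by unfold_locales auto
  show ?thesis
    unfolding limit_spectrum_def slippage_spectrum_def PSF_eq PLLF_eq ribbon_figure_eq by simp
qed

end
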